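(* Let $n,n'\ge1$ and $d\ge2$ be integers. Given an $n'$-tuple $r=(r_1,\ldots,r_{n'})$ of real polynomials in $n$ variables of degree at most $d$, let $\mu_r$ be the measure on the graph of $r$ (as a subset of $\mathbb{R}^n\times\mathbb{R}^{n'}$) given by $$\int\varphi(x,y)\,d\mu_r(x,y):=\int_{\mathbb{R}^n}\varphi\big(t,r_1(t),\ldots,r_{n'}(t)\big)\,dt .$$ Then given any $f\in L^p(\mathbb{R}^n\times\mathbb{R}^{n'})$, $p:=1+\frac{n'd}{n+1}$, $$\|f\star\mu_r\|_{L^q(\mathbb{R}^n\times\mathbb{R}^{n'})}<\infty$$ for almost every $r$, where $q:=\binom{n+d}{d}\,p$.
   Context: "Almost every $r$" is with respect to Lebesgue measure on the finite-dimensional space of coefficients of $n'$-tuples of polynomials in $n$ variables of degree at most $d$. Here $f\star\mu_r(x,y)=\int_{\mathbb{R}^n}f(x-t,\,y-r(t))\,dt$ is the convolution of $f$ with $\mu_r$. *)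

theory Defs
  imports "HOL-Analysis.Analysis"
begin

section \<open>Tuples of polynomials and their coefficient space\<close>

text \<open>
  A polynomial of degree at most \<open>d\<close> in variables indexed by \<open>'n\<close> is the family of its
  coefficients, indexed by the exponent vectors of total degree at most \<open>d\<close>.
\<close>

definition exponents :: "nat \<Rightarrow> ('n::finite \<Rightarrow> nat) set" where
  "exponents d = {\<alpha>. (\<Sum>i\<in>UNIV. \<alpha> i) \<le> d}"

lemma finite_exponents [simp]: "finite (exponents d :: ('n::finite \<Rightarrow> nat) set)"
proof (rule finite_subset)
  have "\<alpha> i \<le> (\<Sum>i\<in>UNIV. \<alpha> i)" for \<alpha> :: "'n \<Rightarrow> nat" and i
    by (rule member_le_sum) simp_all
  then show "exponents d \<subseteq> (UNIV :: 'n set) \<rightarrow>\<^sub>E {..d}"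
    unfolding exponents_def PiE_UNIV_domain by (blast intro: order_trans)
qed (rule finite_PiE; simp)

definition poly_tuple ::
  "nat \<Rightarrow> ('m::finite \<times> ('n::finite \<Rightarrow> nat) \<Rightarrow> real) \<Rightarrow> real ^ 'n \<Rightarrow> real ^ 'm" where
  "poly_tuple d c t = (\<chi> j. \<Sum>\<alpha>\<in>exponents d. c (j, \<alpha>) * (\<Prod>i\<in>UNIV. (t $ i) ^ \<alpha> i))"

text \<open>
  Lebesgue measure on the space of coefficients of \<open>CARD('m)\<close>-tuples of such polynomials. It is
  not completed, which makes no difference for almost-everywhere statements.
\<close>

definition coeff_measure ::
  "nat \<Rightarrow> ('m::finite \<times> ('n::finite \<Rightarrow> nat) \<Rightarrow> real) measure" where
  "coeff_measure d = Pi\<^sub>M (UNIV \<times> exponents d) (\<lambda>_. lborel)"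

lemma continuous_on_poly_tuple: "continuous_on A (poly_tuple d c)"
  unfolding poly_tuple_def by (intro continuous_intros)

section \<open>The measure on a graph and convolution with it\<close>

text \<open>
  The measure is completed so that Lebesgue measurable functions, and not only Borel measurable
  ones, can be convolved with it; the lemmas below confirm the expected integral formulas.
\<close>

definition graph_measure ::
  "('a::euclidean_space \<Rightarrow> 'b::euclidean_space) \<Rightarrow> ('a \<times> 'b) measure" where
  "graph_measure r = completion (distr lborel borel (\<lambda>t. (t, r t)))"

definition conv ::
  "('a::real_normed_vector \<Rightarrow> 'b::{banach, second_countable_topology}) \<Rightarrow> 'a measure \<Rightarrow> 'a \<Rightarrow> 'b"
  where "conv f \<mu> z = (LINT w|\<mu>. f (z - w))"

lemma measurable_graph:
  fixes r :: "'a::euclidean_space \<Rightarrow> 'b::euclidean_space"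
  assumes "continuous_on UNIV r"
  shows "(\<lambda>t. (t, r t)) \<in> borel_measurable borel"
  by (intro borel_measurable_continuous_onI continuous_intros assms)

lemma AE_graph_measure_iff:
  fixes r :: "'a::euclidean_space \<Rightarrow> 'b::euclidean_space"
  assumes r: "continuous_on UNIV r"
  shows "(AE w in graph_measure r. P w) \<longleftrightarrow> (AE t in lebesgue. P (t, r t))"
proof -
  let ?g = "\<lambda>t. (t, r t)"
  have g [measurable]: "?g \<in> lborel \<rightarrow>\<^sub>M borel" using measurable_graph[OF r] by simp
  have rm [measurable]: "r \<in> borel_measurable borel"
    using r by (rule borel_measurable_continuous_onI)
  have "(AE w in distr lborel borel ?g. P w)" if P: "AE t in lborel. P (t, r t)"
  proof -
    obtain N where N: "{t \<in> space lborel. \<not> P (t, r t)} \<subseteq> N" "N \<in> null_sets lborel"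
      using P by (auto elim!: AE_E simp: null_sets_def)
    have [measurable]: "N \<in> sets borel" using N(2) by auto
    have "AE w in distr lborel borel ?g. fst w \<notin> N \<and> snd w = r (fst w)"
    proof (subst AE_distr_iff)
      show "{w \<in> space borel. fst w \<notin> N \<and> snd w = r (fst w)} \<in> sets (borel :: ('a \<times> 'b) measure)"
        unfolding borel_prod[symmetric] by measurable
      show "AE t in lborel. fst (?g t) \<notin> N \<and> snd (?g t) = r (fst (?g t))"
        using AE_not_in[OF N(2)] by simp
    qed (rule g)
    then show ?thesis
    proof (rule AE_mp, intro AE_I2 impI)
      fix w assume "fst w \<notin> N \<and> snd w = r (fst w)"
      then show "P w" using N(1) by (cases w) auto
    qed
  qed
  then show ?thesis
    unfolding graph_measure_def AE_completion_iff
    using AE_distrD[OF g] by blast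
qed

lemma graph_measure_eq_distr:
  fixes r :: "'a::euclidean_space \<Rightarrow> 'b::euclidean_space"
  assumes r: "continuous_on UNIV r"
  shows "graph_measure r = distr lebesgue (graph_measure r) (\<lambda>t. (t, r t))"
proof -
  let ?g = "\<lambda>t. (t, r t)"
  let ?D = "distr lborel borel ?g"
  have g: "?g \<in> lborel \<rightarrow>\<^sub>M borel" using measurable_graph[OF r] by simp
  then have gD: "?g \<in> lborel \<rightarrow>\<^sub>M ?D" by simp
  have "distr lebesgue ?D ?g = distr lborel ?D ?g"
    by (rule distr_completion[OF gD])
  also have "\<dots> = ?D" by (rule distr_cong) auto
  finally have D: "distr lebesgue ?D ?g = ?D" .
  show ?thesis
    using completion.completion_distr_eq[OF measurable_completion[OF gD]]
    unfolding graph_measure_def D by blast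
qed

lemma measurable_graph_lebesgue:
  fixes r :: "'a::euclidean_space \<Rightarrow> 'b::euclidean_space"
  assumes r: "continuous_on UNIV r"
  shows "(\<lambda>t. (t, r t)) \<in> lebesgue \<rightarrow>\<^sub>M graph_measure r"
proof -
  let ?g = "\<lambda>t. (t, r t)"
  let ?D = "distr lborel borel ?g"
  have "?g \<in> lborel \<rightarrow>\<^sub>M ?D" using measurable_graph[OF r] by simp
  then have gD: "?g \<in> lebesgue \<rightarrow>\<^sub>M ?D" by (rule measurable_completion)
  have "distr lebesgue ?D ?g = ?D"
    using distr_completion[of ?g lborel ?D] measurable_graph[OF r]
    by (auto intro: distr_cong)
  then show ?thesis
    unfolding graph_measure_def by (intro completion.measurable_completion2[OF gD]) simp
qed

lemma sets_graph_measure_iff: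
  fixes r :: "'a::euclidean_space \<Rightarrow> 'b::euclidean_space"
  assumes r: "continuous_on UNIV r"
  shows "A \<in> sets (graph_measure r) \<longleftrightarrow> {t. (t, r t) \<in> A} \<in> sets lebesgue"
proof
  assume "A \<in> sets (graph_measure r)"
  from measurable_sets[OF measurable_graph_lebesgue[OF r] this]
  show "{t. (t, r t) \<in> A} \<in> sets lebesgue" by (simp add: vimage_def)
next
  assume A: "{t. (t, r t) \<in> A} \<in> sets lebesgue" (is "?B \<in> _")
  define S where "S = main_part lborel ?B"
  have S: "S \<in> sets borel" using main_part_sets[OF A] by (simp add: S_def)
  have "AE t in lebesgue. t \<in> S \<longleftrightarrow> (t, r t) \<in> A"
    using AE_in_main_part[OF A] unfolding AE_completion_iff S_def by auto
  then have *: "AE w in graph_measure r. w \<in> S \<times> UNIV \<longleftrightarrow> w \<in> A"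
    by (simp add: AE_graph_measure_iff[OF r])
  have "S \<times> UNIV \<in> sets (borel :: ('a \<times> 'b) measure)"
    unfolding borel_prod[symmetric] using S by auto
  then have **: "S \<times> UNIV \<in> sets (graph_measure r)"
    unfolding graph_measure_def by auto
  show "A \<in> sets (graph_measure r)"
    using completion.in_sets_AE[of "S \<times> UNIV" A "distr lborel borel (\<lambda>t. (t, r t))"] * **
    unfolding graph_measure_def by simp
qed

lemma graph_measure_measurable_iff:
  fixes r :: "'a::euclidean_space \<Rightarrow> 'b::euclidean_space"
    and \<phi> :: "'a \<times> 'b \<Rightarrow> 'c::topological_space"
  assumes r: "continuous_on UNIV r"
  shows "\<phi> \<in> borel_measurable (graph_measure r) \<longleftrightarrow>
    (\<lambda>t. \<phi> (t, r t)) \<in> borel_measurable lebesgue"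
proof
  assume "\<phi> \<in> borel_measurable (graph_measure r)"
  from measurable_compose[OF measurable_graph_lebesgue[OF r] this]
  show "(\<lambda>t. \<phi> (t, r t)) \<in> borel_measurable lebesgue" .
next
  assume L: "(\<lambda>t. \<phi> (t, r t)) \<in> borel_measurable lebesgue"
  have space_graph: "space (graph_measure r) = UNIV" by (simp add: graph_measure_def)
  show "\<phi> \<in> borel_measurable (graph_measure r)"
  proof (rule measurableI)
    fix B :: "'c set" assume "B \<in> sets borel"
    from measurable_sets[OF L this]
    show "\<phi> -` B \<inter> space (graph_measure r) \<in> sets (graph_measure r)"
      by (simp add: sets_graph_measure_iff[OF r] vimage_def space_graph)
  next
    fix w assume "w \<in> space (graph_measure r)"
    show "\<phi> w \<in> space borel" by simp
  qed
qed

lemma integrable_graph_measure_iff: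
  fixes r :: "'a::euclidean_space \<Rightarrow> 'b::euclidean_space"
    and \<phi> :: "'a \<times> 'b \<Rightarrow> 'c::{banach, second_countable_topology}"
  assumes r: "continuous_on UNIV r"
  shows "integrable (graph_measure r) \<phi> \<longleftrightarrow> integrable lebesgue (\<lambda>t. \<phi> (t, r t))"
proof (cases "\<phi> \<in> borel_measurable (graph_measure r)")
  case True
  then show ?thesis
    using integrable_distr_eq[OF measurable_graph_lebesgue[OF r], of \<phi>]
    by (simp flip: graph_measure_eq_distr[OF r])
next
  case False
  then show ?thesis
    using graph_measure_measurable_iff[OF r, of \<phi>] by auto
qed

lemma integral_graph_measure:
  fixes r :: "'a::euclidean_space \<Rightarrow> 'b::euclidean_space"
    and \<phi> :: "'a \<times> 'b \<Rightarrow> 'c::{banach, second_countable_topology}"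
  assumes r: "continuous_on UNIV r"
  shows "(LINT w|graph_measure r. \<phi> w) = (LINT t|lebesgue. \<phi> (t, r t))"
proof (cases "\<phi> \<in> borel_measurable (graph_measure r)")
  case True
  then show ?thesis
    using integral_distr[OF measurable_graph_lebesgue[OF r], of \<phi>]
    by (simp flip: graph_measure_eq_distr[OF r])
next
  case False
  then show ?thesis
    using graph_measure_measurable_iff[OF r, of \<phi>]
    by (metis borel_measurable_integrable not_integrable_integral_eq)
qed

lemma conv_graph_measure:
  fixes r :: "'a::euclidean_space \<Rightarrow> 'b::euclidean_space"
    and f :: "'a \<times> 'b \<Rightarrow> 'c::{banach, second_countable_topology}"
  assumes r: "continuous_on UNIV r"
  shows "conv f (graph_measure r) (x, y) = (LINT t|lebesgue. f (x - t, y - r t))"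
  by (simp add: conv_def integral_graph_measure[OF r])

section \<open>Lebesgue norms\<close>

text \<open>
  The norm is extended-valued, and is intended for measurable \<open>f\<close> and \<open>1 \<le> p < \<infinity>\<close>. The infinite
  case is separate because \<^const>\<open>powr\<close> is not available on \<^typ>\<open>ennreal\<close>.
\<close>

definition Lp_norm :: "'a measure \<Rightarrow> real \<Rightarrow> ('a \<Rightarrow> 'b::real_normed_vector) \<Rightarrow> ennreal" where
  "Lp_norm M p f =
    (let I = \<integral>\<^sup>+ x. ennreal (norm (f x) powr p) \<partial>M
     in if I = \<infinity> then \<infinity> else ennreal (enn2real I powr (1 / p)))"

definition Lp_space :: "'a measure \<Rightarrow> real \<Rightarrow> ('a \<Rightarrow> 'b::real_normed_vector) set" where
  "Lp_space M p = {f \<in> borel_measurable M. Lp_norm M p f < \<infinity>}"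

end

theory Submission
  imports Defs "HOL-Computational_Algebra.Fundamental_Theorem_Algebra"
begin

text \<open>
  For an \<open>n'\<close>-tuple \<open>s\<close> of polynomials put \<open>T s = \<integral> \<bar>f (t, s t)\<bar> dt\<close>, and let \<open>N\<close> be the binomial
  coefficient in \<open>q = N p\<close>, the number of monomials of degree at most \<open>d\<close>. The heart of the
  matter is that \<open>(T s)\<^sup>q\<close> is integrable over the whole coefficient space. For \<open>u t = \<bar>f (t, s t)\<bar>\<close>,
  the power \<open>(\<integral> u)\<^sup>q\<close> is bounded by a constant times
  \<open>\<integral> \<Prod>k. u (t\<^sub>k)\<^sup>p \<bar>det D\<bar>\<^sup>n\<^sup>' dt\<^sub>1 \<dots> dt\<^sub>N\<close>, where \<open>D\<close> is the generalised Vandermonde matrix of the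
  points \<open>t\<^sub>k\<close>. Since \<open>s\<close> depends linearly on its values at the \<open>t\<^sub>k\<close>, with Jacobian \<open>\<bar>det D\<bar>\<^sup>n\<^sup>'\<close>,
  integrating this bound over \<open>s\<close> gives \<open>(\<integral> \<bar>f\<bar>\<^sup>p)\<^sup>N\<close>.

  The determinant is treated as a product of pivots of Gaussian elimination. The \<open>k\<close>-th pivot is a
  lexicographically monic polynomial in \<open>t\<^sub>k\<close>, so the multilinear integral is at least the product of
  the minimal moments \<open>\<integral> \<bar>P\<bar>\<^sup>n\<^sup>' u\<^sup>p\<close> over monic \<open>P\<close> with the given leading monomials. A nearly optimal
  family, scaled so that all its moments agree, has a maximum \<open>M\<close> for which \<open>\<integral> M\<^sup>n\<^sup>' u\<^sup>p\<close> is controlled,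
  while \<open>M powr (- (n + 1) / d)\<close> has integral bounded independently of the family: replacing each
  polynomial by its leading monomial, one variable at a time, does not shrink sublevel sets by
  more than a constant factor. Balancing the two bounds \<open>\<integral> u\<close>.

  Finally \<open>f \<star> \<mu>\<^sub>r (x, y)\<close> is bounded by \<open>T s\<close> for \<open>s t = y - r (x - t)\<close>. These reflections act on the
  coefficient space as measure preserving involutions, and for \<open>d \<ge> 2\<close> almost every orbit meets
  a set of polynomials, smeared out to a weight, in a set of translations of finite measure.
  Hence integrability over all \<open>s\<close> implies integrability over almost every orbit.
\<close>


section \<open>Gaussian elimination and integrals over products\<close>

interpretation PL: product_sigma_finite "\<lambda>_. lborel :: 'b::euclidean_space measure"
  by standard

lemma sigma_finite_PiM_lborel [simp]:
  "finite I \<Longrightarrow> sigma_finite_measure (PiM I (\<lambda>_. lborel :: 'b::euclidean_space measure))"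
  by (rule PL.sigma_finite)

lemma nn_integral_lborel_shift:
  fixes c :: "'b::euclidean_space"
  assumes [measurable]: "F \<in> borel_measurable borel"
  shows "(\<integral>\<^sup>+x. F (c + x) \<partial>lborel) = (\<integral>\<^sup>+x. F x \<partial>lborel)"
  by (subst (2) lborel_distr_plus[of c, symmetric], subst nn_integral_distr) auto

lemma nn_integral_lborel_scale:
  fixes c :: real and F :: "'b::euclidean_space \<Rightarrow> ennreal"
  assumes [measurable]: "F \<in> borel_measurable borel" and c: "c \<noteq> 0"
  shows "ennreal (\<bar>c\<bar> ^ DIM('b)) * (\<integral>\<^sup>+x. F (c *\<^sub>R x) \<partial>lborel) = (\<integral>\<^sup>+x. F x \<partial>lborel)"
  using c
  by (subst (2) lborel_affine[OF c, of 0], subst nn_integral_density)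
     (auto simp: nn_integral_cmult nn_integral_distr)

text \<open>
  Row \<open>k\<close> is used to clear column \<open>k\<close>. A vanishing pivot is harmless: then the division yields
  \<open>0\<close>, and the pivot also occurs as a factor.
\<close>

fun elim :: "(nat \<Rightarrow> nat \<Rightarrow> real) \<Rightarrow> nat \<Rightarrow> nat \<Rightarrow> nat \<Rightarrow> real" where
  "elim A 0 l i = A l i"
| "elim A (Suc k) l i = elim A k l i - elim A k l k / elim A k k k * elim A k k i"

text \<open>There are no row exchanges: when none of the first \<open>N\<close> pivots vanishes,
  their product is the determinant of the leading \<open>N\<close> by \<open>N\<close>
  block.\<close>

definition pivot :: "(nat \<Rightarrow> nat \<Rightarrow> real) \<Rightarrow> nat \<Rightarrow> real" where
  "pivot A k = elim A k k k"

text \<open>Elimination only adds multiples of the first \<open>k\<close> rows, and these multiples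
  are read off the first \<open>k\<close> columns. A matrix \<open>A'\<close> sharing those columns
  has the same multipliers, so the \<open>k\<close>-th pivot is a fixed combination, monic in row
  \<open>k\<close>, of the entries of column \<open>k\<close>.\<close>

lemma elim_combination:
  "\<exists>a. \<forall>A'. (\<forall>r. \<forall>j<k. A' r j = A r j) \<longrightarrow>
     (\<forall>i. elim A' k l i = A' l i + (\<Sum>r<k. a r * A' r i))"
proof (induction k arbitrary: l)
  case 0
  show ?case by simp
next
  case (Suc k)
  obtain a where a: "\<And>A'. (\<forall>r. \<forall>j<k. A' r j = A r j) \<Longrightarrow>
     (\<forall>i. elim A' k l i = A' l i + (\<Sum>r<k. a r * A' r i))"
    using Suc[of l] by blast
  obtain b where b: "\<And>A'. (\<forall>r. \<forall>j<k. A' r j = A r j) \<Longrightarrow>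
     (\<forall>i. elim A' k k i = A' k i + (\<Sum>r<k. b r * A' r i))"
    using Suc[of k] by blast
  \<comment> \<open>The new multiplier sits in column \<open>k\<close>, which the hypothesis for
    \<open>Suc k\<close> freezes. Row \<open>k\<close> has itself been combined with earlier rows,
    hence the terms \<open>b r\<close> in \<open>c\<close>.\<close>
  define q where "q = elim A k l k / elim A k k k"
  define c where "c r = (if r = k then - q else a r - q * b r)" for r
  show ?case
  proof (intro exI[of _ c] allI impI)
    fix A' :: "nat \<Rightarrow> nat \<Rightarrow> real" and i
    assume A': "\<forall>r. \<forall>j<Suc k. A' r j = A r j"
    then have A'': "\<forall>r. \<forall>j<k. A' r j = A r j" by simp
    have e: "elim A' k m k = elim A k m k" if "m = l \<or> m = k" for m
      using that a[OF A''] a[of A] b[OF A''] b[of A] A' by auto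
    have "elim A' (Suc k) l i = elim A' k l i - q * elim A' k k i"
      by (simp add: q_def e)
    also have "\<dots> = A' l i + (\<Sum>r<Suc k. c r * A' r i)"
      using a[OF A''] b[OF A'']
      by (simp add: c_def algebra_simps sum.distrib sum_subtractf sum_distrib_left)
    finally show "elim A' (Suc k) l i = A' l i + (\<Sum>r<Suc k. c r * A' r i)" .
  qed
qed

text \<open>A pivot row of a lower triangular matrix vanishes to the right of the diagonal, so its
  subtraction leaves all later columns alone. At \<open>k = l = i\<close> this identifies the pivots
  with the diagonal entries.\<close>

lemma elim_triangular:
  assumes "\<And>k i. k < i \<Longrightarrow> A k i = 0" "k \<le> i"
  shows "elim A k l i = A l i"
  using assms(2) by (induction k arbitrary: l) (auto simp: assms(1) Suc_le_eq)

lemma elim_uminus: "elim (\<lambda>l i. - A l i) k l i = - elim A k l i"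
  by (induction k arbitrary: l i) auto

lemma pivot_uminus: "pivot (\<lambda>l i. - A l i) k = - pivot A k"
  by (simp add: pivot_def elim_uminus)

lemma measurable_elim [measurable (raw)]:
  assumes [measurable]: "\<And>l i. (\<lambda>x. A x l i) \<in> borel_measurable M"
  shows "(\<lambda>x. elim (A x) k l i) \<in> borel_measurable M"
  by (induction k arbitrary: l i) auto

lemma measurable_pivot [measurable (raw)]:
  assumes "\<And>l i. (\<lambda>x. A x l i) \<in> borel_measurable M"
  shows "(\<lambda>x. pivot (A x) k) \<in> borel_measurable M"
  unfolding pivot_def using assms by (rule measurable_elim)

text \<open>A linear change of variables, one elimination step at a time. The variable
  \<open>c k\<close> is translated so that form \<open>k\<close> depends on it alone; scaling by the
  pivot gives one Jacobian factor, and the other forms are left with the matrix of the next step.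
  The power \<open>DIM('b)\<close> arises because the unknowns are vectors.\<close>

lemma nn_integral_elim:
  fixes F :: "nat \<Rightarrow> 'b::euclidean_space \<Rightarrow> ennreal"
  assumes "k \<le> N"
    and "\<And>i. F i \<in> borel_measurable borel"
    and piv: "\<And>i. i < N \<Longrightarrow> pivot A i \<noteq> 0"
  shows "(\<Prod>i\<in>{k..<N}. ennreal (\<bar>pivot A i\<bar> ^ DIM('b))) *
      (\<integral>\<^sup>+c. (\<Prod>i\<in>{k..<N}. F i (\<Sum>l\<in>{k..<N}. elim A k l i *\<^sub>R c l)) \<partial>PiM {k..<N} (\<lambda>_. lborel))
    = (\<Prod>i\<in>{k..<N}. \<integral>\<^sup>+y. F i y \<partial>lborel)"
  using assms(1,2)
proof (induction arbitrary: F rule: inc_induct)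
  case base
  show ?case by (simp add: PL.nn_integral_empty del: nn_integral_const)
next
  case (step k)
  let ?M = "PiM {Suc k..<N} (\<lambda>_. lborel :: 'b measure)"
  let ?p = "elim A k k k"
  note [measurable] = \<open>\<And>i. F i \<in> borel_measurable borel\<close>
  have p: "?p \<noteq> 0" using piv[of k] step by (simp add: pivot_def)
  have ins: "{k..<N} = insert k {Suc k..<N}" using step by auto
  have mm: "(\<lambda>c. \<Prod>i\<in>{k..<N}. F i (\<Sum>l\<in>{k..<N}. elim A k l i *\<^sub>R c l))
      \<in> borel_measurable (PiM (insert k {Suc k..<N}) (\<lambda>_. lborel))"
    unfolding ins by measurable
  define R where "R c i = (\<Sum>l\<in>{Suc k..<N}. elim A (Suc k) l i *\<^sub>R c l)" for c :: "nat \<Rightarrow> 'b" and i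
  have Rm [measurable]: "(\<lambda>c. R c i) \<in> borel_measurable ?M" for i
    unfolding R_def by measurable
  have split: "(\<Prod>i\<in>{k..<N}. F i (\<Sum>l\<in>{k..<N}. elim A k l i *\<^sub>R (c(k := y)) l)) =
      F k (?p *\<^sub>R y + (\<Sum>l\<in>{Suc k..<N}. elim A k l k *\<^sub>R c l)) *
      (\<Prod>i\<in>{Suc k..<N}. F i (elim A k k i *\<^sub>R y + (\<Sum>l\<in>{Suc k..<N}. elim A k l i *\<^sub>R c l)))"
    for c y
  proof -
    have s: "(\<Sum>l\<in>{k..<N}. elim A k l i *\<^sub>R (c(k := y)) l) =
      elim A k k i *\<^sub>R y + (\<Sum>l\<in>{Suc k..<N}. elim A k l i *\<^sub>R c l)" for i
      unfolding ins by (subst sum.insert) (auto intro!: sum.cong)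
    show ?thesis unfolding s unfolding ins by (subst prod.insert) auto
  qed
  have inner: "(\<integral>\<^sup>+y. (\<Prod>i\<in>{k..<N}. F i (\<Sum>l\<in>{k..<N}. elim A k l i *\<^sub>R (c(k := y)) l)) \<partial>lborel) =
      (\<integral>\<^sup>+y. F k (?p *\<^sub>R y) * (\<Prod>i\<in>{Suc k..<N}. F i (elim A k k i *\<^sub>R y + R c i)) \<partial>lborel)" for c
  proof -
    \<comment> \<open>Translating \<open>c k\<close> by \<open>v\<close> cancels the other unknowns
      in form \<open>k\<close> and turns the entries of the other forms into those of
      \<open>elim A (Suc k)\<close>.\<close>
    define v where "v = - (\<Sum>l\<in>{Suc k..<N}. (elim A k l k / ?p) *\<^sub>R c l)"
    have v: "elim A k k i *\<^sub>R (v + y) + (\<Sum>l\<in>{Suc k..<N}. elim A k l i *\<^sub>R c l) =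
       elim A k k i *\<^sub>R y + R c i" for i y
      by (simp add: v_def R_def algebra_simps scaleR_sum_right sum.distrib sum_subtractf sum_negf)
    have R0: "R c k = 0" using p by (simp add: R_def)
    let ?f = "\<lambda>y. F k (?p *\<^sub>R y + (\<Sum>l\<in>{Suc k..<N}. elim A k l k *\<^sub>R c l)) *
      (\<Prod>i\<in>{Suc k..<N}. F i (elim A k k i *\<^sub>R y + (\<Sum>l\<in>{Suc k..<N}. elim A k l i *\<^sub>R c l)))"
    have "(\<integral>\<^sup>+y. ?f (v + y) \<partial>lborel) = (\<integral>\<^sup>+y. ?f y \<partial>lborel)"
      by (rule nn_integral_lborel_shift) simp
    then show ?thesis
      unfolding split v by (simp add: R0)
  qed
  have [measurable]: "(\<lambda>y. \<integral>\<^sup>+c. (\<Prod>i\<in>{Suc k..<N}. F i (elim A k k i *\<^sub>R y + R c i)) \<partial>?M)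
      \<in> borel_measurable borel"
    by (rule sigma_finite_measure.borel_measurable_nn_integral) (simp, measurable)
  \<comment> \<open>For fixed \<open>y\<close> the induction hypothesis applies to translates of the
    \<open>F i\<close>; translation invariance then removes \<open>y\<close> from the right
    side.\<close>
  have IH: "(\<Prod>i\<in>{Suc k..<N}. ennreal (\<bar>pivot A i\<bar> ^ DIM('b))) *
     (\<integral>\<^sup>+c. (\<Prod>i\<in>{Suc k..<N}. F i (elim A k k i *\<^sub>R y + R c i)) \<partial>?M) =
     (\<Prod>i\<in>{Suc k..<N}. \<integral>\<^sup>+y. F i y \<partial>lborel)" for y
  proof -
    have "(\<Prod>i\<in>{Suc k..<N}. ennreal (\<bar>pivot A i\<bar> ^ DIM('b))) *
     (\<integral>\<^sup>+c. (\<Prod>i\<in>{Suc k..<N}. F i (elim A k k i *\<^sub>R y + R c i)) \<partial>?M) =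
     (\<Prod>i\<in>{Suc k..<N}. \<integral>\<^sup>+x. F i (elim A k k i *\<^sub>R y + x) \<partial>lborel)"
      unfolding R_def by (rule step.IH) simp
    then show ?thesis by (simp add: nn_integral_lborel_shift)
  qed
  let ?P = "\<Prod>i\<in>{Suc k..<N}. ennreal (\<bar>pivot A i\<bar> ^ DIM('b))"
  have "(\<integral>\<^sup>+c. (\<Prod>i\<in>{k..<N}. F i (\<Sum>l\<in>{k..<N}. elim A k l i *\<^sub>R c l)) \<partial>PiM {k..<N} (\<lambda>_. lborel)) =
     (\<integral>\<^sup>+c. \<integral>\<^sup>+y. (\<Prod>i\<in>{k..<N}. F i (\<Sum>l\<in>{k..<N}. elim A k l i *\<^sub>R (c(k := y)) l)) \<partial>lborel \<partial>?M)"
    using PL.product_nn_integral_insert[OF _ _ mm] unfolding ins[symmetric] by simp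
  also have "\<dots> = (\<integral>\<^sup>+c. \<integral>\<^sup>+y. F k (?p *\<^sub>R y) *
      (\<Prod>i\<in>{Suc k..<N}. F i (elim A k k i *\<^sub>R y + R c i)) \<partial>lborel \<partial>?M)"
    unfolding inner ..
  also have "\<dots> = (\<integral>\<^sup>+y. \<integral>\<^sup>+c. F k (?p *\<^sub>R y) *
      (\<Prod>i\<in>{Suc k..<N}. F i (elim A k k i *\<^sub>R y + R c i)) \<partial>?M \<partial>lborel)"
    by (rule pair_sigma_finite.Fubini')
       (simp_all add: pair_sigma_finite.intro sigma_finite_lborel, measurable)
  also have "\<dots> = (\<integral>\<^sup>+y. F k (?p *\<^sub>R y) *
      (\<integral>\<^sup>+c. (\<Prod>i\<in>{Suc k..<N}. F i (elim A k k i *\<^sub>R y + R c i)) \<partial>?M) \<partial>lborel)"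
    by (intro nn_integral_cong nn_integral_cmult) measurable
  finally have "?P * (\<integral>\<^sup>+c. (\<Prod>i\<in>{k..<N}. F i (\<Sum>l\<in>{k..<N}. elim A k l i *\<^sub>R c l))
        \<partial>PiM {k..<N} (\<lambda>_. lborel)) =
      ?P * (\<integral>\<^sup>+y. F k (?p *\<^sub>R y) *
      (\<integral>\<^sup>+c. (\<Prod>i\<in>{Suc k..<N}. F i (elim A k k i *\<^sub>R y + R c i)) \<partial>?M) \<partial>lborel)"
    by simp
  also have "\<dots> = (\<integral>\<^sup>+y. F k (?p *\<^sub>R y) * (?P *
      (\<integral>\<^sup>+c. (\<Prod>i\<in>{Suc k..<N}. F i (elim A k k i *\<^sub>R y + R c i)) \<partial>?M)) \<partial>lborel)"
    by (subst nn_integral_cmult[symmetric]) (simp_all add: mult_ac)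
  also have "\<dots> = (\<integral>\<^sup>+y. F k (?p *\<^sub>R y) \<partial>lborel) * (\<Prod>i\<in>{Suc k..<N}. \<integral>\<^sup>+y. F i y \<partial>lborel)"
    unfolding IH by (rule nn_integral_multc) simp
  finally have "ennreal (\<bar>?p\<bar> ^ DIM('b)) * (?P *
      (\<integral>\<^sup>+c. (\<Prod>i\<in>{k..<N}. F i (\<Sum>l\<in>{k..<N}. elim A k l i *\<^sub>R c l)) \<partial>PiM {k..<N} (\<lambda>_. lborel)))
    = (ennreal (\<bar>?p\<bar> ^ DIM('b)) * (\<integral>\<^sup>+y. F k (?p *\<^sub>R y) \<partial>lborel)) *
      (\<Prod>i\<in>{Suc k..<N}. \<integral>\<^sup>+y. F i y \<partial>lborel)"
    by (simp add: mult.assoc)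
  also have "ennreal (\<bar>?p\<bar> ^ DIM('b)) * (\<integral>\<^sup>+y. F k (?p *\<^sub>R y) \<partial>lborel) = (\<integral>\<^sup>+y. F k y \<partial>lborel)"
    by (rule nn_integral_lborel_scale) (simp_all add: p)
  finally show ?case
    by (subst (1 5) ins) (simp add: pivot_def mult.assoc)
qed

lemma nn_integral_matrix:
  fixes F :: "nat \<Rightarrow> 'b::euclidean_space \<Rightarrow> ennreal"
  assumes "\<And>i. F i \<in> borel_measurable borel" "\<And>i. i < N \<Longrightarrow> pivot A i \<noteq> 0"
  shows "(\<Prod>i<N. ennreal (\<bar>pivot A i\<bar> ^ DIM('b))) *
      (\<integral>\<^sup>+c. (\<Prod>i<N. F i (\<Sum>l<N. A l i *\<^sub>R c l)) \<partial>PiM {..<N} (\<lambda>_. lborel))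
    = (\<Prod>i<N. \<integral>\<^sup>+y. F i y \<partial>lborel)"
  using nn_integral_elim[of 0 N F A, OF _ assms] by (simp add: lessThan_atLeast0)

lemma pivot_cong:
  assumes "\<And>l i. i \<le> k \<Longrightarrow> A l i = A' l i"
  shows "pivot A k = pivot A' k"
proof -
  have "elim A j l i = elim A' j l i" if "j \<le> k" "i \<le> k" for j l i
    using that by (induction j arbitrary: l i) (auto simp: assms)
  then show ?thesis unfolding pivot_def by simp
qed

lemma measurable_pivot_PiM:
  fixes \<phi> :: "nat \<Rightarrow> 'a::euclidean_space \<Rightarrow> real"
  assumes k: "k < N" and \<phi>: "\<And>l. \<phi> l \<in> borel_measurable borel"
  shows "(\<lambda>t. pivot (\<lambda>l i. \<phi> l (t i)) k) \<in> borel_measurable (PiM {..<N} (\<lambda>_. lborel))"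
proof -
  \<comment> \<open>Only coordinates below \<open>N\<close> are measurable on this product. Columns
    beyond \<open>k\<close> are set to 0, which the \<open>k\<close>-th pivot does not see.\<close>
  have "(\<lambda>t. pivot (\<lambda>l i. if i \<le> k then \<phi> l (t i) else 0) k) \<in> borel_measurable (PiM {..<N} (\<lambda>_. lborel))"
  proof (rule measurable_pivot)
    fix l i
    have "(\<lambda>t. t i) \<in> borel_measurable (PiM {..<N} (\<lambda>_. lborel :: 'a measure))" if "i \<le> k"
      using k that measurable_component_singleton[of i "{..<N}" "\<lambda>_. lborel :: 'a measure"] by simp
    then show "(\<lambda>t. if i \<le> k then \<phi> l (t i) else 0) \<in> borel_measurable (PiM {..<N} (\<lambda>_. lborel))"
      by (cases "i \<le> k") (auto intro: measurable_compose[OF _ \<phi>])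
  qed
  moreover have "pivot (\<lambda>l i. \<phi> l (t i)) k = pivot (\<lambda>l i. if i \<le> k then \<phi> l (t i) else 0) k" for t
    by (rule pivot_cong) simp
  ultimately show ?thesis by simp
qed

text \<open>The last point is integrated first. With the others fixed, the last pivot is
  \<open>\<phi> N\<close> plus a combination of the earlier \<open>\<phi> r\<close> in that point,
  so the inner integral is at least the infimum, which is a constant.\<close>

lemma prod_INF_le_nn_integral_pivot:
  fixes G :: "'a::euclidean_space \<Rightarrow> ennreal" and \<phi> :: "nat \<Rightarrow> 'a \<Rightarrow> real"
  assumes [measurable]: "G \<in> borel_measurable borel" "\<And>l. \<phi> l \<in> borel_measurable borel"
  shows "(\<Prod>k<N. INF a. \<integral>\<^sup>+x. ennreal (\<bar>\<phi> k x + (\<Sum>r<k. a r * \<phi> r x)\<bar> ^ g) * G x \<partial>lborel)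
    \<le> (\<integral>\<^sup>+t. (\<Prod>k<N. ennreal (\<bar>pivot (\<lambda>l i. \<phi> l (t i)) k\<bar> ^ g) * G (t k)) \<partial>PiM {..<N} (\<lambda>_. lborel))"
proof (induction N)
  case 0
  show ?case by (simp add: PL.nn_integral_empty del: nn_integral_const)
next
  case (Suc N)
  let ?E = "\<lambda>k. INF a. \<integral>\<^sup>+x. ennreal (\<bar>\<phi> k x + (\<Sum>r<k. a r * \<phi> r x)\<bar> ^ g) * G x \<partial>lborel"
  let ?M = "\<lambda>N. PiM {..<N} (\<lambda>_. lborel :: 'a measure)"
  let ?A = "\<lambda>t l i. \<phi> l (t i)"
  let ?h = "\<lambda>N t. \<Prod>k<N. ennreal (\<bar>pivot (?A t) k\<bar> ^ g) * G (t k)"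
  have hm: "?h N \<in> borel_measurable (?M N')" if "N \<le> N'" for N N'
  proof (rule borel_measurable_prod_ennreal)
    fix k assume "k \<in> {..<N}"
    then have k: "k < N'" using that by simp
    have [measurable]: "(\<lambda>t. pivot (?A t) k) \<in> borel_measurable (?M N')"
      by (rule measurable_pivot_PiM[OF k assms(2)])
    have [measurable]: "(\<lambda>t. t k) \<in> borel_measurable (?M N')"
      using k measurable_component_singleton[of k "{..<N'}" "\<lambda>_. lborel :: 'a measure"] by simp
    show "(\<lambda>t. ennreal (\<bar>pivot (?A t) k\<bar> ^ g) * G (t k)) \<in> borel_measurable (?M N')"
      by measurable
  qed
  have *: "?h N t * ?E N \<le> (\<integral>\<^sup>+x. ?h (Suc N) (t(N := x)) \<partial>lborel)" for t
  proof -
    \<comment> \<open>These coefficients depend on the earlier points \<open>t\<close> but not on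
      the new point \<open>x\<close>, so they compete in the infimum.\<close>
    obtain a where a: "\<And>A'. (\<forall>r. \<forall>j<N. A' r j = ?A t r j) \<Longrightarrow>
       (\<forall>i. elim A' N N i = A' N i + (\<Sum>r<N. a r * A' r i))"
      using elim_combination[of N "?A t" N] by blast
    have piv: "pivot (?A (t(N := x))) N = \<phi> N x + (\<Sum>r<N. a r * \<phi> r x)" for x
      using a[of "?A (t(N := x))"] by (simp add: pivot_def)
    have "pivot (?A (t(N := x))) k = pivot (?A t) k" if "k < N" for k x
      by (rule pivot_cong) (use that in auto)
    then have "?h N (t(N := x)) = ?h N t" for x
      by (intro prod.cong) auto
    then have eq: "?h (Suc N) (t(N := x)) =
        ?h N t * (ennreal (\<bar>\<phi> N x + (\<Sum>r<N. a r * \<phi> r x)\<bar> ^ g) * G x)" for x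
      by (simp add: piv del: fun_upd_apply) simp
    have "(\<integral>\<^sup>+x. ?h (Suc N) (t(N := x)) \<partial>lborel) =
       ?h N t * (\<integral>\<^sup>+x. ennreal (\<bar>\<phi> N x + (\<Sum>r<N. a r * \<phi> r x)\<bar> ^ g) * G x \<partial>lborel)"
      unfolding eq by (rule nn_integral_cmult) measurable
    then show ?thesis by (auto intro!: mult_left_mono INF_lower)
  qed
  have "(\<Prod>k<Suc N. ?E k) \<le> (\<integral>\<^sup>+t. ?h N t \<partial>?M N) * ?E N"
    using Suc.IH by (simp add: mult_right_mono)
  also have "\<dots> = (\<integral>\<^sup>+t. ?h N t * ?E N \<partial>?M N)"
    by (rule nn_integral_multc[symmetric]) (rule hm, simp)
  also have "\<dots> \<le> (\<integral>\<^sup>+t. \<integral>\<^sup>+x. ?h (Suc N) (t(N := x)) \<partial>lborel \<partial>?M N)"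
    by (intro nn_integral_mono *)
  also have "\<dots> = (\<integral>\<^sup>+t. ?h (Suc N) t \<partial>?M (Suc N))"
    using hm[of "Suc N" "Suc N"] unfolding lessThan_Suc[of N]
    by (subst PL.product_nn_integral_insert) (auto simp del: prod.lessThan_Suc)
  finally show ?case .
qed

section \<open>Sublevel sets of lexicographically monic polynomials\<close>

text \<open>
  A point of the sublevel set is within distance \<open>\<rho>\<close> of the real part of some complex root.
\<close>

lemma emeasure_poly_sublevel_le:
  fixes p :: "real poly"
  assumes deg: "degree p = a" "a \<ge> 1" and \<rho>: "\<rho> \<ge> 0" "1 \<le> \<bar>lead_coeff p\<bar> * \<rho> ^ a"
  shows "emeasure lborel {x. \<bar>poly p x\<bar> \<le> 1} \<le> ennreal (2 * real a * \<rho>)"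
proof -
  define q where "q = map_poly complex_of_real p"
  have dq: "degree q = a" unfolding q_def using deg(1) by (simp add: degree_map_poly)
  have lq: "lead_coeff q = complex_of_real (lead_coeff p)"
    using dq deg(1) by (simp add: q_def coeff_map_poly)
  have poly_map_poly_of_real: "poly (map_poly complex_of_real p) (complex_of_real x) = complex_of_real (poly p x)" for x
    by (induction p) (auto simp: map_poly_pCons)
  obtain r where r: "smult (lead_coeff q) (\<Prod>i<degree q. [:- r i, 1:]) = q"
    using complex_poly_decompose' by blast
  have val: "\<bar>poly p x\<bar> = \<bar>lead_coeff p\<bar> * (\<Prod>i<a. norm (complex_of_real x - r i))" for x
  proof -
    have "\<bar>poly p x\<bar> = norm (poly q (complex_of_real x))"
      by (simp add: q_def poly_map_poly_of_real)
    also have "poly q (complex_of_real x) = lead_coeff q * (\<Prod>i<a. complex_of_real x - r i)"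
      by (subst r[symmetric]) (simp add: poly_prod dq)
    finally show ?thesis by (simp add: lq norm_mult prod_norm)
  qed
  \<comment> \<open>At any other point all \<open>a\<close> linear factors exceed
    \<open>\<rho>\<close>, so the value exceeds
    \<open>\<bar>lead_coeff p\<bar> * \<rho> ^ a\<close>, which is at least 1.\<close>
  have "{x. \<bar>poly p x\<bar> \<le> 1} \<subseteq> (\<Union>i<a. {Re (r i) - \<rho>..Re (r i) + \<rho>})"
  proof (rule ccontr)
    assume "\<not> ?thesis"
    then obtain x where x: "\<bar>poly p x\<bar> \<le> 1" "\<And>i. i < a \<Longrightarrow> x \<notin> {Re (r i) - \<rho>..Re (r i) + \<rho>}"
      by blast
    have "\<rho> < norm (complex_of_real x - r i)" if "i < a" for i
    proof -
      have "\<rho> < \<bar>x - Re (r i)\<bar>" using x(2)[OF that] by auto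
      also have "\<dots> \<le> norm (complex_of_real x - r i)"
        using abs_Re_le_cmod[of "complex_of_real x - r i"] by simp
      finally show ?thesis .
    qed
    then have "(\<Prod>i<a. \<rho>) < (\<Prod>i<a. norm (complex_of_real x - r i))"
      using \<rho>(1) deg(2) by (intro prod_mono_strict[of 0]) (auto simp del: zero_less_norm_iff intro: less_imp_le le_less_trans)
    then have "\<rho> ^ a < (\<Prod>i<a. norm (complex_of_real x - r i))" by simp
    moreover have "lead_coeff p \<noteq> 0" using deg by auto
    ultimately have "\<bar>lead_coeff p\<bar> * \<rho> ^ a < \<bar>poly p x\<bar>" unfolding val by simp
    with x(1) \<rho>(2) show False by linarith
  qed
  then have "emeasure lborel {x. \<bar>poly p x\<bar> \<le> 1} \<le>
      emeasure lborel (\<Union>i<a. {Re (r i) - \<rho>..Re (r i) + \<rho>})"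
    by (intro emeasure_mono) auto
  also have "\<dots> \<le> (\<Sum>i<a. emeasure lborel {Re (r i) - \<rho>..Re (r i) + \<rho>})"
    by (intro emeasure_subadditive_finite) auto
  also have "\<dots> = (\<Sum>i<a. ennreal (2 * \<rho>))"
    using \<rho>(1) by (intro sum.cong) auto
  also have "\<dots> = ennreal (2 * real a * \<rho>)"
    using \<rho>(1) by (simp add: ennreal_of_nat_eq_real_of_nat flip: ennreal_mult)
  finally show ?thesis .
qed

text \<open>Reduces a bound for a possibly infinite measure to finite lengths below it.\<close>

lemma ennreal_le_if_real_le:
  fixes x y :: ennreal
  assumes "\<And>r. 0 < r \<Longrightarrow> ennreal r \<le> x \<Longrightarrow> ennreal r \<le> y"
  shows "x \<le> y"
proof (cases x)
  case (real r)
  then show ?thesis using assms[of r] by (cases "r = 0") auto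
next
  case top
  have "y = top"
  proof (rule ccontr)
    assume "y \<noteq> top"
    then obtain s where s: "y = ennreal s" "s \<ge> 0" by (cases y) auto
    have "ennreal (s + 1) \<le> y" using assms[of "s + 1"] top s by simp
    then show False using s by simp
  qed
  then show ?thesis by simp
qed

text \<open>If the left set has measure at least \<open>l\<close>, the interval of half-length
  \<open>l / (2 * d)\<close> around 0 lies in the right set: a constraint violated at some
  \<open>h\<close> there would, by \<open>emeasure_poly_sublevel_le\<close>, force the left measure
  below \<open>2 * d * \<bar>h\<bar>\<close>, hence below \<open>l\<close>. All constraints share
  this interval, so one factor \<open>d\<close> serves any number of polynomials.\<close>

lemma emeasure_sublevel_compress:
  fixes p :: "'k \<Rightarrow> real poly"
  assumes K: "finite K" and w: "\<And>k. k \<in> K \<Longrightarrow> 0 \<le> w k"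
    and deg: "\<And>k. k \<in> K \<Longrightarrow> degree (p k) \<le> a k" "\<And>k. k \<in> K \<Longrightarrow> a k \<le> d"
    and d: "d \<ge> 1"
  shows "emeasure lborel {x. \<forall>k\<in>K. w k * \<bar>poly (p k) x\<bar> \<le> 1} \<le>
    ennreal (real d) * emeasure lborel {h. \<forall>k\<in>K. w k * (\<bar>h\<bar> ^ a k * \<bar>coeff (p k) (a k)\<bar>) \<le> 1}"
    (is "emeasure lborel ?A \<le> _ * emeasure lborel ?H")
proof (rule ennreal_le_if_real_le)
  fix l :: real assume l: "0 < l" "ennreal l \<le> emeasure lborel ?A"
  have Hm: "?H \<in> sets borel"
    using K by measurable
  have [measurable]: "poly (p k) \<in> borel_measurable borel" for k
    by (intro borel_measurable_continuous_onI continuous_intros)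
  have Am: "?A \<in> sets borel" using K by measurable
  have sub: "{- (l / (2 * d))..l / (2 * d)} \<subseteq> ?H"
  proof (intro subsetI CollectI ballI)
    fix h k assume h: "h \<in> {- (l / (2 * d))..l / (2 * d)}" and k: "k \<in> K"
    let ?c = "w k * \<bar>coeff (p k) (a k)\<bar>"
    have h': "\<bar>h\<bar> \<le> l / (2 * d)" using h by auto
    have ne: "?A \<noteq> {}" using l by (metis emeasure_empty ennreal_eq_0_iff le_zero_eq not_le)
    \<comment> \<open>A zero leading coefficient or weight makes the constraint trivial; for
      \<open>a k = 0\<close> the polynomial is constant, and any point of the nonempty left set
      certifies it. In the last case \<open>a k\<close> is the exact degree.\<close>
    consider "?c = 0" | "a k = 0" | "?c > 0" "a k \<ge> 1"
      using w[OF k] by (smt (verit) One_nat_def Suc_leI abs_ge_zero mult_nonneg_nonneg neq0_conv)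
    then show "w k * (\<bar>h\<bar> ^ a k * \<bar>coeff (p k) (a k)\<bar>) \<le> 1"
    proof cases
      case 1
      then show ?thesis by auto
    next
      case 2
      obtain x where "w k * \<bar>poly (p k) x\<bar> \<le> 1" using ne k by blast
      moreover have "poly (p k) x = coeff (p k) 0"
        using deg(1)[OF k] 2 by (metis degree_eq_zeroE le_zero_eq poly_pCons coeff_pCons_0 mult_zero_right add.right_neutral poly_0)
      ultimately show ?thesis using 2 by simp
    next
      case 3
      show ?thesis
      proof (rule ccontr)
        assume "\<not> ?thesis"
        then have gt: "?c * \<bar>h\<bar> ^ a k > 1" by (simp add: mult_ac)
        \<comment> \<open>The radius at which the weighted leading term equals 1.\<close>
        define \<rho> where "\<rho> = root (a k) (1 / ?c)"
        have \<rho>: "\<rho> \<ge> 0" "\<rho> ^ a k = 1 / ?c" using 3 by (auto simp: \<rho>_def)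
        have cne: "coeff (p k) (a k) \<noteq> 0"
          using 3(1) by (metis abs_zero mult_zero_right less_irrefl)
        have wpos: "w k > 0"
          using 3(1) w[OF k] by (metis mult_zero_left less_irrefl order_le_less)
        have dp: "degree (p k) = a k" using deg(1)[OF k] cne by (simp add: le_antisym le_degree)
        have "emeasure lborel ?A \<le> emeasure lborel {x. \<bar>poly (smult (w k) (p k)) x\<bar> \<le> 1}"
          using k wpos by (intro emeasure_mono) (auto simp: abs_mult)
        also have "\<dots> \<le> ennreal (2 * real (a k) * \<rho>)"
        proof (rule emeasure_poly_sublevel_le)
          show "1 \<le> \<bar>lead_coeff (smult (w k) (p k))\<bar> * \<rho> ^ a k"
            using 3 wpos cne by (simp add: \<rho> dp abs_mult)
        qed (use 3 \<rho> wpos dp in auto)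
        finally have "ennreal l \<le> ennreal (2 * real (a k) * \<rho>)" using l(2) by order
        then have le: "l \<le> 2 * real (a k) * \<rho>" using \<rho>(1) by (simp add: ennreal_le_iff)
        have "\<rho> < \<bar>h\<bar>"
        proof (rule power_less_imp_less_base)
          show "\<rho> ^ a k < \<bar>h\<bar> ^ a k"
            using gt 3 by (simp add: \<rho> field_simps)
        qed simp
        then have "2 * real (a k) * \<rho> < 2 * real d * \<bar>h\<bar>"
          using 3 deg(2)[OF k] \<rho>(1)
          by (intro mult_le_less_imp_less) auto
        also have "\<dots> \<le> l" using h' d by (simp add: field_simps)
        finally show False using le by simp
      qed
    qed
  qed
  have "ennreal l = ennreal (real d) * ennreal (l / d)"
    using d l by (simp flip: ennreal_mult)
  also have "ennreal (l / d) = emeasure lborel {- (l / (2 * d))..l / (2 * d)}"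
    using d l by simp
  also have "\<dots> \<le> emeasure lborel ?H" using sub Hm by (intro emeasure_mono) auto
  finally show "ennreal l \<le> ennreal (real d) * emeasure lborel ?H" by (simp add: mult_left_mono)
qed

fun lexless :: "'i list \<Rightarrow> ('i \<Rightarrow> nat) \<Rightarrow> ('i \<Rightarrow> nat) \<Rightarrow> bool" where
  "lexless [] \<beta> \<alpha> = False"
| "lexless (j # js) \<beta> \<alpha> = (\<beta> j < \<alpha> j \<or> \<beta> j = \<alpha> j \<and> lexless js \<beta> \<alpha>)"

text \<open>Both orders of integration are stated because the induction on the variables first
  compresses the new variable with the others frozen, and then freezes the new one.\<close>

lemma emeasure_PiM_insert:
  fixes I :: "'i set"
  assumes "finite I" "i \<notin> I"
    and "{t \<in> space (PiM (insert i I) (\<lambda>_. lborel :: 'b::euclidean_space measure)). Q t}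
      \<in> sets (PiM (insert i I) (\<lambda>_. lborel :: 'b measure))"
  shows "emeasure (PiM (insert i I) (\<lambda>_. lborel :: 'b measure))
      {t \<in> space (PiM (insert i I) (\<lambda>_. lborel :: 'b measure)). Q t} =
    (\<integral>\<^sup>+t. emeasure lborel {x. Q (t(i := x))} \<partial>PiM I (\<lambda>_. lborel))" (is ?th1)
    and "emeasure (PiM (insert i I) (\<lambda>_. lborel :: 'b measure))
      {t \<in> space (PiM (insert i I) (\<lambda>_. lborel :: 'b measure)). Q t} =
    (\<integral>\<^sup>+x. emeasure (PiM I (\<lambda>_. lborel)) {t \<in> space (PiM I (\<lambda>_. lborel :: 'b measure)). Q (t(i := x))} \<partial>lborel)"
      (is ?th2)
    and "(\<lambda>t. emeasure lborel {x. Q (t(i := x))}) \<in> borel_measurable (PiM I (\<lambda>_. lborel))" (is ?th3)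
    and "(\<lambda>x. emeasure (PiM I (\<lambda>_. lborel)) {t \<in> space (PiM I (\<lambda>_. lborel :: 'b measure)). Q (t(i := x))})
      \<in> borel_measurable lborel" (is ?th4)
proof -
  let ?M = "\<lambda>I. PiM I (\<lambda>_. lborel :: 'b measure)"
  let ?A = "{t \<in> space (?M (insert i I)). Q t}"
  have sp: "t(i := x) \<in> space (?M (insert i I))" if "t \<in> space (?M I)" for t x
    using that by (auto simp: space_PiM PiE_iff extensional_def)
  have ind: "indicator ?A (t(i := x)) = (indicator {x. Q (t(i := x))} x :: ennreal)"
    "indicator ?A (t(i := x)) = (indicator {t \<in> space (?M I). Q (t(i := x))} t :: ennreal)"
    if "t \<in> space (?M I)" for t x
    using sp[OF that] that by (auto simp: indicator_def)
  have m [measurable]: "indicator ?A \<in> borel_measurable (?M (insert i I))" using assms(3) by simp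
  have sec1: "{x. Q (t(i := x))} \<in> sets lborel" if "t \<in> space (?M I)" for t
  proof -
    have "(\<lambda>x. t(i := x)) \<in> lborel \<rightarrow>\<^sub>M ?M (insert i I)"
      using that by measurable
    from measurable_sets[OF this assms(3)] show ?thesis
      using sp[OF that] by (simp add: vimage_def)
  qed
  have sec2: "{t \<in> space (?M I). Q (t(i := x))} \<in> sets (?M I)" for x
  proof -
    have "(\<lambda>t. t(i := x)) \<in> ?M I \<rightarrow>\<^sub>M ?M (insert i I)"
      by measurable
    from measurable_sets[OF this assms(3)]
    have "(\<lambda>t. t(i := x)) -` ?A \<inter> space (?M I) \<in> sets (?M I)" .
    also have "(\<lambda>t. t(i := x)) -` ?A \<inter> space (?M I) = {t \<in> space (?M I). Q (t(i := x))}"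
      using sp by auto
    finally show ?thesis .
  qed
  have i1: "(\<integral>\<^sup>+x. indicator ?A (t(i := x)) \<partial>lborel) = emeasure lborel {x. Q (t(i := x))}"
    if "t \<in> space (?M I)" for t
    using sec1[OF that] by (simp add: ind(1)[OF that])
  have i2: "(\<integral>\<^sup>+t. indicator ?A (t(i := x)) \<partial>?M I) = emeasure (?M I) {t \<in> space (?M I). Q (t(i := x))}" for x
  proof -
    have "(\<integral>\<^sup>+t. indicator ?A (t(i := x)) \<partial>?M I) =
        (\<integral>\<^sup>+t. indicator {t \<in> space (?M I). Q (t(i := x))} t \<partial>?M I)"
      by (intro nn_integral_cong ind(2))
    then show ?thesis using sec2 by simp
  qed
  have A: "emeasure (?M (insert i I)) ?A = (\<integral>\<^sup>+t. indicator ?A t \<partial>?M (insert i I))"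
    using assms(3) by simp
  show ?th1
    unfolding A PL.product_nn_integral_insert[OF assms(1,2) m]
    by (intro nn_integral_cong i1)
  show ?th2
    unfolding A PL.product_nn_integral_insert_rev[OF assms(1,2) m] i2 ..
  have "(\<lambda>t. \<integral>\<^sup>+x. indicator ?A (t(i := x)) \<partial>lborel) \<in> borel_measurable (?M I)"
    by (rule lborel.borel_measurable_nn_integral) measurable
  then show ?th3 by (simp add: i1 cong: measurable_cong)
  have "(\<lambda>x. \<integral>\<^sup>+t. indicator ?A (t(i := x)) \<partial>?M I) \<in> borel_measurable lborel"
    by (rule sigma_finite_measure.borel_measurable_nn_integral)
       (simp add: assms(1), measurable)
  then show ?th4 by (simp add: i2)
qed

text \<open>
  One variable at a time, a polynomial is replaced by its leading monomial. The remaining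
  variables see the coefficient of the leading power, which is again lexicographically monic.
\<close>

lemma emeasure_lexmonic_compress:
  fixes \<alpha> :: "'k \<Rightarrow> 'i \<Rightarrow> nat" and a :: "'k \<Rightarrow> ('i \<Rightarrow> nat) \<Rightarrow> real"
  assumes "distinct js" "finite K" "finite X" "d \<ge> 1"
    and "\<And>k j. k \<in> K \<Longrightarrow> \<alpha> k j \<le> d"
    and "\<And>k. k \<in> K \<Longrightarrow> 0 \<le> w k"
    and "\<And>k \<beta>. k \<in> K \<Longrightarrow> \<beta> \<in> X \<Longrightarrow> a k \<beta> \<noteq> 0 \<Longrightarrow> lexless js \<beta> (\<alpha> k)"
  shows "emeasure (PiM (set js) (\<lambda>_. lborel)) {t \<in> space (PiM (set js) (\<lambda>_. lborel)).
      \<forall>k\<in>K. w k * \<bar>(\<Prod>j\<in>set js. t j ^ \<alpha> k j) + (\<Sum>\<beta>\<in>X. a k \<beta> * (\<Prod>j\<in>set js. t j ^ \<beta> j))\<bar> \<le> 1}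
    \<le> ennreal (real d ^ length js) * emeasure (PiM (set js) (\<lambda>_. lborel))
      {t \<in> space (PiM (set js) (\<lambda>_. lborel)). \<forall>k\<in>K. w k * (\<Prod>j\<in>set js. \<bar>t j\<bar> ^ \<alpha> k j) \<le> 1}"
  using assms(1,6,7)
proof (induction js arbitrary: w a)
  case Nil
  then have "(\<Sum>\<beta>\<in>X. a k \<beta>) = 0" if "k \<in> K" for k
    using that by (intro sum.neutral) auto
  moreover have "\<bar>w k\<bar> = w k" if "k \<in> K" for k using Nil(2)[OF that] by simp
  ultimately show ?case by (auto simp: space_PiM intro!: eq_refl arg_cong[where f="emeasure _"])
next
  case (Cons j js)
  let ?M = "\<lambda>I. PiM I (\<lambda>_. lborel :: real measure)"
  let ?S = "set js"
  have j: "j \<notin> ?S" and dist: "distinct js" using Cons.prems by auto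
  note w = Cons.prems(2) and a = Cons.prems(3)
  note [measurable] = \<open>finite K\<close>
  define P where "P k t = (\<Prod>j\<in>set (j # js). t j ^ \<alpha> k j) +
      (\<Sum>\<beta>\<in>X. a k \<beta> * (\<Prod>j\<in>set (j # js). t j ^ \<beta> j))" for k and t :: "'i \<Rightarrow> real"
  \<comment> \<open>Of the lower terms, only those with the full power \<open>\<alpha> k j\<close>
    of the new variable survive in its leading coefficient \<open>Q\<close>.\<close>
  define a' where "a' k \<beta> = (if \<beta> j = \<alpha> k j then a k \<beta> else 0)" for k \<beta>
  define Q where "Q k t = (\<Prod>j\<in>?S. t j ^ \<alpha> k j) + (\<Sum>\<beta>\<in>X. a' k \<beta> * (\<Prod>j\<in>?S. t j ^ \<beta> j))"
    for k and t :: "'i \<Rightarrow> real"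
  define p where "p k t = monom (\<Prod>j\<in>?S. t j ^ \<alpha> k j) (\<alpha> k j) +
      (\<Sum>\<beta>\<in>X. monom (a k \<beta> * (\<Prod>j\<in>?S. t j ^ \<beta> j)) (\<beta> j))" for k and t :: "'i \<Rightarrow> real"
  have upd: "(\<Prod>i\<in>set (j # js). (t(j := x)) i ^ \<beta> i) = x ^ \<beta> j * (\<Prod>i\<in>?S. t i ^ \<beta> i)"
    for t :: "'i \<Rightarrow> real" and x \<beta>
  proof -
    have "(\<Prod>i\<in>?S. (t(j := x)) i ^ \<beta> i) = (\<Prod>i\<in>?S. t i ^ \<beta> i)"
      using j by (intro prod.cong) auto
    then show ?thesis using j by simp
  qed
  have upd_abs: "(\<Prod>i\<in>set (j # js). \<bar>(t(j := x)) i\<bar> ^ \<beta> i) = \<bar>x\<bar> ^ \<beta> j * (\<Prod>i\<in>?S. \<bar>t i\<bar> ^ \<beta> i)"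
    for t :: "'i \<Rightarrow> real" and x \<beta>
  proof -
    have "(\<Prod>i\<in>?S. \<bar>(t(j := x)) i\<bar> ^ \<beta> i) = (\<Prod>i\<in>?S. \<bar>t i\<bar> ^ \<beta> i)"
      using j by (intro prod.cong) auto
    then show ?thesis using j by simp
  qed
  have Pp: "P k (t(j := x)) = poly (p k t) x" for k t x
    unfolding P_def p_def upd by (simp add: poly_monom poly_sum mult_ac)
  have le: "\<beta> j \<le> \<alpha> k j" if "k \<in> K" "\<beta> \<in> X" "a k \<beta> \<noteq> 0" for k \<beta>
    using a[OF that] by auto
  have degp: "degree (p k t) \<le> \<alpha> k j" if "k \<in> K" for k t
    unfolding p_def
  proof (intro degree_add_le degree_sum_le \<open>finite X\<close> degree_monom_le)
    fix \<beta> assume "\<beta> \<in> X"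
    then show "degree (monom (a k \<beta> * (\<Prod>j\<in>?S. t j ^ \<beta> j)) (\<beta> j)) \<le> \<alpha> k j"
      using le[OF that] by (cases "a k \<beta> = 0") (auto intro: order_trans[OF degree_monom_le])
  qed
  have cp: "coeff (p k t) (\<alpha> k j) = Q k t" for k t
    unfolding p_def Q_def a'_def by (auto simp: coeff_sum intro!: sum.cong)
  have a': "lexless js \<beta> (\<alpha> k)" if "k \<in> K" "\<beta> \<in> X" "a' k \<beta> \<noteq> 0" for k \<beta>
    using a[of k \<beta>] that by (auto simp: a'_def split: if_splits)
  have [measurable]: "P k \<in> borel_measurable (?M (insert j ?S))" for k
    unfolding P_def by simp
  have [measurable]: "Q k \<in> borel_measurable (?M ?S)" for k
    unfolding Q_def by simp
  have 1: "emeasure (?M (insert j ?S)) {t \<in> space (?M (insert j ?S)). \<forall>k\<in>K. w k * \<bar>P k t\<bar> \<le> 1} =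
     (\<integral>\<^sup>+t. emeasure lborel {x. \<forall>k\<in>K. w k * \<bar>P k (t(j := x))\<bar> \<le> 1} \<partial>?M ?S)"
    using j by (intro emeasure_PiM_insert(1)) (simp_all, measurable)
  \<comment> \<open>\<open>Q\<close> lives on the product without \<open>j\<close>;
    \<open>restrict\<close> makes it a function on the larger product, where the order of
    integration is exchanged.\<close>
  let ?h = "\<lambda>t. \<forall>k\<in>K. (w k * \<bar>t j\<bar> ^ \<alpha> k j) * \<bar>Q k (restrict t ?S)\<bar> \<le> 1"
  have H: "{t \<in> space (?M (insert j ?S)). ?h t} \<in> sets (?M (insert j ?S))"
    by measurable
  note H' = emeasure_PiM_insert[OF _ j H, simplified]
  have rest: "restrict (t(j := x)) ?S = t" if "t \<in> space (?M ?S)" for t and x :: real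
    using that j by (auto simp: space_PiM PiE_iff extensional_def restrict_def fun_eq_iff)
  have "emeasure (?M (insert j ?S)) {t \<in> space (?M (insert j ?S)). \<forall>k\<in>K. w k * \<bar>P k t\<bar> \<le> 1} \<le>
    (\<integral>\<^sup>+t. ennreal (real d) * emeasure lborel {x. \<forall>k\<in>K. w k * (\<bar>x\<bar> ^ \<alpha> k j * \<bar>Q k t\<bar>) \<le> 1} \<partial>?M ?S)"
    unfolding 1 Pp cp[symmetric]
    by (intro nn_integral_mono emeasure_sublevel_compress) (use assms w degp in auto)
  also have "\<dots> = (\<integral>\<^sup>+t. ennreal (real d) * emeasure lborel {x. ?h (t(j := x))} \<partial>?M ?S)"
    by (intro nn_integral_cong) (simp add: rest mult_ac)
  also have "\<dots> = ennreal (real d) * (\<integral>\<^sup>+t. emeasure lborel {x. ?h (t(j := x))} \<partial>?M ?S)"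
    by (rule nn_integral_cmult) (use H'(3) in simp)
  also have "(\<integral>\<^sup>+t. emeasure lborel {x. ?h (t(j := x))} \<partial>?M ?S) =
    (\<integral>\<^sup>+x. emeasure (?M ?S) {t \<in> space (?M ?S). ?h (t(j := x))} \<partial>lborel)"
    using H' by simp
  also have "\<dots> = (\<integral>\<^sup>+x. emeasure (?M ?S) {t \<in> space (?M ?S). \<forall>k\<in>K.
      (w k * \<bar>x\<bar> ^ \<alpha> k j) * \<bar>Q k t\<bar> \<le> 1} \<partial>lborel)"
    by (intro nn_integral_cong arg_cong[where f="emeasure _"]) (auto simp: rest)
  \<comment> \<open>For fixed \<open>x\<close> the factor
    \<open>\<bar>x\<bar> ^ \<alpha> k j\<close> is absorbed into the weights, which is why the
    induction carries weights.\<close>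
  also have "\<dots> \<le> (\<integral>\<^sup>+x. ennreal (real d ^ length js) * emeasure (?M ?S) {t \<in> space (?M ?S). \<forall>k\<in>K.
      (w k * \<bar>x\<bar> ^ \<alpha> k j) * (\<Prod>i\<in>?S. \<bar>t i\<bar> ^ \<alpha> k i) \<le> 1} \<partial>lborel)"
    unfolding Q_def
    by (intro nn_integral_mono Cons.IH) (use w a' dist in auto)
  also have "\<dots> = (\<integral>\<^sup>+x. ennreal (real d ^ length js) * emeasure (?M ?S) {t \<in> space (?M ?S). \<forall>k\<in>K.
      w k * (\<Prod>i\<in>set (j # js). \<bar>(t(j := x)) i\<bar> ^ \<alpha> k i) \<le> 1} \<partial>lborel)"
    unfolding upd_abs by (simp add: mult_ac)
  also have "\<dots> = ennreal (real d ^ length js) * emeasure (?M (insert j ?S))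
     {t \<in> space (?M (insert j ?S)). \<forall>k\<in>K. w k * (\<Prod>i\<in>set (j # js). \<bar>t i\<bar> ^ \<alpha> k i) \<le> 1}"
  proof -
    have "{t \<in> space (?M (insert j ?S)). \<forall>k\<in>K. w k * (\<Prod>i\<in>set (j # js). \<bar>t i\<bar> ^ \<alpha> k i) \<le> 1}
       \<in> sets (?M (insert j ?S))"
      by simp measurable
    note G = emeasure_PiM_insert[OF _ j this]
    show ?thesis
      by (subst nn_integral_cmult) (use G(2,4) in simp_all)
  qed
  finally show ?case
    unfolding P_def by (simp add: mult_left_mono ennreal_mult mult.assoc)
qed

section \<open>Lebesgue measure on coordinate vectors\<close>

text \<open>The index set is general: \<open>UNIV\<close> serves the sublevel estimates,
  \<open>{..<CARD('n)}\<close> the linear systems in coordinates numbered by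
  \<open>js\<close>.\<close>

lemma lborel_vec_reindex:
  assumes \<nu>: "bij_betw \<nu> (UNIV :: 'n::finite set) I"
  shows "(lborel :: (real ^ 'n) measure) = distr (PiM I (\<lambda>_. lborel)) borel (\<lambda>f. \<chi> j. f (\<nu> j))"
    and "(\<lambda>f. \<chi> j. f (\<nu> j)) \<in> PiM I (\<lambda>_. lborel) \<rightarrow>\<^sub>M (borel :: (real ^ 'n) measure)"
proof -
  have in_I: "\<nu> j \<in> I" for j using \<nu> by (auto simp: bij_betw_def)
  have fin: "finite I" using bij_betw_finite[OF \<nu>] by simp
  have comp: "(\<lambda>f. f (\<nu> j)) \<in> borel_measurable (PiM I (\<lambda>_. lborel :: real measure))" for j
    using measurable_component_singleton[OF in_I[of j], where M="\<lambda>_. lborel :: real measure"] by simp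
  show [measurable]: "(\<lambda>f. \<chi> j. f (\<nu> j)) \<in> PiM I (\<lambda>_. lborel) \<rightarrow>\<^sub>M (borel :: (real ^ 'n) measure)"
    by (subst borel_measurable_euclidean_space) (auto simp: Basis_vec_def inner_axis comp)
  define \<mu> where "\<mu> = inv_into UNIV \<nu>"
  have \<mu>: "\<mu> (\<nu> j) = j" for j using \<nu> by (simp add: \<mu>_def bij_betw_def)
  have \<nu>\<mu>: "\<nu> (\<mu> i) = i" if "i \<in> I" for i
    using \<nu> that unfolding \<mu>_def by (metis bij_betw_inv_into_right)
  show "(lborel :: (real ^ 'n) measure) = distr (PiM I (\<lambda>_. lborel)) borel (\<lambda>f. \<chi> j. f (\<nu> j))"
  proof (rule lborel_eqI)
    fix l u :: "real ^ 'n" assume le: "\<And>b. b \<in> Basis \<Longrightarrow> l \<bullet> b \<le> u \<bullet> b"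
    then have le': "l $ j \<le> u $ j" for j
      using le[of "axis j 1"] by (simp add: inner_axis)
    have "(\<lambda>f. \<chi> j. f (\<nu> j)) -` box l u \<inter> space (PiM I (\<lambda>_. lborel)) =
        PiE I (\<lambda>i. {l $ \<mu> i<..<u $ \<mu> i})"
    proof (intro set_eqI iffI)
      fix f assume "f \<in> (\<lambda>f. \<chi> j. f (\<nu> j)) -` box l u \<inter> space (PiM I (\<lambda>_. lborel))"
      then have ext: "f \<in> extensional I" and b: "\<And>j. l $ j < f (\<nu> j) \<and> f (\<nu> j) < u $ j"
        by (auto simp: mem_box_cart space_PiM PiE_iff)
      have "l $ \<mu> i < f i \<and> f i < u $ \<mu> i" if "i \<in> I" for i
        using b[of "\<mu> i"] \<nu>\<mu>[OF that] by simp
      then show "f \<in> PiE I (\<lambda>i. {l $ \<mu> i<..<u $ \<mu> i})"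
        using ext by (simp add: PiE_iff)
    next
      fix f assume f: "f \<in> PiE I (\<lambda>i. {l $ \<mu> i<..<u $ \<mu> i})"
      then have "l $ j < f (\<nu> j) \<and> f (\<nu> j) < u $ j" for j
        using PiE_mem[OF f in_I[of j]] by (simp add: \<mu>)
      then show "f \<in> (\<lambda>f. \<chi> j. f (\<nu> j)) -` box l u \<inter> space (PiM I (\<lambda>_. lborel))"
        using f by (auto simp: mem_box_cart space_PiM PiE_iff)
    qed
    then have "emeasure (distr (PiM I (\<lambda>_. lborel)) borel (\<lambda>f. \<chi> j. f (\<nu> j))) (box l u) =
      emeasure (PiM I (\<lambda>_. lborel)) (PiE I (\<lambda>i. {l $ \<mu> i<..<u $ \<mu> i}))"
      by (subst emeasure_distr) simp_all
    also have "\<dots> = (\<Prod>i\<in>I. ennreal (u $ \<mu> i - l $ \<mu> i))"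
      using le' fin by (subst PL.emeasure_PiM) auto
    also have "\<dots> = (\<Prod>j\<in>UNIV. ennreal (u $ j - l $ j))"
      using prod.reindex_bij_betw[OF \<nu>, of "\<lambda>i. ennreal (u $ \<mu> i - l $ \<mu> i)"] by (simp add: \<mu>)
    also have "\<dots> = ennreal (\<Prod>j\<in>UNIV. u $ j - l $ j)"
      using le' by (intro prod_ennreal) auto
    also have "(\<Prod>j\<in>UNIV. u $ j - l $ j) = (\<Prod>b\<in>Basis. (u - l) \<bullet> b)"
    proof -
      have "(\<Prod>b\<in>(\<lambda>j. axis j 1) ` (UNIV :: 'n set). (u - l) \<bullet> b) = (\<Prod>j\<in>UNIV. (u - l) $ j)"
        by (subst prod.reindex) (auto simp: inj_on_def axis_eq_axis inner_axis)
      moreover have "(\<lambda>j. axis j 1) ` (UNIV :: 'n set) = (Basis :: (real ^ 'n) set)"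
        by (auto simp: Basis_vec_def)
      ultimately show ?thesis by simp
    qed
    finally show "emeasure (distr (PiM I (\<lambda>_. lborel)) borel (\<lambda>f. \<chi> j. f (\<nu> j))) (box l u) =
       ennreal (\<Prod>b\<in>Basis. (u - l) \<bullet> b)" .
  qed simp
qed

lemma lborel_vec_eq:
  "(lborel :: (real ^ 'n::finite) measure) = distr (PiM UNIV (\<lambda>_. lborel)) borel (\<lambda>f. \<chi> j. f j)"
  by (rule lborel_vec_reindex(1)[OF bij_betw_id, unfolded id_apply])

lemma measurable_vec_lambda [measurable]:
  "(\<lambda>f. \<chi> j. f j) \<in> PiM (UNIV :: 'n::finite set) (\<lambda>_. lborel) \<rightarrow>\<^sub>M (borel :: (real ^ 'n) measure)"
  by (rule lborel_vec_reindex(2)[OF bij_betw_id, unfolded id_apply])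

lemma nn_integral_lborel_vec:
  fixes F :: "real ^ 'n::finite \<Rightarrow> ennreal"
  assumes [measurable]: "F \<in> borel_measurable borel"
  shows "(\<integral>\<^sup>+x. F x \<partial>lborel) = (\<integral>\<^sup>+f. F (\<chi> j. f j) \<partial>PiM UNIV (\<lambda>_. lborel))"
  by (subst lborel_vec_eq, subst nn_integral_distr) simp_all

lemma emeasure_lborel_vec_box:
  fixes A :: "'m::finite \<Rightarrow> real set"
  assumes A: "\<And>j. A j \<in> sets borel"
  shows "emeasure lborel {y :: real ^ 'm. \<forall>j. y $ j \<in> A j} = (\<Prod>j\<in>UNIV. emeasure lborel (A j))"
    and "{y :: real ^ 'm. \<forall>j. y $ j \<in> A j} \<in> sets borel"
proof -
  have "{y :: real ^ 'm. \<forall>j. y $ j \<in> A j} = (\<Inter>j. (\<lambda>y. y $ j) -` A j)" by auto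
  moreover have "(\<lambda>y :: real ^ 'm. y $ j) -` A j \<in> sets borel" for j
    using measurable_sets[of "\<lambda>y :: real ^ 'm. y $ j" borel borel "A j"] A by simp
  ultimately show S: "{y :: real ^ 'm. \<forall>j. y $ j \<in> A j} \<in> sets borel"
    by (simp add: sets.finite_INT)
  have "emeasure lborel {y :: real ^ 'm. \<forall>j. y $ j \<in> A j} =
     emeasure (PiM UNIV (\<lambda>_. lborel)) ((\<lambda>f. \<chi> j. f j) -` {y :: real ^ 'm. \<forall>j. y $ j \<in> A j} \<inter> space (PiM UNIV (\<lambda>_. lborel)))"
    by (subst lborel_vec_eq, subst emeasure_distr) (use S in auto)
  also have "(\<lambda>f. \<chi> j. f j) -` {y :: real ^ 'm. \<forall>j. y $ j \<in> A j} \<inter> space (PiM UNIV (\<lambda>_. lborel)) = PiE UNIV A"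
    by (auto simp: space_PiM PiE_iff)
  also have "emeasure (PiM UNIV (\<lambda>_. lborel)) (PiE UNIV A) = (\<Prod>j\<in>UNIV. emeasure lborel (A j))"
    using A by (intro PL.emeasure_PiM) auto
  finally show "emeasure lborel {y :: real ^ 'm. \<forall>j. y $ j \<in> A j} = (\<Prod>j\<in>UNIV. emeasure lborel (A j))" .
qed

section \<open>Layer-cake comparison and one-variable kernels\<close>

lemma nn_integral_powr_layer:
  assumes "x > 0" "s > (0::real)"
  shows "(\<integral>\<^sup>+y. ennreal (s * y powr (- s - 1)) * indicator {x..} y \<partial>lborel) = ennreal (x powr (- s))"
proof (rule nn_integral_has_integral_lebesgue')
  have "((\<lambda>y. s * y powr (- s - 1)) has_integral s * (-(x powr (- s - 1 + 1)) / (- s - 1 + 1))) {x..}"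
    using assms by (intro has_integral_mult_right has_integral_powr_to_inf) auto
  then show "((\<lambda>y. s * y powr (- s - 1)) has_integral x powr (- s)) {x..}"
    using assms by simp
qed (use assms in auto)

text \<open>The integral of \<open>f x powr (- s)\<close> equals that of
  \<open>s * y powr (- s - 1)\<close> times the measure of the sublevel set at height
  \<open>y\<close>. A comparison of sublevel sets, even on different spaces, thus carries over to
  the integrals.\<close>

lemma nn_integral_powr_le_of_sublevel:
  assumes A: "sigma_finite_measure A" and B: "sigma_finite_measure B"
    and [measurable]: "f \<in> borel_measurable A" "g \<in> borel_measurable B"
    and pos: "\<And>x. x \<in> space A \<Longrightarrow> f x > 0" "\<And>x. x \<in> space B \<Longrightarrow> g x > 0" and s: "s > (0::real)"
    and le: "\<And>y. y > 0 \<Longrightarrow> emeasure A {x \<in> space A. f x \<le> y} \<le> C * emeasure B {x \<in> space B. g x \<le> y}"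
  shows "(\<integral>\<^sup>+x. ennreal (f x powr (- s)) \<partial>A) \<le> C * (\<integral>\<^sup>+x. ennreal (g x powr (- s)) \<partial>B)"
proof -
  have layer: "(\<integral>\<^sup>+x. ennreal (h x powr (- s)) \<partial>M) =
     (\<integral>\<^sup>+y. ennreal (s * y powr (- s - 1)) * emeasure M {x \<in> space M. h x \<le> y} \<partial>lborel)"
    "(\<lambda>y. emeasure M {x \<in> space M. h x \<le> y}) \<in> borel_measurable lborel"
    if M: "sigma_finite_measure M" and [measurable]: "h \<in> borel_measurable M"
      and pos: "\<And>x. x \<in> space M \<Longrightarrow> h x > 0" for M :: "'x measure" and h
  proof -
    have ind: "(indicator {h x..} y :: ennreal) = indicator {x \<in> space M. h x \<le> y} x"
      if "x \<in> space M" for x y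
      using that by (auto simp: indicator_def)
    have m [measurable]: "(\<lambda>(x, y). indicator {h x..} y :: ennreal) \<in> borel_measurable (M \<Otimes>\<^sub>M lborel)"
      unfolding indicator_def by simp
    have e: "(\<integral>\<^sup>+x. indicator {h x..} y \<partial>M) = emeasure M {x \<in> space M. h x \<le> y}" for y
      by (simp add: ind cong: nn_integral_cong)
    have "(\<integral>\<^sup>+x. ennreal (h x powr (- s)) \<partial>M) =
      (\<integral>\<^sup>+x. \<integral>\<^sup>+y. ennreal (s * y powr (- s - 1)) * indicator {h x..} y \<partial>lborel \<partial>M)"
      by (intro nn_integral_cong) (simp add: nn_integral_powr_layer pos s)
    also have "\<dots> = (\<integral>\<^sup>+y. \<integral>\<^sup>+x. ennreal (s * y powr (- s - 1)) * indicator {h x..} y \<partial>M \<partial>lborel)"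
      by (rule pair_sigma_finite.Fubini')
         (simp_all add: pair_sigma_finite.intro sigma_finite_lborel M, measurable)
    also have "\<dots> = (\<integral>\<^sup>+y. ennreal (s * y powr (- s - 1)) * (\<integral>\<^sup>+x. indicator {h x..} y \<partial>M) \<partial>lborel)"
      by (intro nn_integral_cong nn_integral_cmult) measurable
    finally show "(\<integral>\<^sup>+x. ennreal (h x powr (- s)) \<partial>M) =
     (\<integral>\<^sup>+y. ennreal (s * y powr (- s - 1)) * emeasure M {x \<in> space M. h x \<le> y} \<partial>lborel)"
      unfolding e .
    have "(\<lambda>y. \<integral>\<^sup>+x. indicator {h x..} y \<partial>M) \<in> borel_measurable lborel"
      by (rule sigma_finite_measure.borel_measurable_nn_integral[OF M]) measurable
    then show "(\<lambda>y. emeasure M {x \<in> space M. h x \<le> y}) \<in> borel_measurable lborel"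
      unfolding e .
  qed
  have lB [measurable]: "(\<lambda>y. emeasure B {x \<in> space B. g x \<le> y}) \<in> borel_measurable lborel"
    by (rule layer(2)) (use assms in auto)
  have "(\<integral>\<^sup>+x. ennreal (f x powr (- s)) \<partial>A) =
     (\<integral>\<^sup>+y. ennreal (s * y powr (- s - 1)) * emeasure A {x \<in> space A. f x \<le> y} \<partial>lborel)"
    by (rule layer(1)) (use assms in auto)
  also have "\<dots> \<le> (\<integral>\<^sup>+y. C * (ennreal (s * y powr (- s - 1)) * emeasure B {x \<in> space B. g x \<le> y}) \<partial>lborel)"
  proof (rule nn_integral_mono)
    fix y :: real
    have "emeasure A {x \<in> space A. f x \<le> y} \<le> C * emeasure B {x \<in> space B. g x \<le> y}"
    proof (cases "y > 0")
      case False
      then have e: "{x \<in> space A. f x \<le> y} = {}" using pos(1) by force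
      show ?thesis unfolding e by simp
    qed (rule le)
    from mult_left_mono[OF this, of "ennreal (s * y powr (- s - 1))"]
    show "ennreal (s * y powr (- s - 1)) * emeasure A {x \<in> space A. f x \<le> y} \<le>
       C * (ennreal (s * y powr (- s - 1)) * emeasure B {x \<in> space B. g x \<le> y})"
      by (simp add: mult_ac)
  qed
  also have "\<dots> = C * (\<integral>\<^sup>+y. ennreal (s * y powr (- s - 1)) * emeasure B {x \<in> space B. g x \<le> y} \<partial>lborel)"
    by (rule nn_integral_cmult) measurable
  also have "(\<integral>\<^sup>+y. ennreal (s * y powr (- s - 1)) * emeasure B {x \<in> space B. g x \<le> y} \<partial>lborel) =
     (\<integral>\<^sup>+x. ennreal (g x powr (- s)) \<partial>B)"
    by (rule layer(1)[symmetric]) (use assms in auto)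
  finally show ?thesis .
qed

text \<open>
  A kernel of scaling degree \<open>-1\<close> up to the factor that makes it integrable at both ends. The
  value at \<open>0\<close> makes pointwise bounds by products of such kernels hold everywhere.
\<close>

definition two_sided :: "real \<Rightarrow> real \<Rightarrow> ennreal" where
  "two_sided \<delta> u = (if u = 0 then \<infinity> else ennreal (inverse \<bar>u\<bar> * min \<bar>u\<bar> (inverse \<bar>u\<bar>) powr \<delta>))"

lemma measurable_two_sided [measurable]: "two_sided \<delta> \<in> borel_measurable borel"
  unfolding two_sided_def by measurable

text \<open>The kernel is \<open>\<bar>u\<bar> powr (\<delta> - 1)\<close> near 0 and
  \<open>\<bar>u\<bar> powr (- \<delta> - 1)\<close> near infinity, both integrable because
  \<open>\<delta> > 0\<close>.\<close>

lemma nn_integral_two_sided: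
  assumes \<delta>: "\<delta> > 0"
  shows "(\<integral>\<^sup>+u. two_sided \<delta> u \<partial>lborel) < \<infinity>"
proof -
  define g where "g u = ennreal (u powr (\<delta> - 1)) * indicator {0..1} u +
      ennreal (u powr (- \<delta> - 1)) * indicator {1..} u" for u :: real
  have [measurable]: "g \<in> borel_measurable borel" unfolding g_def by measurable
  have "(\<integral>\<^sup>+u. ennreal (u powr (\<delta> - 1)) * indicator {0..1} u \<partial>lborel) = ennreal (1 / \<delta>)"
    by (rule nn_integral_has_integral_lebesgue')
       (use \<delta> has_integral_powr_from_0[of "\<delta> - 1" 1] in auto)
  moreover have "(\<integral>\<^sup>+u. ennreal (u powr (- \<delta> - 1)) * indicator {1..} u \<partial>lborel) = ennreal (1 / \<delta>)"
    by (rule nn_integral_has_integral_lebesgue')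
       (use \<delta> has_integral_powr_to_inf[of "- \<delta> - 1" 1] in auto)
  ultimately have fin: "(\<integral>\<^sup>+u. g u \<partial>lborel) < \<infinity>"
    unfolding g_def by (subst nn_integral_add) auto
  have "two_sided \<delta> u \<le> g u + g (- u)" if "u \<noteq> 0" for u
  proof -
    have *: "two_sided \<delta> u \<le> g u" if "u > 0" for u
    proof (cases "u \<le> 1")
      case True
      then have "u \<le> inverse u" using that one_le_inverse[of u] by linarith
      then have "min u (inverse u) = u" by simp
      then have "two_sided \<delta> u = ennreal (u powr (\<delta> - 1))"
        using that by (simp add: two_sided_def powr_diff divide_inverse mult.commute)
      then show ?thesis using True that by (simp add: g_def)
    next
      case False
      then have "inverse u \<le> u" using that inverse_le_1_iff[of u] by linarith
      then have "min u (inverse u) = inverse u" by simp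
      then have "two_sided \<delta> u = ennreal (u powr (- \<delta> - 1))"
        using that by (simp add: two_sided_def powr_diff powr_minus inverse_powr divide_inverse mult.commute)
      then show ?thesis using False by (simp add: g_def)
    qed
    have sym: "two_sided \<delta> (- u) = two_sided \<delta> u" by (simp add: two_sided_def)
    show ?thesis
    proof (cases "u > 0")
      case True
      then show ?thesis using *[of u] by (simp add: add_increasing2)
    next
      case False
      then show ?thesis using *[of "- u"] sym that by (simp add: add_increasing)
    qed
  qed
  moreover have "AE u in lborel. u \<noteq> (0::real)" by (rule AE_lborel_singleton)
  ultimately have "(\<integral>\<^sup>+u. two_sided \<delta> u \<partial>lborel) \<le> (\<integral>\<^sup>+u. g u + g (- u) \<partial>lborel)"
    by (intro nn_integral_mono_AE) auto
  also have "\<dots> = (\<integral>\<^sup>+u. g u \<partial>lborel) + (\<integral>\<^sup>+u. g (- u) \<partial>lborel)"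
    by (rule nn_integral_add) measurable
  also have "(\<integral>\<^sup>+u. g (- u) \<partial>lborel) = (\<integral>\<^sup>+u. g u \<partial>lborel)"
    using nn_integral_lborel_scale[of g "-1"] by simp
  finally show ?thesis using fin by (simp add: order_le_less_trans)
qed

lemma ennreal_prod_nonzero:
  fixes f :: "'i \<Rightarrow> ennreal"
  shows "(\<And>i. i \<in> A \<Longrightarrow> f i \<noteq> 0) \<Longrightarrow> prod f A \<noteq> 0"
  by (induction A rule: infinite_finite_induct) auto

text \<open>The factors other than \<open>y b\<close> contribute at most
  \<open>\<rho> ^ (N - 1)\<close> to a product equal to 1, so \<open>y b\<close> cannot be small;
  one more factor \<open>\<rho>\<close> bounds \<open>y a\<close>.\<close>

lemma le_power_of_prod_eq_1:
  fixes y :: "nat \<Rightarrow> real"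
  assumes pos: "\<And>k. k < N \<Longrightarrow> 0 < y k" and prod: "(\<Prod>k<N. y k) = 1"
    and le: "\<And>k. k < N \<Longrightarrow> y k \<le> \<rho>" and ab: "a < N" "b < N"
  shows "y a \<le> y b * \<rho> ^ N"
proof -
  have \<rho>: "0 < \<rho>" using pos[OF ab(1)] le[OF ab(1)] by linarith
  have "1 = y b * (\<Prod>k\<in>{..<N} - {b}. y k)"
    using prod prod.remove[of "{..<N}" b y] ab by simp
  also have "\<dots> \<le> y b * (\<Prod>k\<in>{..<N} - {b}. \<rho>)"
    using pos le ab by (intro mult_left_mono prod_mono) (auto intro: less_imp_le)
  also have "\<dots> = y b * \<rho> ^ (N - 1)" using ab by simp
  finally have "\<rho> \<le> y b * \<rho> ^ (N - 1) * \<rho>" using \<rho> by simp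
  also have "\<dots> = y b * \<rho> ^ N" using ab by (simp flip: power_Suc2)
  finally show ?thesis using le[OF ab(1)] by linarith
qed

section \<open>Exponents\<close>

text \<open>Functions vanishing outside \<open>S\<close> keep the induction on \<open>S\<close>
  within one type. Slicing by the value at the new index gives the hockey-stick sum; finiteness is
  carried along for the cardinality of the disjoint union.\<close>

lemma card_bounded_sum:
  assumes "finite S"
  shows "card {\<alpha> :: 'i \<Rightarrow> nat. (\<forall>i. i \<notin> S \<longrightarrow> \<alpha> i = 0) \<and> (\<Sum>i\<in>S. \<alpha> i) \<le> d} = (card S + d) choose d
    \<and> finite {\<alpha> :: 'i \<Rightarrow> nat. (\<forall>i. i \<notin> S \<longrightarrow> \<alpha> i = 0) \<and> (\<Sum>i\<in>S. \<alpha> i) \<le> d}"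
  using assms
proof (induction S arbitrary: d rule: finite_induct)
  case empty
  have "{\<alpha> :: 'i \<Rightarrow> nat. \<forall>i. \<alpha> i = 0} = {\<lambda>_. 0}" by auto
  then show ?case by simp
next
  case (insert i S)
  let ?X = "\<lambda>S d. {\<alpha> :: 'i \<Rightarrow> nat. (\<forall>i. i \<notin> S \<longrightarrow> \<alpha> i = 0) \<and> (\<Sum>i\<in>S. \<alpha> i) \<le> d}"
  have upd: "(\<Sum>j\<in>S. (\<alpha>(i := k)) j) = (\<Sum>j\<in>S. \<alpha> j)" for \<alpha> :: "'i \<Rightarrow> nat" and k
    using insert.hyps by (intro sum.cong) auto
  have eq: "?X (insert i S) d = (\<Union>k\<in>{..d}. (\<lambda>\<alpha>. \<alpha>(i := k)) ` ?X S (d - k))"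
  proof (intro set_eqI iffI)
    fix \<alpha> assume \<alpha>: "\<alpha> \<in> ?X (insert i S) d"
    then have "\<alpha> i + (\<Sum>i\<in>S. \<alpha> i) \<le> d" using insert.hyps by simp
    then have "\<alpha>(i := 0) \<in> ?X S (d - \<alpha> i)" "\<alpha> i \<le> d" using \<alpha> upd[of \<alpha> 0] by auto
    moreover have "\<alpha> = (\<alpha>(i := 0))(i := \<alpha> i)" by simp
    ultimately show "\<alpha> \<in> (\<Union>k\<in>{..d}. (\<lambda>\<alpha>. \<alpha>(i := k)) ` ?X S (d - k))" by blast
  next
    fix \<alpha> assume "\<alpha> \<in> (\<Union>k\<in>{..d}. (\<lambda>\<alpha>. \<alpha>(i := k)) ` ?X S (d - k))"
    then obtain k \<beta> where "k \<le> d" "\<beta> \<in> ?X S (d - k)" "\<alpha> = \<beta>(i := k)" by blast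
    then show "\<alpha> \<in> ?X (insert i S) d"
      using insert.hyps upd[of \<beta> k] by auto
  qed
  have inj: "inj_on (\<lambda>\<alpha>. \<alpha>(i := k)) (?X S (d - k))" for k
  proof (rule inj_onI)
    fix \<alpha> \<beta> assume "\<alpha> \<in> ?X S (d - k)" "\<beta> \<in> ?X S (d - k)" "\<alpha>(i := k) = \<beta>(i := k)"
    then show "\<alpha> = \<beta>" using insert.hyps by (auto simp: fun_eq_iff split: if_splits) metis
  qed
  have fin: "finite (?X S d')" and card: "card (?X S d') = (card S + d') choose d'" for d'
    using insert.IH[of d'] by auto
  have "card (?X (insert i S) d) = (\<Sum>k\<le>d. card ((\<lambda>\<alpha>. \<alpha>(i := k)) ` ?X S (d - k)))"
    unfolding eq
  proof (rule card_UN_disjoint)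
    show "\<forall>k\<in>{..d}. \<forall>l\<in>{..d}. k \<noteq> l \<longrightarrow>
      (\<lambda>\<alpha>. \<alpha>(i := k)) ` ?X S (d - k) \<inter> (\<lambda>\<alpha>. \<alpha>(i := l)) ` ?X S (d - l) = {}"
      by (auto simp: fun_eq_iff) metis
  qed (use fin in auto)
  also have "\<dots> = (\<Sum>k\<le>d. (card S + (d - k)) choose (d - k))"
    by (simp add: card_image[OF inj] card)
  also have "\<dots> = (\<Sum>k\<le>d. (card S + k) choose k)"
    by (rule sum.reindex_bij_witness[of _ "\<lambda>k. d - k" "\<lambda>k. d - k"]) auto
  also have "\<dots> = (card (insert i S) + d) choose d"
    using insert.hyps by (simp add: sum_choose_lower)
  finally show ?case unfolding eq using fin by auto
qed

lemma card_exponents: "card (exponents d :: ('n::finite \<Rightarrow> nat) set) = (CARD('n) + d) choose d"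
  using card_bounded_sum[of "UNIV :: 'n set" d] by (simp add: exponents_def)

text \<open>
  The slack \<open>d - |\<alpha>|\<close> is exchanged with any of the \<open>CARD('n)\<close> entries by an involution.
\<close>

lemma sum_exponents:
  "(CARD('n) + 1) * (\<Sum>\<alpha>\<in>(exponents d :: ('n::finite \<Rightarrow> nat) set). \<alpha> i) =
     d * card (exponents d :: ('n \<Rightarrow> nat) set)"
proof -
  let ?E = "exponents d :: ('n \<Rightarrow> nat) set"
  let ?sw = "\<lambda>j \<alpha>. \<alpha>(j := d - (\<Sum>i\<in>UNIV. \<alpha> i))"
  define T where "T = (\<Sum>\<alpha>\<in>?E. d - (\<Sum>i\<in>UNIV. \<alpha> i))"
  have sw: "(\<Sum>i\<in>UNIV. ?sw j \<alpha> i) = d - \<alpha> j" if "\<alpha> \<in> ?E" for \<alpha> and j :: 'n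
  proof -
    have "(\<Sum>i\<in>UNIV. \<alpha> i) = \<alpha> j + (\<Sum>i\<in>UNIV - {j}. \<alpha> i)" by (rule sum.remove) auto
    moreover have "(\<Sum>i\<in>UNIV. ?sw j \<alpha> i) = ?sw j \<alpha> j + (\<Sum>i\<in>UNIV - {j}. ?sw j \<alpha> i)"
      by (rule sum.remove) auto
    moreover have "(\<Sum>i\<in>UNIV - {j}. ?sw j \<alpha> i) = (\<Sum>i\<in>UNIV - {j}. \<alpha> i)"
      by (intro sum.cong) auto
    ultimately show ?thesis using that by (simp add: exponents_def)
  qed
  have le: "\<alpha> j \<le> d" if "\<alpha> \<in> ?E" for \<alpha> and j :: 'n
    using that member_le_sum[of j UNIV \<alpha>] by (simp add: exponents_def)
  have S: "(\<Sum>\<alpha>\<in>?E. \<alpha> j) = T" for j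
    unfolding T_def
  proof (rule sum.reindex_bij_witness[of _ "?sw j" "?sw j"])
    fix \<alpha> assume \<alpha>: "\<alpha> \<in> ?E"
    then have s: "(\<Sum>i\<in>UNIV. \<alpha> i) \<le> d" by (simp add: exponents_def)
    show "?sw j \<alpha> \<in> ?E" unfolding exponents_def using sw[OF \<alpha>, of j] by simp
    show "?sw j (?sw j \<alpha>) = \<alpha>" unfolding sw[OF \<alpha>] using le[OF \<alpha>, of j] by auto
    show "d - (\<Sum>i\<in>UNIV. ?sw j \<alpha> i) = \<alpha> j" unfolding sw[OF \<alpha>] using le[OF \<alpha>, of j] by auto
    show "?sw j \<alpha> \<in> ?E" "?sw j (?sw j \<alpha>) = \<alpha>" by fact+
  qed
  \<comment> \<open>The entries and the slack of each exponent add up to \<open>d\<close>, and every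
    entry has the same total as the slack, namely \<open>T\<close>.\<close>
  have "(\<Sum>i\<in>UNIV. \<Sum>\<alpha>\<in>?E. \<alpha> i) + T = (\<Sum>\<alpha>\<in>?E. (\<Sum>i\<in>UNIV. \<alpha> i) + (d - (\<Sum>i\<in>UNIV. \<alpha> i)))"
    unfolding T_def by (subst sum.swap) (simp add: sum.distrib)
  also have "\<dots> = (\<Sum>\<alpha>\<in>?E. d)" by (intro sum.cong) (auto simp: exponents_def)
  finally show ?thesis by (simp add: S algebra_simps)
qed

section \<open>The lexicographic order\<close>

lemma lexless_irrefl: "\<not> lexless js \<alpha> \<alpha>"
  by (induction js) auto

lemma lexless_trans: "lexless js \<alpha> \<beta> \<Longrightarrow> lexless js \<beta> \<gamma> \<Longrightarrow> lexless js \<alpha> \<gamma>"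
  by (induction js) auto

lemma lexless_total:
  "(\<And>j. j \<notin> set js \<Longrightarrow> \<alpha> j = \<beta> j) \<Longrightarrow> \<alpha> \<noteq> \<beta> \<Longrightarrow> lexless js \<alpha> \<beta> \<or> lexless js \<beta> \<alpha>"
proof (induction js)
  case (Cons j js)
  show ?case
  proof (cases "\<alpha> j = \<beta> j")
    case True
    then have "\<alpha> k = \<beta> k" if "k \<notin> set js" for k
      using Cons.prems(1)[of k] that by (cases "k = j") auto
    then show ?thesis using Cons.IH Cons.prems(2) True by auto
  qed auto
qed auto

lemma not_lexless_zero: "\<not> lexless js \<beta> (\<lambda>_. 0)"
  by (induction js) auto

lemma ex_increasing_enumeration:
  assumes "finite X" and irr: "\<And>x. \<not> R x x" and tr: "\<And>x y z. R x y \<Longrightarrow> R y z \<Longrightarrow> R x z"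
    and tot: "\<And>x y. x \<in> X \<Longrightarrow> y \<in> X \<Longrightarrow> x \<noteq> y \<Longrightarrow> R x y \<or> R y x"
  shows "\<exists>e. bij_betw e {..<card X} X \<and> (\<forall>r k. r < k \<longrightarrow> k < card X \<longrightarrow> R (e r) (e k))"
  using assms(1,4)
proof (induction "card X" arbitrary: X)
  case 0
  then show ?case by (auto simp: bij_betw_def)
next
  case (Suc N)
  \<comment> \<open>A largest element is one with the most elements below it.\<close>
  define below where "below x = card {y \<in> X. R y x}" for x
  have "X \<noteq> {}" using Suc.hyps by auto
  then have "Max (below ` X) \<in> below ` X" using Suc.prems(1) by (intro Max_in) auto
  then obtain m where m0: "m \<in> X" "Max (below ` X) = below m" by auto
  have m: "m \<in> X" "\<And>x. x \<in> X \<Longrightarrow> below x \<le> below m"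
    using m0 Suc.prems(1) Max_ge[of "below ` X"] by auto
  have max: "R x m" if "x \<in> X" "x \<noteq> m" for x
  proof (rule ccontr)
    assume "\<not> R x m"
    then have "R m x" using Suc.prems(2) that m(1) by blast
    then have "{y \<in> X. R y m} \<subset> {y \<in> X. R y x}" using m(1) tr irr by blast
    then have "below m < below x" unfolding below_def using Suc.prems(1) by (intro psubset_card_mono) auto
    then show False using m(2)[OF that(1)] by simp
  qed
  have c: "N = card (X - {m})" using Suc.hyps(2) Suc.prems(1) m(1) by simp
  from Suc.hyps(1)[OF c] Suc.prems obtain e where
    e: "bij_betw e {..<N} (X - {m})" "\<And>r k. r < k \<Longrightarrow> k < N \<Longrightarrow> R (e r) (e k)"
    using c by auto
  have img: "e r \<in> X" "e r \<noteq> m" if "r < N" for r using e(1) that by (auto simp: bij_betw_def)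
  show ?case
  proof (intro exI[of _ "e(N := m)"] conjI allI impI)
    have "bij_betw (e(N := m)) {..<N} (X - {m})"
      using e(1) by (rule bij_betw_cong[THEN iffD1, rotated]) auto
    then have "bij_betw (e(N := m)) (insert N {..<N}) (insert m (X - {m}))"
      using notIn_Un_bij_betw[of N "{..<N}" "e(N := m)" "X - {m}"] by simp
    moreover have "insert m (X - {m}) = X" using m by auto
    ultimately show "bij_betw (e(N := m)) {..<card X} X"
      by (simp add: Suc.hyps(2)[symmetric] lessThan_Suc)
    show "R ((e(N := m)) r) ((e(N := m)) k)" if "r < k" "k < card X" for r k
      using that e(2)[of r k] max img Suc.hyps(2) by auto
  qed
qed


section \<open>Integrating powers of lexicographically monic families\<close>

text \<open>Monomials are listed in lexicographically increasing order so that each pivot of the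
  generalised Vandermonde matrix is lexicographically monic in its own point; \<open>js\<close>
  fixes the priority of the variables.\<close>

locale exponent_enumeration =
  fixes d :: nat and js :: "'n::finite list" and e :: "nat \<Rightarrow> 'n \<Rightarrow> nat" and N :: nat
  assumes d_pos: "d \<ge> 1"
    and js: "distinct js" "set js = UNIV"
    and e_bij: "bij_betw e {..<N} (exponents d)"
    and e_less: "r < k \<Longrightarrow> k < N \<Longrightarrow> lexless js (e r) (e k)"
begin

definition \<phi> :: "nat \<Rightarrow> real ^ 'n \<Rightarrow> real" where
  "\<phi> k t = (\<Prod>i\<in>UNIV. (t $ i) ^ e k i)"

definition index :: "('n \<Rightarrow> nat) \<Rightarrow> nat" where
  "index = inv_into {..<N} e"

lemma e_index: "\<alpha> \<in> exponents d \<Longrightarrow> e (index \<alpha>) = \<alpha>"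
  and index_less: "\<alpha> \<in> exponents d \<Longrightarrow> index \<alpha> < N"
  and index_e: "k < N \<Longrightarrow> index (e k) = k"
  and e_in: "k < N \<Longrightarrow> e k \<in> exponents d"
  using e_bij bij_betw_inv_into_right[OF e_bij] bij_betw_inv_into_left[OF e_bij]
    bij_betwE[OF bij_betw_inv_into[OF e_bij]] bij_betwE[OF e_bij]
  by (auto simp: index_def)

lemma N_eq: "N = (CARD('n) + d) choose d"
  using bij_betw_same_card[OF e_bij] by (simp add: card_exponents)

lemma zero_exponent: "(\<lambda>_. 0) \<in> exponents d" and unit_exponent: "(\<lambda>j. if j = i then 1 else 0) \<in> exponents d"
  using d_pos by (auto simp: exponents_def)

lemma index_zero: "index (\<lambda>_. 0) = 0"
proof (rule ccontr)
  assume "index (\<lambda>_. 0) \<noteq> 0"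
  then have "lexless js (e 0) (\<lambda>_. 0)"
    using e_less[of 0 "index (\<lambda>_. 0)"] index_less[OF zero_exponent] e_index[OF zero_exponent] by simp
  then show False by (simp add: not_lexless_zero)
qed

lemma e_0: "e 0 = (\<lambda>_. 0)"
  using e_index[OF zero_exponent] by (simp add: index_zero)

lemma N_pos: "0 < N"
  using index_less[OF zero_exponent] by simp

lemma \<phi>_0 [simp]: "\<phi> 0 t = 1"
  by (simp add: \<phi>_def e_0)

lemma e_le: "k < N \<Longrightarrow> e k i \<le> d"
  using e_in[of k] member_le_sum[of i UNIV "e k"] by (simp add: exponents_def)

lemma measurable_\<phi> [measurable]: "\<phi> k \<in> borel_measurable borel"
  unfolding \<phi>_def by (intro borel_measurable_continuous_onI continuous_intros)

text \<open>Its reciprocal is the average exponent of each variable over all monomials, as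
  \<open>sum_e\<close> records. In absolute value, the product of all \<open>N\<close> monomials is
  therefore the product of the variables to the power \<open>N / s\<close>.\<close>

definition s :: real where "s = (real CARD('n) + 1) / real d"

lemma s_pos: "s > 0" using d_pos by (simp add: s_def)

lemma length_js: "length js = CARD('n)"
  using js distinct_card by metis

lemma sum_e: "(\<Sum>k<N. real (e k i)) = real N / s"
proof -
  have "(\<Sum>k<N. e k i) = (\<Sum>\<alpha>\<in>exponents d. \<alpha> i)"
    using sum.reindex_bij_betw[OF e_bij, of "\<lambda>\<alpha>. \<alpha> i"] by simp
  then have "(CARD('n) + 1) * (\<Sum>k<N. e k i) = d * N"
    using sum_exponents[where 'n='n, of i d] bij_betw_same_card[OF e_bij] by simp
  then have "real ((CARD('n) + 1) * (\<Sum>k<N. e k i)) = real (d * N)"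
    by (rule arg_cong)
  then have "(real CARD('n) + 1) * (\<Sum>k<N. real (e k i)) = real d * real N"
    by (simp only: of_nat_mult of_nat_add of_nat_sum of_nat_1)
  then show ?thesis using d_pos by (simp add: s_def field_simps)
qed

definition mono_max :: "(nat \<Rightarrow> real) \<Rightarrow> ('n \<Rightarrow> real) \<Rightarrow> real" where
  "mono_max b h = Max ((\<lambda>k. b k * (\<Prod>i\<in>UNIV. \<bar>h i\<bar> ^ e k i)) ` {..<N})"

text \<open>
  After normalisation by \<open>(\<Prod>i. \<bar>h i\<bar>) powr (1 / s)\<close> the monomials have product \<open>1\<close>, so each of
  them is at least a power of their maximum; comparing the linear ones with the constant one
  gives the decay.
\<close>

lemma mono_max_powr_le:
  assumes h: "\<And>i. h i \<noteq> 0" and b: "\<And>k. k < N \<Longrightarrow> 0 < b k" "(\<Prod>k<N. b k) = 1"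
  defines "\<kappa> \<equiv> \<lambda>i. b (index (\<lambda>j. if j = i then 1 else 0)) / b 0"
  shows "mono_max b h powr (- s) \<le>
    (\<Prod>i\<in>UNIV. inverse \<bar>h i\<bar> * min (\<kappa> i * \<bar>h i\<bar>) (inverse (\<kappa> i * \<bar>h i\<bar>)) powr (s / (real CARD('n) * real N)))"
proof -
  define H where "H = (\<Prod>i\<in>UNIV. \<bar>h i\<bar>)"
  have H: "H > 0" unfolding H_def using h by (intro prod_pos) auto
  define m where "m k = b k * (\<Prod>i\<in>UNIV. \<bar>h i\<bar> ^ e k i)" for k
  have m: "m k > 0" if "k < N" for k
    unfolding m_def using h b(1)[OF that] by (intro mult_pos_pos prod_pos) auto
  define y where "y k = m k * H powr (- 1 / s)" for k
  define \<rho> where "\<rho> = mono_max b h * H powr (- 1 / s)"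
  have y: "y k > 0" if "k < N" for k using m[OF that] H by (simp add: y_def)
  have "m k \<le> mono_max b h" if "k < N" for k
    unfolding mono_max_def m_def using that by (intro Max_ge) auto
  then have y\<rho>: "y k \<le> \<rho>" if "k < N" for k using that by (simp add: y_def \<rho>_def mult_right_mono)
  have \<rho>: "\<rho> > 0" using y[OF N_pos] y\<rho>[OF N_pos] by linarith
  have mm: "mono_max b h = \<rho> * H powr (1 / s)"
    using H by (simp add: \<rho>_def mult.assoc flip: powr_add)
  \<comment> \<open>By \<open>sum_e\<close> every variable has total exponent \<open>N / s\<close>,
    which the normalisation of the \<open>N\<close> factors by \<open>H powr (- 1 / s)\<close>
    cancels exactly.\<close>
  have prod_y: "(\<Prod>k<N. y k) = 1"
  proof -
    have "(\<Prod>k<N. \<Prod>i\<in>UNIV. \<bar>h i\<bar> ^ e k i) = (\<Prod>i\<in>UNIV. \<Prod>k<N. \<bar>h i\<bar> ^ e k i)"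
      by (rule prod.swap)
    also have "\<dots> = (\<Prod>i\<in>UNIV. \<bar>h i\<bar> powr (real N / s))"
    proof (intro prod.cong refl)
      fix i
      have "(\<Prod>k<N. \<bar>h i\<bar> ^ e k i) = (\<Prod>k<N. \<bar>h i\<bar> powr real (e k i))"
        using h by (intro prod.cong) (auto simp: powr_realpow)
      also have "\<dots> = \<bar>h i\<bar> powr (\<Sum>k<N. real (e k i))"
        using h[of i] by (simp add: powr_sum)
      finally show "(\<Prod>k<N. \<bar>h i\<bar> ^ e k i) = \<bar>h i\<bar> powr (real N / s)" by (simp add: sum_e)
    qed
    also have "\<dots> = H powr (real N / s)"
      unfolding H_def by (rule prod_powr_distrib[symmetric])
    finally have "(\<Prod>k<N. m k) = H powr (real N / s)"
      by (simp add: m_def prod.distrib b(2))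
    moreover have "(\<Prod>k<N. H powr (- 1 / s)) = H powr (- (real N / s))"
    proof -
      have "(\<Prod>k<N. H powr (- 1 / s)) = (H powr (- 1 / s)) powr real N"
        using H by (subst powr_realpow) auto
      then show ?thesis by (simp add: powr_powr)
    qed
    ultimately show ?thesis
      using H by (simp add: y_def prod.distrib flip: powr_add)
  qed
  have cmp: "y a \<le> y b * \<rho> ^ N" if "a < N" "b < N" for a b
    using le_power_of_prod_eq_1[of N y \<rho> a b] y prod_y y\<rho> that by blast
  \<comment> \<open>\<open>\<kappa> i * \<bar>h i\<bar>\<close> is the ratio of the linear monomial
    in \<open>h i\<close> to the constant one; \<open>cmp\<close> bounds it in both
    directions.\<close>
  have \<kappa>: "inverse (\<rho> ^ N) \<le> min (\<kappa> i * \<bar>h i\<bar>) (inverse (\<kappa> i * \<bar>h i\<bar>))" for i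
  proof -
    let ?a = "index (\<lambda>j. if j = i then 1 else 0)"
    have a: "?a < N" by (rule index_less[OF unit_exponent])
    have "(\<Prod>j\<in>UNIV. \<bar>h j\<bar> ^ e ?a j) = (\<Prod>j\<in>UNIV. if j = i then \<bar>h j\<bar> else 1)"
      unfolding e_index[OF unit_exponent] by (intro prod.cong) auto
    also have "\<dots> = \<bar>h i\<bar>" by simp
    finally have ma: "m ?a = b ?a * \<bar>h i\<bar>" by (simp add: m_def)
    have m0: "m 0 = b 0" by (simp add: m_def e_0)
    have k: "\<kappa> i * \<bar>h i\<bar> = y ?a / y 0"
      using H by (simp add: \<kappa>_def y_def ma m0)
    have "inverse (\<rho> ^ N) \<le> y ?a / y 0"
      using cmp[OF N_pos a] y[OF N_pos] \<rho> by (simp add: field_simps)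
    moreover have "inverse (\<rho> ^ N) \<le> inverse (y ?a / y 0)"
      using cmp[OF a N_pos] y[OF N_pos] y[OF a] \<rho> by (simp add: field_simps)
    ultimately show ?thesis unfolding k by simp
  qed
  \<comment> \<open>The decay \<open>\<rho> powr (- s)\<close> is split evenly over the variables:
    the exponent satisfies \<open>CARD('n) * N * \<delta> = s\<close>.\<close>
  let ?\<delta> = "s / (real CARD('n) * real N)"
  have "mono_max b h powr (- s) = \<rho> powr (- s) * (H powr (1 / s)) powr (- s)"
    unfolding mm using \<rho> H by (simp add: powr_mult)
  also have "(H powr (1 / s)) powr (- s) = inverse H"
    using H s_pos by (simp add: powr_powr powr_minus)
  also have "inverse H = (\<Prod>i\<in>UNIV. inverse \<bar>h i\<bar>)" by (simp only: H_def prod_inversef[symmetric] o_def)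
  also have "\<rho> powr (- s) = (\<Prod>i\<in>(UNIV :: 'n set). inverse (\<rho> ^ N) powr ?\<delta>)"
  proof -
    have "inverse (\<rho> ^ N) = \<rho> powr (- real N)"
      using \<rho> by (subst powr_minus, subst powr_realpow) auto
    then have "inverse (\<rho> ^ N) powr ?\<delta> = \<rho> powr (- real N * ?\<delta>)"
      by (simp only: powr_powr)
    then have "(\<Prod>i\<in>(UNIV :: 'n set). inverse (\<rho> ^ N) powr ?\<delta>) = (\<rho> powr (- real N * ?\<delta>)) powr real CARD('n)"
      using \<rho> by (subst powr_realpow) simp_all
    also have "\<dots> = \<rho> powr (- s)" using N_pos by (simp add: powr_powr)
    finally show ?thesis ..
  qed
  finally have "mono_max b h powr (- s) =
      (\<Prod>i\<in>(UNIV :: 'n set). inverse (\<rho> ^ N) powr ?\<delta>) * (\<Prod>i\<in>UNIV. inverse \<bar>h i\<bar>)" .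
  also have "\<dots> \<le> (\<Prod>i\<in>UNIV. min (\<kappa> i * \<bar>h i\<bar>) (inverse (\<kappa> i * \<bar>h i\<bar>)) powr ?\<delta>) *
      (\<Prod>i\<in>UNIV. inverse \<bar>h i\<bar>)"
  proof (rule mult_right_mono)
    show "(\<Prod>i\<in>(UNIV :: 'n set). inverse (\<rho> ^ N) powr ?\<delta>) \<le>
        (\<Prod>i\<in>UNIV. min (\<kappa> i * \<bar>h i\<bar>) (inverse (\<kappa> i * \<bar>h i\<bar>)) powr ?\<delta>)"
    proof (intro prod_mono conjI powr_mono2)
      show "inverse (\<rho> ^ N) \<le> min (\<kappa> i * \<bar>h i\<bar>) (inverse (\<kappa> i * \<bar>h i\<bar>))" for i by (rule \<kappa>)
    qed (use \<rho> s_pos in auto)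
  qed (simp add: prod_nonneg)
  also have "\<dots> = (\<Prod>i\<in>UNIV. inverse \<bar>h i\<bar> * min (\<kappa> i * \<bar>h i\<bar>) (inverse (\<kappa> i * \<bar>h i\<bar>)) powr ?\<delta>)"
    unfolding prod.distrib by (rule mult.commute)
  finally show ?thesis .
qed

lemma measurable_mono_max [measurable]:
  "mono_max b \<in> borel_measurable (PiM UNIV (\<lambda>_. lborel))"
  unfolding mono_max_def using N_pos by (intro borel_measurable_Max) (auto, measurable)

text \<open>The integrand is dominated by a product of one-variable kernels. Rescaling the
  \<open>i\<close>-th variable by \<open>\<kappa> i\<close> removes the dependence on
  \<open>b\<close>, which makes the bound uniform.\<close>

lemma nn_integral_mono_max:
  assumes b: "\<And>k. k < N \<Longrightarrow> 0 < b k" "(\<Prod>k<N. b k) = 1"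
  shows "(\<integral>\<^sup>+h. ennreal (mono_max b h powr (- s)) \<partial>PiM UNIV (\<lambda>_. lborel)) \<le>
    (\<integral>\<^sup>+u. two_sided (s / (real CARD('n) * real N)) u \<partial>lborel) ^ CARD('n)"
proof -
  define \<kappa> where "\<kappa> i = b (index (\<lambda>j. if j = i then 1 else 0)) / b 0" for i
  have \<kappa>: "\<kappa> i > 0" for i
    using b(1)[OF index_less[OF unit_exponent]] b(1)[OF N_pos] by (simp add: \<kappa>_def)
  let ?\<delta> = "s / (real CARD('n) * real N)"
  have two: "ennreal (\<kappa> i) * two_sided ?\<delta> (\<kappa> i * u) =
     (if u = 0 then \<infinity> else ennreal (inverse \<bar>u\<bar> * min (\<kappa> i * \<bar>u\<bar>) (inverse (\<kappa> i * \<bar>u\<bar>)) powr ?\<delta>))" for i u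
    using \<kappa>[of i] by (simp add: two_sided_def abs_mult ennreal_mult_top flip: ennreal_mult)
  have "ennreal (mono_max b h powr (- s)) \<le> (\<Prod>i\<in>UNIV. ennreal (\<kappa> i) * two_sided ?\<delta> (\<kappa> i * h i))" for h
  proof (cases "\<forall>i. h i \<noteq> 0")
    case True
    then have "(\<Prod>i\<in>UNIV. ennreal (\<kappa> i) * two_sided ?\<delta> (\<kappa> i * h i)) =
       ennreal (\<Prod>i\<in>UNIV. inverse \<bar>h i\<bar> * min (\<kappa> i * \<bar>h i\<bar>) (inverse (\<kappa> i * \<bar>h i\<bar>)) powr ?\<delta>)"
      unfolding two by (simp add: prod_ennreal)
    then show ?thesis
      using mono_max_powr_le[of h b] True b unfolding \<kappa>_def by (simp add: ennreal_leI)
  next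
    case False
    then obtain i where "h i = 0" by blast
    \<comment> \<open>The pointwise bound covers nonzero coordinates. At \<open>h i = 0\<close> one
      kernel is infinite and none of the others is 0, so the product is infinite.\<close>
    have "ennreal (\<kappa> j) * two_sided ?\<delta> (\<kappa> j * h j) \<noteq> 0" for j
      unfolding two using \<kappa>[of j] by (auto simp: min_def)
    then have "(\<Prod>j\<in>UNIV - {i}. ennreal (\<kappa> j) * two_sided ?\<delta> (\<kappa> j * h j)) \<noteq> 0"
      by (intro ennreal_prod_nonzero) auto
    moreover have "ennreal (\<kappa> i) * two_sided ?\<delta> (\<kappa> i * h i) = \<infinity>"
      unfolding two using \<open>h i = 0\<close> by simp
    ultimately have "(\<Prod>i\<in>UNIV. ennreal (\<kappa> i) * two_sided ?\<delta> (\<kappa> i * h i)) = \<infinity>"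
      by (subst prod.remove[of UNIV i]) (simp_all only: finite UNIV_I ennreal_top_mult infinity_ennreal_def if_False)
    then show ?thesis by simp
  qed
  then have "(\<integral>\<^sup>+h. ennreal (mono_max b h powr (- s)) \<partial>PiM UNIV (\<lambda>_. lborel)) \<le>
    (\<integral>\<^sup>+h. (\<Prod>i\<in>UNIV. ennreal (\<kappa> i) * two_sided ?\<delta> (\<kappa> i * h i)) \<partial>PiM UNIV (\<lambda>_. lborel))"
    by (intro nn_integral_mono) auto
  also have "\<dots> = (\<Prod>i\<in>(UNIV :: 'n set). \<integral>\<^sup>+u. ennreal (\<kappa> i) * two_sided ?\<delta> (\<kappa> i * u) \<partial>lborel)"
    by (rule PL.product_nn_integral_prod) auto
  also have "\<dots> = (\<Prod>i\<in>(UNIV :: 'n set). \<integral>\<^sup>+u. two_sided ?\<delta> u \<partial>lborel)"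
  proof (intro prod.cong refl)
    fix i :: 'n
    show "(\<integral>\<^sup>+u. ennreal (\<kappa> i) * two_sided ?\<delta> (\<kappa> i * u) \<partial>lborel) = (\<integral>\<^sup>+u. two_sided ?\<delta> u \<partial>lborel)"
      using nn_integral_lborel_scale[of "two_sided ?\<delta>" "\<kappa> i"] \<kappa>[of i]
      by (subst nn_integral_cmult) auto
  qed
  finally show ?thesis by simp
qed

definition lexmonic :: "(nat \<Rightarrow> nat \<Rightarrow> real) \<Rightarrow> nat \<Rightarrow> real ^ 'n \<Rightarrow> real" where
  "lexmonic a k t = \<phi> k t + (\<Sum>r<k. a k r * \<phi> r t)"

definition poly_max :: "(nat \<Rightarrow> real) \<Rightarrow> (nat \<Rightarrow> nat \<Rightarrow> real) \<Rightarrow> real ^ 'n \<Rightarrow> real" where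
  "poly_max b a t = Max ((\<lambda>k. b k * \<bar>lexmonic a k t\<bar>) ` {..<N})"

lemma measurable_lexmonic [measurable]: "lexmonic a k \<in> borel_measurable borel"
  unfolding lexmonic_def by measurable

lemma measurable_poly_max [measurable]: "poly_max b a \<in> borel_measurable borel"
  unfolding poly_max_def using N_pos by (intro borel_measurable_Max) (auto, measurable)

lemma le_poly_max: "k < N \<Longrightarrow> b k * \<bar>lexmonic a k t\<bar> \<le> poly_max b a t"
  unfolding poly_max_def by (intro Max_ge) auto

lemma poly_max_pos: "0 < b 0 \<Longrightarrow> 0 < poly_max b a t"
  using le_poly_max[OF N_pos, of b a t] by (simp add: lexmonic_def)

text \<open>The maximum is at most \<open>y\<close> exactly when all constraints with weights
  \<open>b k / y\<close> hold, so \<open>emeasure_lexmonic_compress\<close> treats the whole family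
  at once.\<close>

lemma emeasure_poly_max_le:
  assumes b: "\<And>k. k < N \<Longrightarrow> 0 < b k" and y: "y > 0"
  shows "emeasure (PiM UNIV (\<lambda>_. lborel)) {h \<in> space (PiM UNIV (\<lambda>_. lborel)). poly_max b a (\<chi> j. h j) \<le> y} \<le>
    ennreal (real d ^ CARD('n)) * emeasure (PiM UNIV (\<lambda>_. lborel)) {h \<in> space (PiM UNIV (\<lambda>_. lborel)). mono_max b h \<le> y}"
proof -
  \<comment> \<open>The coefficients are re-indexed by exponents; they are nonzero only below index
    \<open>k\<close>, hence only at exponents preceding \<open>e k\<close>.\<close>
  define a' where "a' k \<beta> = (if index \<beta> < k then a k (index \<beta>) else 0)" for k \<beta>
  have P: "lexmonic a k (\<chi> j. h j) = (\<Prod>j\<in>set js. h j ^ e k j) +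
      (\<Sum>\<beta>\<in>exponents d. a' k \<beta> * (\<Prod>j\<in>set js. h j ^ \<beta> j))" if "k < N" for k h
  proof -
    have "(\<Sum>\<beta>\<in>exponents d. a' k \<beta> * (\<Prod>j\<in>UNIV. h j ^ \<beta> j)) =
       (\<Sum>r<N. a' k (e r) * (\<Prod>j\<in>UNIV. h j ^ e r j))"
      using sum.reindex_bij_betw[OF e_bij, of "\<lambda>\<beta>. a' k \<beta> * (\<Prod>j\<in>UNIV. h j ^ \<beta> j)"] by simp
    also have "\<dots> = (\<Sum>r<k. a k r * (\<Prod>j\<in>UNIV. h j ^ e r j))"
      using that by (intro sum.mono_neutral_cong_right) (auto simp: a'_def index_e)
    finally show ?thesis by (simp add: lexmonic_def \<phi>_def js)
  qed
  have "emeasure (PiM (set js) (\<lambda>_. lborel)) {h \<in> space (PiM (set js) (\<lambda>_. lborel)).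
      \<forall>k\<in>{..<N}. (b k / y) * \<bar>(\<Prod>j\<in>set js. h j ^ e k j) + (\<Sum>\<beta>\<in>exponents d. a' k \<beta> * (\<Prod>j\<in>set js. h j ^ \<beta> j))\<bar> \<le> 1}
    \<le> ennreal (real d ^ length js) * emeasure (PiM (set js) (\<lambda>_. lborel))
      {h \<in> space (PiM (set js) (\<lambda>_. lborel)). \<forall>k\<in>{..<N}. (b k / y) * (\<Prod>j\<in>set js. \<bar>h j\<bar> ^ e k j) \<le> 1}"
  proof (rule emeasure_lexmonic_compress)
    show "0 \<le> b k / y" if "k \<in> {..<N}" for k using b[of k] y that by simp
    show "lexless js \<beta> (e k)" if "k \<in> {..<N}" "\<beta> \<in> exponents d" "a' k \<beta> \<noteq> 0" for k \<beta>
      using that e_less[of "index \<beta>" k] e_index[of \<beta>] by (auto simp: a'_def split: if_splits)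
  qed (use js d_pos e_le in auto)
  also have "{h \<in> space (PiM (set js) (\<lambda>_. lborel)). \<forall>k\<in>{..<N}. (b k / y) * (\<Prod>j\<in>set js. \<bar>h j\<bar> ^ e k j) \<le> 1} =
     {h \<in> space (PiM UNIV (\<lambda>_. lborel)). mono_max b h \<le> y}"
    using N_pos y by (auto simp: mono_max_def js field_simps lessThan_empty_iff)
  also have "{h \<in> space (PiM (set js) (\<lambda>_. lborel)).
      \<forall>k\<in>{..<N}. (b k / y) * \<bar>(\<Prod>j\<in>set js. h j ^ e k j) + (\<Sum>\<beta>\<in>exponents d. a' k \<beta> * (\<Prod>j\<in>set js. h j ^ \<beta> j))\<bar> \<le> 1} =
     {h \<in> space (PiM UNIV (\<lambda>_. lborel)). poly_max b a (\<chi> j. h j) \<le> y}"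
    using N_pos y by (auto simp: poly_max_def js P field_simps lessThan_empty_iff)
  finally show ?thesis by (simp add: js length_js)
qed

text \<open>One constant must serve all families, since the nearly optimal family chosen later
  depends on \<open>u\<close> and its coefficients \<open>a\<close> are not controlled.\<close>

lemma ex_bound_nn_integral_poly_max:
  obtains B where "B > 0" "\<And>a b. (\<And>k. k < N \<Longrightarrow> 0 < b k) \<Longrightarrow> (\<Prod>k<N. b k) = 1 \<Longrightarrow>
    (\<integral>\<^sup>+t. ennreal (poly_max b a t powr (- s)) \<partial>lborel) \<le> ennreal B"
proof -
  let ?I = "(\<integral>\<^sup>+u. two_sided (s / (real CARD('n) * real N)) u \<partial>lborel)"
  have I: "?I < \<infinity>" using s_pos N_pos by (intro nn_integral_two_sided) simp
  \<comment> \<open>One factor \<open>d\<close> per variable comes from replacing polynomials by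
    monomials; the added 1 secures \<open>B > 0\<close>.\<close>
  define B where "B = real d ^ CARD('n) * enn2real ?I ^ CARD('n) + 1"
  have "(\<integral>\<^sup>+t. ennreal (poly_max b a t powr (- s)) \<partial>lborel) \<le> ennreal B"
    if b: "\<And>k. k < N \<Longrightarrow> 0 < b k" "(\<Prod>k<N. b k) = 1" for a b
  proof -
    have "(\<integral>\<^sup>+t. ennreal (poly_max b a t powr (- s)) \<partial>lborel) =
      (\<integral>\<^sup>+h. ennreal (poly_max b a (\<chi> j. h j) powr (- s)) \<partial>PiM UNIV (\<lambda>_. lborel))"
      by (rule nn_integral_lborel_vec) measurable
    also have "\<dots> \<le> ennreal (real d ^ CARD('n)) * (\<integral>\<^sup>+h. ennreal (mono_max b h powr (- s)) \<partial>PiM UNIV (\<lambda>_. lborel))"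
    proof (rule nn_integral_powr_le_of_sublevel)
      show "mono_max b h > 0" for h
      proof -
        have "b 0 * (\<Prod>i\<in>UNIV. \<bar>h i\<bar> ^ e 0 i) \<le> mono_max b h"
          unfolding mono_max_def using N_pos by (intro Max_ge) auto
        then show ?thesis using b(1)[OF N_pos] by (simp add: e_0)
      qed
    qed (use s_pos b N_pos in \<open>auto intro!: poly_max_pos emeasure_poly_max_le\<close>)
    also have "\<dots> \<le> ennreal (real d ^ CARD('n)) * ?I ^ CARD('n)"
      by (intro mult_left_mono nn_integral_mono_max b) auto
    also have "?I = ennreal (enn2real ?I)" using I by simp
    also have "ennreal (real d ^ CARD('n)) * ennreal (enn2real ?I) ^ CARD('n) \<le> ennreal B"
      by (simp add: B_def ennreal_power flip: ennreal_mult)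
    finally show ?thesis .
  qed
  moreover have "B > 0" unfolding B_def by (intro add_nonneg_pos) auto
  ultimately show ?thesis using that by blast
qed

section \<open>The multilinear estimate\<close>

definition min_moment :: "nat \<Rightarrow> (real ^ 'n \<Rightarrow> ennreal) \<Rightarrow> nat \<Rightarrow> ennreal" where
  "min_moment g G k = (INF a. \<integral>\<^sup>+t. ennreal (\<bar>\<phi> k t + (\<Sum>r<k. a r * \<phi> r t)\<bar> ^ g) * G t \<partial>lborel)"

text \<open>
  The weight \<open>M ^ g\<close>, with \<open>M\<close> the largest member of a nearly optimal lexicographically monic
  family normalised to equal moments, is balanced against \<open>M powr (- s)\<close>, which is integrable.
\<close>

lemma nn_integral_le_moments:
  assumes p: "p = 1 + real g / s" and g: "g \<ge> 1"
    and B: "\<And>a b. (\<And>k. k < N \<Longrightarrow> 0 < b k) \<Longrightarrow> (\<Prod>k<N. b k) = 1 \<Longrightarrow>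
      (\<integral>\<^sup>+t. ennreal (poly_max b a t powr (- s)) \<partial>lborel) \<le> ennreal B" "B > 0"
    and u [measurable]: "u \<in> borel_measurable borel" and u_nonneg: "\<And>t. 0 \<le> u t"
    and \<eta>: "\<And>k. k < N \<Longrightarrow> 0 < \<eta> k" "\<And>k. k < N \<Longrightarrow> min_moment g (\<lambda>t. ennreal (u t powr p)) k < ennreal (\<eta> k)"
  shows "(\<integral>\<^sup>+t. ennreal (u t) \<partial>lborel) \<le> ennreal ((B + real N) * (\<Prod>k<N. \<eta> k) powr (1 / (real N * p)))"
proof -
  have p1: "p > 1" using p g s_pos by simp
  have "\<exists>a. (\<integral>\<^sup>+t. ennreal (\<bar>\<phi> k t + (\<Sum>r<k. a r * \<phi> r t)\<bar> ^ g) * ennreal (u t powr p) \<partial>lborel) < ennreal (\<eta> k)"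
    if "k < N" for k
    using \<eta>(2)[OF that] unfolding min_moment_def by (simp add: INF_less_iff)
  then have "\<forall>k. \<exists>a. k < N \<longrightarrow>
      (\<integral>\<^sup>+t. ennreal (\<bar>\<phi> k t + (\<Sum>r<k. a r * \<phi> r t)\<bar> ^ g) * ennreal (u t powr p) \<partial>lborel) < ennreal (\<eta> k)"
    by blast
  from choice[OF this] obtain a where "\<forall>k. k < N \<longrightarrow>
      (\<integral>\<^sup>+t. ennreal (\<bar>\<phi> k t + (\<Sum>r<k. a k r * \<phi> r t)\<bar> ^ g) * ennreal (u t powr p) \<partial>lborel) < ennreal (\<eta> k)" ..
  then have a: "\<And>k. k < N \<Longrightarrow>
      (\<integral>\<^sup>+t. ennreal (\<bar>lexmonic a k t\<bar> ^ g) * ennreal (u t powr p) \<partial>lborel) < ennreal (\<eta> k)"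
    unfolding lexmonic_def by blast
  define H where "H = (\<Prod>k<N. \<eta> k)"
  have H: "H > 0" unfolding H_def by (intro prod_pos) (use \<eta> in auto)
  \<comment> \<open>These factors have product 1 and equalise the moment bounds:
    \<open>b k ^ g * \<eta> k\<close> is \<open>H powr (1 / N)\<close> for each
    \<open>k\<close>.\<close>
  define b where "b k = H powr (1 / (real N * real g)) * \<eta> k powr (- 1 / real g)" for k
  have b: "0 < b k" if "k < N" for k using H \<eta>(1)[OF that] by (simp add: b_def)
  have b1: "(\<Prod>k<N. b k) = 1"
  proof -
    have "(\<Prod>k<N. \<eta> k powr (- 1 / real g)) = H powr (- 1 / real g)"
      unfolding H_def by (rule prod_powr_distrib[symmetric])
    moreover have "(\<Prod>k<N. H powr (1 / (real N * real g))) = H powr (1 / real g)"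
      using H N_pos by (simp add: powr_powr flip: powr_realpow)
    ultimately show ?thesis
      using H by (simp add: b_def prod.distrib flip: powr_add)
  qed
  have bg: "b k ^ g = H powr (1 / real N) / \<eta> k" if "k < N" for k
  proof -
    have "b k ^ g = b k powr real g" using b[OF that] by (simp add: powr_realpow)
    also have "\<dots> = H powr (1 / real N) * \<eta> k powr (- 1)"
      using H \<eta>(1)[OF that] g by (simp add: b_def powr_mult powr_powr)
    finally show ?thesis using \<eta>(1)[OF that] by (simp add: powr_minus divide_inverse)
  qed
  let ?M = "poly_max b a"
  have M: "?M t > 0" for t by (rule poly_max_pos) (use b N_pos in auto)
  \<comment> \<open>Chosen so that \<open>\<kappa> powr p = H powr (1 / N)\<close>; then both terms
    of the final bound are multiples of \<open>\<kappa>\<close>.\<close>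
  define \<kappa> where "\<kappa> = H powr (1 / (real N * p))"
  have \<kappa>: "\<kappa> > 0" using H by (simp add: \<kappa>_def)
  \<comment> \<open>Where \<open>u t\<close> exceeds \<open>v = \<kappa> * ?M t powr (- s)\<close>,
    the factor \<open>u t powr (1 - p)\<close> is at most \<open>v powr (1 - p)\<close>, and
    \<open>s * (p - 1) = g\<close> produces the weight \<open>?M t ^ g\<close>.\<close>
  have pt: "u t \<le> \<kappa> * ?M t powr (- s) + \<kappa> powr (1 - p) * (?M t ^ g * u t powr p)" for t
  proof (cases "u t \<le> \<kappa> * ?M t powr (- s)")
    case True
    then show ?thesis using \<kappa> M[of t] by (auto intro: add_increasing2)
  next
    case False
    define v where "v = \<kappa> * ?M t powr (- s)"
    have v: "0 < v" "v < u t" using False \<kappa> M[of t] by (auto simp: v_def)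
    have "u t = u t powr (1 - p) * u t powr p" using v by (simp flip: powr_add)
    also have "\<dots> \<le> v powr (1 - p) * u t powr p"
      using v p1 by (intro mult_right_mono powr_mono2') auto
    also have "v powr (1 - p) = \<kappa> powr (1 - p) * ?M t powr (- s * (1 - p))"
      using \<kappa> M[of t] by (simp add: v_def powr_mult powr_powr)
    also have "- s * (1 - p) = real g" using s_pos by (simp add: p)
    also have "?M t powr real g = ?M t ^ g" using M[of t] by (simp add: powr_realpow)
    finally have "u t \<le> \<kappa> powr (1 - p) * (?M t ^ g * u t powr p)" by (simp add: mult_ac)
    then show ?thesis using \<kappa> M[of t] by (auto intro: add_increasing)
  qed
  have Mg: "?M t ^ g \<le> (\<Sum>k<N. b k ^ g * \<bar>lexmonic a k t\<bar> ^ g)" for t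
  proof -
    have "?M t \<in> (\<lambda>k. b k * \<bar>lexmonic a k t\<bar>) ` {..<N}"
      unfolding poly_max_def using N_pos by (intro Max_in) auto
    then obtain k where k: "k < N" "?M t = b k * \<bar>lexmonic a k t\<bar>" by auto
    then have "?M t ^ g = b k ^ g * \<bar>lexmonic a k t\<bar> ^ g" by (simp add: power_mult_distrib)
    also have "\<dots> \<le> (\<Sum>k<N. b k ^ g * \<bar>lexmonic a k t\<bar> ^ g)"
      using k b by (intro member_le_sum) (auto intro!: mult_nonneg_nonneg zero_le_power less_imp_le[OF b])
    finally show ?thesis .
  qed
  have Mint: "(\<integral>\<^sup>+t. ennreal (?M t ^ g * u t powr p) \<partial>lborel) \<le> ennreal (real N * H powr (1 / real N))"
  proof -
    have "(\<integral>\<^sup>+t. ennreal (?M t ^ g * u t powr p) \<partial>lborel) \<le>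
      (\<integral>\<^sup>+t. (\<Sum>k<N. ennreal (b k ^ g) * (ennreal (\<bar>lexmonic a k t\<bar> ^ g) * ennreal (u t powr p))) \<partial>lborel)"
    proof (rule nn_integral_mono)
      fix t
      have "?M t ^ g * u t powr p \<le> (\<Sum>k<N. b k ^ g * \<bar>lexmonic a k t\<bar> ^ g) * u t powr p"
        by (intro mult_right_mono Mg) auto
      also have "\<dots> = (\<Sum>k<N. b k ^ g * (\<bar>lexmonic a k t\<bar> ^ g * u t powr p))"
        by (simp add: sum_distrib_right mult.assoc)
      finally have "ennreal (?M t ^ g * u t powr p) \<le>
          ennreal (\<Sum>k<N. b k ^ g * (\<bar>lexmonic a k t\<bar> ^ g * u t powr p))" by (rule ennreal_leI)
      also have "\<dots> = (\<Sum>k<N. ennreal (b k ^ g * (\<bar>lexmonic a k t\<bar> ^ g * u t powr p)))"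
        using b by (intro sum_ennreal[symmetric]) (auto intro!: mult_nonneg_nonneg zero_le_power less_imp_le[OF b])
      also have "\<dots> = (\<Sum>k<N. ennreal (b k ^ g) * (ennreal (\<bar>lexmonic a k t\<bar> ^ g) * ennreal (u t powr p)))"
        using b by (intro sum.cong) (auto simp: less_imp_le simp flip: ennreal_mult)
      finally show "ennreal (?M t ^ g * u t powr p) \<le> \<dots>" .
    qed
    also have "\<dots> = (\<Sum>k<N. ennreal (b k ^ g) * (\<integral>\<^sup>+t. ennreal (\<bar>lexmonic a k t\<bar> ^ g) * ennreal (u t powr p) \<partial>lborel))"
      by (subst nn_integral_sum) (auto simp: nn_integral_cmult)
    also have "\<dots> \<le> (\<Sum>k<N. ennreal (b k ^ g) * ennreal (\<eta> k))"
      using a by (intro sum_mono mult_left_mono) (auto intro: less_imp_le)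
    also have "\<dots> = (\<Sum>k<N. ennreal (H powr (1 / real N)))"
    proof (intro sum.cong refl)
      fix k assume "k \<in> {..<N}"
      then show "ennreal (b k ^ g) * ennreal (\<eta> k) = ennreal (H powr (1 / real N))"
        using \<eta>(1)[of k] by (simp add: bg flip: ennreal_mult)
    qed
    also have "\<dots> = ennreal (real N * H powr (1 / real N))"
      by (simp add: ennreal_of_nat_eq_real_of_nat flip: ennreal_mult)
    finally show ?thesis .
  qed
  have "(\<integral>\<^sup>+t. ennreal (u t) \<partial>lborel) \<le>
    (\<integral>\<^sup>+t. ennreal \<kappa> * ennreal (?M t powr (- s)) + ennreal (\<kappa> powr (1 - p)) * ennreal (?M t ^ g * u t powr p) \<partial>lborel)"
  proof (rule nn_integral_mono)
    fix t
    show "ennreal (u t) \<le> ennreal \<kappa> * ennreal (?M t powr (- s)) + ennreal (\<kappa> powr (1 - p)) * ennreal (?M t ^ g * u t powr p)"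
      using ennreal_leI[OF pt[of t]] \<kappa> M[of t] by (simp add: ennreal_mult less_imp_le)
  qed
  also have "\<dots> = ennreal \<kappa> * (\<integral>\<^sup>+t. ennreal (?M t powr (- s)) \<partial>lborel) +
     ennreal (\<kappa> powr (1 - p)) * (\<integral>\<^sup>+t. ennreal (?M t ^ g * u t powr p) \<partial>lborel)"
    by (subst nn_integral_add) (auto simp: nn_integral_cmult)
  also have "\<dots> \<le> ennreal \<kappa> * ennreal B + ennreal (\<kappa> powr (1 - p)) * ennreal (real N * H powr (1 / real N))"
    by (intro add_mono mult_left_mono Mint B(1) b b1) auto
  also have "\<dots> = ennreal (\<kappa> * B + \<kappa> powr (1 - p) * (real N * H powr (1 / real N)))"
    using \<kappa> B(2) by (simp add: ennreal_mult less_imp_le)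
  also have "\<kappa> powr (1 - p) * (real N * H powr (1 / real N)) = \<kappa> * real N"
  proof -
    have "H powr (1 / real N) = \<kappa> powr p"
      using H p1 by (simp add: \<kappa>_def powr_powr)
    then show ?thesis using \<kappa> by (simp add: mult.left_commute flip: powr_add)
  qed
  finally show ?thesis by (simp add: \<kappa>_def H_def algebra_simps)
qed


text \<open>\<open>nn_integral_le_moments\<close> takes positive numbers strictly above the moments,
  which may vanish; these are \<open>E k + \<epsilon>\<close> with \<open>\<epsilon>\<close> tending
  to 0. Finiteness is assumed separately because a product in \<open>ennreal\<close> can be 0
  although a factor is infinite.\<close>

lemma nn_integral_le_prod_moments:
  assumes p: "p = 1 + real g / s" and g: "g \<ge> 1"
    and B: "\<And>a b. (\<And>k. k < N \<Longrightarrow> 0 < b k) \<Longrightarrow> (\<Prod>k<N. b k) = 1 \<Longrightarrow>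
      (\<integral>\<^sup>+t. ennreal (poly_max b a t powr (- s)) \<partial>lborel) \<le> ennreal B" "B > 0"
    and u: "u \<in> borel_measurable borel" "\<And>t. 0 \<le> u t"
    and fin: "\<And>k. k < N \<Longrightarrow> min_moment g (\<lambda>t. ennreal (u t powr p)) k < \<infinity>"
    and J: "(\<Prod>k<N. min_moment g (\<lambda>t. ennreal (u t powr p)) k) \<le> ennreal J" "0 \<le> J"
  shows "(\<integral>\<^sup>+t. ennreal (u t) \<partial>lborel) \<le> ennreal ((B + real N) * J powr (1 / (real N * p)))"
proof -
  have p1: "p > 1" using p g s_pos by simp
  define E where "E k = enn2real (min_moment g (\<lambda>t. ennreal (u t powr p)) k)" for k
  have E: "min_moment g (\<lambda>t. ennreal (u t powr p)) k = ennreal (E k)" if "k < N" for k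
    using fin[OF that] by (simp add: E_def)
  have E0: "0 \<le> E k" for k by (simp add: E_def)
  have "(\<Prod>k<N. min_moment g (\<lambda>t. ennreal (u t powr p)) k) = ennreal (\<Prod>k<N. E k)"
    using E E0 by (simp add: prod_ennreal)
  then have EJ: "(\<Prod>k<N. E k) \<le> J" using J by (simp add: ennreal_le_iff)
  let ?c = "1 / (real N * p)"
  have c: "?c > 0" using N_pos p1 by simp
  have "((\<lambda>\<epsilon>. (B + real N) * (\<Prod>k<N. E k + \<epsilon>) powr ?c) \<longlongrightarrow> (B + real N) * (\<Prod>k<N. E k + 0) powr ?c) (at_right 0)"
    using c E0 N_pos by (intro tendsto_intros tendsto_powr2)
      (auto intro!: eventually_at_rightI[of 0 1] prod_nonneg add_nonneg_nonneg)
  then have "((\<lambda>\<epsilon>. ennreal ((B + real N) * (\<Prod>k<N. E k + \<epsilon>) powr ?c)) \<longlongrightarrow>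
      ennreal ((B + real N) * (\<Prod>k<N. E k + 0) powr ?c)) (at_right 0)"
    by (rule tendsto_ennrealI)
  moreover have "eventually (\<lambda>\<epsilon>. (\<integral>\<^sup>+t. ennreal (u t) \<partial>lborel) \<le>
      ennreal ((B + real N) * (\<Prod>k<N. E k + \<epsilon>) powr ?c)) (at_right 0)"
  proof (rule eventually_at_rightI[of 0 1])
    fix \<epsilon> :: real assume \<epsilon>: "\<epsilon> \<in> {0<..<1}"
    show "(\<integral>\<^sup>+t. ennreal (u t) \<partial>lborel) \<le> ennreal ((B + real N) * (\<Prod>k<N. E k + \<epsilon>) powr ?c)"
    proof (rule nn_integral_le_moments[OF p g B u])
      show "0 < E k + \<epsilon>" for k using E0[of k] \<epsilon> by simp
      show "min_moment g (\<lambda>t. ennreal (u t powr p)) k < ennreal (E k + \<epsilon>)" if "k < N" for k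
        unfolding E[OF that] using E0[of k] \<epsilon> by (simp add: ennreal_less_iff)
    qed
  qed simp
  ultimately have "(\<integral>\<^sup>+t. ennreal (u t) \<partial>lborel) \<le> ennreal ((B + real N) * (\<Prod>k<N. E k + 0) powr ?c)"
    by (rule tendsto_lowerbound) simp
  also have "\<dots> \<le> ennreal ((B + real N) * J powr ?c)"
    using EJ c E0 B(2) by (intro ennreal_leI mult_left_mono powr_mono2) (auto intro: prod_nonneg)
  finally show ?thesis .
qed

definition pivots :: "nat \<Rightarrow> (nat \<Rightarrow> real ^ 'n) \<Rightarrow> nat \<Rightarrow> ennreal" where
  "pivots g t k = ennreal (\<bar>pivot (\<lambda>l i. \<phi> l (t i)) k\<bar> ^ g)"

text \<open>The multilinear integral dominates the product of the minimal moments by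
  \<open>prod_INF_le_nn_integral_pivot\<close>. Truncating \<open>u\<close> to bounded values on a
  ball makes the moments finite; the bound is independent of the truncation, and monotone
  convergence removes it.\<close>

lemma ex_bound_nn_integral_multilinear:
  assumes p: "p = 1 + real g / s" and g: "g \<ge> 1"
  obtains C where "C > 0" "\<And>u J. u \<in> borel_measurable borel \<Longrightarrow> (\<And>t. 0 \<le> u t) \<Longrightarrow> 0 \<le> J \<Longrightarrow>
     (\<integral>\<^sup>+t. (\<Prod>k<N. pivots g t k * ennreal (u (t k) powr p)) \<partial>PiM {..<N} (\<lambda>_. lborel)) \<le> ennreal J \<Longrightarrow>
     (\<integral>\<^sup>+t. ennreal (u t) \<partial>lborel) \<le> ennreal (C * J powr (1 / (real N * p)))"
proof -
  have p1: "p > 1" using p g s_pos by simp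
  obtain B where B: "B > 0" "\<And>a b. (\<And>k. k < N \<Longrightarrow> 0 < b k) \<Longrightarrow> (\<Prod>k<N. b k) = 1 \<Longrightarrow>
    (\<integral>\<^sup>+t. ennreal (poly_max b a t powr (- s)) \<partial>lborel) \<le> ennreal B"
    using ex_bound_nn_integral_poly_max by metis
  have "(\<integral>\<^sup>+t. ennreal (u t) \<partial>lborel) \<le> ennreal ((B + real N) * J powr (1 / (real N * p)))"
    if u [measurable]: "u \<in> borel_measurable borel" and u0: "\<And>t. 0 \<le> u t" and J: "0 \<le> J"
      "(\<integral>\<^sup>+t. (\<Prod>k<N. pivots g t k * ennreal (u (t k) powr p)) \<partial>PiM {..<N} (\<lambda>_. lborel)) \<le> ennreal J"
    for u J
  proof -
    define v where "v j t = (if norm t \<le> real j \<and> u t \<le> real j then u t else 0)" for j :: nat and t :: "real ^ 'n"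
    have v [measurable]: "v j \<in> borel_measurable borel" for j unfolding v_def by measurable
    have v0: "0 \<le> v j t" and vu: "v j t \<le> u t" for j t using u0 by (auto simp: v_def)
    have bound: "(\<integral>\<^sup>+t. ennreal (v j t) \<partial>lborel) \<le> ennreal ((B + real N) * J powr (1 / (real N * p)))" for j
    proof (rule nn_integral_le_prod_moments[OF p g B(2,1)])
      show "(\<Prod>k<N. min_moment g (\<lambda>t. ennreal (v j t powr p)) k) \<le> ennreal J"
      proof -
        have "(\<Prod>k<N. min_moment g (\<lambda>t. ennreal (v j t powr p)) k) \<le>
          (\<integral>\<^sup>+t. (\<Prod>k<N. pivots g t k * ennreal (v j (t k) powr p)) \<partial>PiM {..<N} (\<lambda>_. lborel))"
          unfolding min_moment_def pivots_def by (rule prod_INF_le_nn_integral_pivot) measurable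
        also have "\<dots> \<le> (\<integral>\<^sup>+t. (\<Prod>k<N. pivots g t k * ennreal (u (t k) powr p)) \<partial>PiM {..<N} (\<lambda>_. lborel))"
          using p1 v0 vu by (intro nn_integral_mono prod_mono_ennreal mult_left_mono ennreal_leI powr_mono2) auto
        finally show ?thesis using J(2) by order
      qed
      fix k
      have "continuous_on (cball 0 (real j)) (\<phi> k)"
        unfolding \<phi>_def by (intro continuous_intros)
      then have "compact (\<phi> k ` cball 0 (real j))" by (intro compact_continuous_image) auto
      then obtain K where "\<forall>t\<in>cball 0 (real j). \<bar>\<phi> k t\<bar> \<le> K"
        by (auto dest!: compact_imp_bounded simp: bounded_iff)
      then have K: "\<And>t. norm t \<le> real j \<Longrightarrow> \<bar>\<phi> k t\<bar> \<le> K"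
        by simp
      \<comment> \<open>The monomial \<open>\<phi> k\<close> itself competes in the infimum, and it
        is bounded on the ball.\<close>
      have "min_moment g (\<lambda>t. ennreal (v j t powr p)) k \<le>
        (\<integral>\<^sup>+t. ennreal (\<bar>\<phi> k t + (\<Sum>r<k. 0 * \<phi> r t)\<bar> ^ g) * ennreal (v j t powr p) \<partial>lborel)"
        unfolding min_moment_def by (rule INF_lower) simp
      also have "\<dots> \<le> (\<integral>\<^sup>+t. ennreal (K ^ g * real j powr p) * indicator (cball (0 :: real ^ 'n) (real j)) t \<partial>lborel)"
      proof (rule nn_integral_mono)
        fix t :: "real ^ 'n"
        show "ennreal (\<bar>\<phi> k t + (\<Sum>r<k. 0 * \<phi> r t)\<bar> ^ g) * ennreal (v j t powr p) \<le>
          ennreal (K ^ g * real j powr p) * indicator (cball 0 (real j)) t"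
        proof (cases "norm t \<le> real j \<and> u t \<le> real j")
          case True
          then have "\<bar>\<phi> k t\<bar> ^ g * v j t powr p \<le> K ^ g * real j powr p"
            using K[of t] p1 v0[of j t]
            by (intro mult_mono power_mono powr_mono2) (auto simp: v_def intro: order_trans[OF abs_ge_zero])
          then show ?thesis using True by (simp add: ennreal_leI flip: ennreal_mult)
        next
          case False
          then have "v j t = 0" by (auto simp: v_def)
          then show ?thesis by simp
        qed
      qed
      also have "\<dots> = ennreal (K ^ g * real j powr p) * emeasure lborel (cball (0 :: real ^ 'n) (real j))"
        by (rule nn_integral_cmult_indicator) simp
      also have "\<dots> < \<infinity>"
        using emeasure_bounded_finite[of "cball (0 :: real ^ 'n) (real j)"] by (simp add: ennreal_mult_less_top)
      finally show "min_moment g (\<lambda>t. ennreal (v j t powr p)) k < \<infinity>" .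
    qed (use v0 J in auto)
    have inc: "incseq (\<lambda>j t. ennreal (v j t))"
      using u0 by (auto simp: incseq_def le_fun_def v_def intro!: ennreal_leI)
    have "(SUP j. ennreal (v j t)) = ennreal (u t)" for t
    proof (rule antisym)
      show "(SUP j. ennreal (v j t)) \<le> ennreal (u t)"
        by (intro SUP_least ennreal_leI vu)
      obtain j :: nat where "max (norm t) (u t) \<le> real j" using real_arch_simple by blast
      then have "v j t = u t" by (simp add: v_def)
      then show "ennreal (u t) \<le> (SUP j. ennreal (v j t))" by (metis SUP_upper UNIV_I)
    qed
    then have "(\<integral>\<^sup>+t. ennreal (u t) \<partial>lborel) = (\<integral>\<^sup>+t. (SUP j. ennreal (v j t)) \<partial>lborel)"
      by simp
    also have "\<dots> = (SUP j. (\<integral>\<^sup>+t. ennreal (v j t) \<partial>lborel))"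
      by (rule nn_integral_monotone_convergence_SUP[OF inc]) measurable
    also have "\<dots> \<le> ennreal ((B + real N) * J powr (1 / (real N * p)))"
      by (intro SUP_least bound)
    finally show ?thesis .
  qed
  then show ?thesis using that[of "B + real N"] B(1) by simp
qed

section \<open>The multilinear form on coefficient space\<close>

definition poly_of :: "(nat \<Rightarrow> real ^ 'm) \<Rightarrow> real ^ 'n \<Rightarrow> real ^ 'm::finite" where
  "poly_of X t = (\<Sum>l<N. \<phi> l t *\<^sub>R X l)"

abbreviation coeffs :: "(nat \<Rightarrow> real ^ 'm::finite) measure" where
  "coeffs \<equiv> PiM {..<N} (\<lambda>_. lborel)"

definition multilinear :: "((real ^ 'n) \<times> (real ^ 'm) \<Rightarrow> ennreal) \<Rightarrow> (nat \<Rightarrow> real ^ 'm::finite) \<Rightarrow> ennreal" where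
  "multilinear F X = (\<integral>\<^sup>+t. (\<Prod>k<N. pivots CARD('m) t k * F (t k, poly_of X (t k))) \<partial>PiM {..<N} (\<lambda>_. lborel))"

lemma measurable_multilinear_integrand:
  fixes F :: "(real ^ 'n) \<times> (real ^ 'm::finite) \<Rightarrow> ennreal"
  assumes [measurable]: "F \<in> borel_measurable borel"
  shows "(\<lambda>(X, t). \<Prod>k<N. pivots CARD('m) t k * F (t k, poly_of X (t k)))
    \<in> borel_measurable (coeffs \<Otimes>\<^sub>M PiM {..<N} (\<lambda>_. lborel))"
  unfolding case_prod_beta
proof (rule borel_measurable_prod_ennreal)
  fix k assume k: "k \<in> {..<N}"
  let ?M = "(coeffs :: (nat \<Rightarrow> real ^ 'm) measure) \<Otimes>\<^sub>M PiM {..<N} (\<lambda>_. lborel :: (real ^ 'n) measure)"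
  have [measurable]: "(\<lambda>z. snd z k) \<in> borel_measurable ?M"
    using k measurable_component_singleton[of k "{..<N}" "\<lambda>_. lborel :: (real ^ 'n) measure"]
    by (auto intro: measurable_compose[OF measurable_snd])
  have [measurable]: "(\<lambda>z. pivot (\<lambda>l i. \<phi> l (snd z i)) k) \<in> borel_measurable ?M"
    using measurable_pivot_PiM[of k N \<phi>] k by (auto intro: measurable_compose[OF measurable_snd])
  show "(\<lambda>z. pivots CARD('m) (snd z) k * F (snd z k, poly_of (fst z) (snd z k))) \<in> borel_measurable ?M"
    unfolding pivots_def poly_of_def by measurable
qed

lemma measurable_multilinear [measurable]:
  assumes [measurable]: "F \<in> borel_measurable borel"
  shows "multilinear F \<in> borel_measurable coeffs"
  unfolding multilinear_def
  using measurable_multilinear_integrand[OF assms]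
  by (intro sigma_finite_measure.borel_measurable_nn_integral) simp_all

text \<open>For fixed points, the values \<open>poly_of X (t k)\<close> depend on \<open>X\<close>
  through the Vandermonde matrix, whose Jacobian is the product of the \<open>pivots\<close>
  factors. Integrating over \<open>X\<close> leaves the integrals of \<open>F\<close> over the
  slices above the points. Where a pivot vanishes the integrand is 0, hence an inequality.\<close>

lemma nn_integral_multilinear_le:
  fixes F :: "(real ^ 'n) \<times> (real ^ 'm::finite) \<Rightarrow> ennreal"
  assumes [measurable]: "F \<in> borel_measurable borel"
  shows "(\<integral>\<^sup>+X. multilinear F X \<partial>coeffs) \<le> (\<integral>\<^sup>+z. F z \<partial>lborel) ^ N"
proof -
  let ?T = "PiM {..<N} (\<lambda>_. lborel :: (real ^ 'n) measure)"
  let ?A = "\<lambda>t l i. \<phi> l (t i)"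
  have slice: "(\<integral>\<^sup>+X. (\<Prod>k<N. pivots CARD('m) t k * F (t k, poly_of X (t k))) \<partial>coeffs)
     \<le> (\<Prod>k<N. \<integral>\<^sup>+y. F (t k, y) \<partial>lborel)" for t
  proof (cases "\<forall>k<N. pivot (?A t) k \<noteq> 0")
    case True
    have "(\<integral>\<^sup>+X. (\<Prod>k<N. pivots CARD('m) t k * F (t k, poly_of X (t k))) \<partial>coeffs) =
       (\<Prod>k<N. pivots CARD('m) t k) * (\<integral>\<^sup>+X. (\<Prod>k<N. F (t k, poly_of X (t k))) \<partial>coeffs)"
      unfolding prod.distrib by (rule nn_integral_cmult) (unfold poly_of_def, measurable)
    also have "\<dots> = (\<Prod>k<N. \<integral>\<^sup>+y. F (t k, y) \<partial>lborel)"
      using nn_integral_matrix[of "\<lambda>k y. F (t k, y)" N "?A t"] True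
      by (simp add: pivots_def poly_of_def)
    finally show ?thesis by simp
  next
    case False
    then obtain k where "k < N" "pivot (?A t) k = 0" by blast
    then have z: "(\<Prod>k<N. pivots CARD('m) t k * F (t k, poly_of X (t k))) = 0" for X
      by (intro prod_zero) (auto simp: pivots_def zero_power)
    show ?thesis unfolding z by simp
  qed
  have "(\<integral>\<^sup>+X. multilinear F X \<partial>coeffs) =
    (\<integral>\<^sup>+t. \<integral>\<^sup>+X. (\<Prod>k<N. pivots CARD('m) t k * F (t k, poly_of X (t k))) \<partial>coeffs \<partial>?T)"
    unfolding multilinear_def
    by (rule pair_sigma_finite.Fubini')
       (use measurable_multilinear_integrand[OF assms] in \<open>simp_all add: pair_sigma_finite.intro\<close>)
  also have "\<dots> \<le> (\<integral>\<^sup>+t. (\<Prod>k<N. \<integral>\<^sup>+y. F (t k, y) \<partial>lborel) \<partial>?T)"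
    by (intro nn_integral_mono slice)
  also have "\<dots> = (\<Prod>k<N. \<integral>\<^sup>+t. \<integral>\<^sup>+y. F (t, y) \<partial>lborel \<partial>lborel)"
    by (rule PL.product_nn_integral_prod) simp_all
  also have "(\<integral>\<^sup>+t. \<integral>\<^sup>+y. F (t, y) \<partial>lborel \<partial>lborel) = (\<integral>\<^sup>+z. F z \<partial>(lborel \<Otimes>\<^sub>M lborel))"
    by (rule lborel.nn_integral_fst) (simp add: lborel_prod)
  also have "\<dots> = (\<integral>\<^sup>+z. F z \<partial>lborel)" by (simp add: lborel_prod)
  finally show ?thesis by simp
qed

end

section \<open>Reflecting and translating polynomials\<close>

text \<open>The coefficient of \<open>t ^ b\<close> in \<open>(x - t) ^ a\<close>.\<close>

definition shift_coeff :: "real \<Rightarrow> nat \<Rightarrow> nat \<Rightarrow> real" where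
  "shift_coeff x a b = (- 1) ^ b * real (a choose b) * x ^ (a - b)"

lemma shift_coeff_eq_0: "a < b \<Longrightarrow> shift_coeff x a b = 0"
  by (simp add: shift_coeff_def)

lemma shift_coeff_expand:
  assumes "a \<le> d"
  shows "(x - t) ^ a = (\<Sum>b\<le>d. shift_coeff x a b * t ^ b)"
proof -
  have "(x - t) ^ a = (- t + x) ^ a" by simp
  also have "\<dots> = (\<Sum>b\<le>a. shift_coeff x a b * t ^ b)"
    unfolding binomial_ring by (intro sum.cong) (auto simp: shift_coeff_def power_minus[of t])
  also have "\<dots> = (\<Sum>b\<le>d. shift_coeff x a b * t ^ b)"
    using assms by (intro sum.mono_neutral_left) (auto simp: shift_coeff_eq_0)
  finally show ?thesis .
qed

text \<open>Both sides are the coefficients of \<open>(x - (x - t)) ^ a = t ^ a\<close>.\<close>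

lemma sum_shift_coeff_mult:
  assumes "a \<le> d" "b \<le> d"
  shows "(\<Sum>c\<le>d. shift_coeff x a c * shift_coeff x c b) = (if a = b then 1 else 0)"
proof -
  let ?p = "\<Sum>b\<le>d. monom (\<Sum>c\<le>d. shift_coeff x a c * shift_coeff x c b) b"
  have "poly ?p t = poly (monom 1 a) t" for t
  proof -
    have "poly ?p t = (\<Sum>b\<le>d. \<Sum>c\<le>d. shift_coeff x a c * shift_coeff x c b * t ^ b)"
      by (simp add: poly_sum poly_monom sum_distrib_right)
    also have "\<dots> = (\<Sum>c\<le>d. \<Sum>b\<le>d. shift_coeff x a c * shift_coeff x c b * t ^ b)"
      by (rule sum.swap)
    also have "\<dots> = (\<Sum>c\<le>d. shift_coeff x a c * (x - t) ^ c)"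
      by (intro sum.cong refl) (simp add: shift_coeff_expand[of _ d] sum_distrib_left mult.assoc)
    also have "\<dots> = (x - (x - t)) ^ a"
      by (rule shift_coeff_expand[OF assms(1), symmetric])
    finally show ?thesis by (simp add: poly_monom)
  qed
  then have "?p = monom 1 a" by (simp add: poly_eq_poly_eq_iff[symmetric] fun_eq_iff)
  then have "coeff ?p b = coeff (monom 1 a) b" by simp
  then show ?thesis using assms(2) by (simp add: coeff_sum)
qed

text \<open>The sum over all vectors with entries up to \<open>d\<close> factorises. A vector of
  total degree above \<open>d\<close> has an entry larger than that of \<open>\<alpha>\<close>, so
  its term vanishes.\<close>

lemma sum_exponents_prod:
  fixes h :: "'n::finite \<Rightarrow> nat \<Rightarrow> real"
  assumes \<alpha>: "\<alpha> \<in> exponents d" and h: "\<And>i b. \<alpha> i < b \<Longrightarrow> h i b = 0"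
  shows "(\<Sum>\<beta>\<in>exponents d. \<Prod>i\<in>UNIV. h i (\<beta> i)) = (\<Prod>i\<in>UNIV. \<Sum>b\<le>d. h i b)"
proof -
  have "(\<Prod>i\<in>UNIV. \<Sum>b\<le>d. h i b) = (\<Sum>\<beta>\<in>PiE UNIV (\<lambda>_. {..d}). \<Prod>i\<in>UNIV. h i (\<beta> i))"
    by (rule prod_sum_PiE) auto
  also have "\<dots> = (\<Sum>\<beta>\<in>exponents d. \<Prod>i\<in>UNIV. h i (\<beta> i))"
  proof (rule sum.mono_neutral_right)
    show "exponents d \<subseteq> PiE (UNIV :: 'n set) (\<lambda>_. {..d})"
    proof
      fix \<beta> :: "'n \<Rightarrow> nat" assume "\<beta> \<in> exponents d"
      then have "\<beta> i \<le> d" for i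
        using member_le_sum[of i UNIV \<beta>] by (simp add: exponents_def)
      then show "\<beta> \<in> PiE UNIV (\<lambda>_. {..d})" by (simp add: PiE_UNIV_domain)
    qed
    show "\<forall>\<beta>\<in>PiE UNIV (\<lambda>_. {..d}) - exponents d. (\<Prod>i\<in>UNIV. h i (\<beta> i)) = 0"
    proof
      fix \<beta> :: "'n \<Rightarrow> nat" assume "\<beta> \<in> PiE UNIV (\<lambda>_. {..d}) - exponents d"
      then have "(\<Sum>i\<in>UNIV. \<alpha> i) < (\<Sum>i\<in>UNIV. \<beta> i)" using \<alpha> by (auto simp: exponents_def)
      then obtain i where "\<alpha> i < \<beta> i" by (meson not_le sum_mono)
      then show "(\<Prod>i\<in>UNIV. h i (\<beta> i)) = 0" using h by (intro prod_zero) auto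
    qed
  qed (simp add: finite_PiE)
  finally show ?thesis ..
qed

lemma lexless_ex_less: "lexless js \<beta> \<alpha> \<Longrightarrow> \<exists>j. \<beta> j < \<alpha> j"
  by (induction js) auto

context exponent_enumeration
begin

definition shift_matrix :: "real ^ 'n \<Rightarrow> ('n \<Rightarrow> nat) \<Rightarrow> ('n \<Rightarrow> nat) \<Rightarrow> real" where
  "shift_matrix x \<alpha> \<beta> = (\<Prod>i\<in>UNIV. shift_coeff (x $ i) (\<alpha> i) (\<beta> i))"

text \<open>The coefficients of \<open>y - P (x - t)\<close> as a polynomial in \<open>t\<close>,
  for \<open>z = (x, y)\<close>. Only the constant coefficient, at index 0, receives
  \<open>y\<close>.\<close>

definition reflect :: "(real ^ 'n) \<times> (real ^ 'm) \<Rightarrow> (nat \<Rightarrow> real ^ 'm) \<Rightarrow> nat \<Rightarrow> real ^ 'm::finite" where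
  "reflect z X = (\<lambda>i\<in>{..<N}. (if i = 0 then snd z else 0) - (\<Sum>l<N. shift_matrix (fst z) (e l) (e i) *\<^sub>R X l))"

lemma sum_e_eq: "(\<Sum>k<N. f (e k)) = (\<Sum>\<alpha>\<in>exponents d. f \<alpha>)"
  by (rule sum.reindex_bij_betw[OF e_bij])

lemma \<phi>_diff:
  assumes "l < N"
  shows "\<phi> l (x - t) = (\<Sum>i<N. shift_matrix x (e l) (e i) * \<phi> i t)"
proof -
  have "(\<Sum>i<N. shift_matrix x (e l) (e i) * \<phi> i t) =
     (\<Sum>\<beta>\<in>exponents d. \<Prod>j\<in>UNIV. shift_coeff (x $ j) (e l j) (\<beta> j) * (t $ j) ^ \<beta> j)"
    using sum_e_eq[of "\<lambda>\<beta>. \<Prod>j\<in>UNIV. shift_coeff (x $ j) (e l j) (\<beta> j) * (t $ j) ^ \<beta> j"]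
    by (simp add: shift_matrix_def \<phi>_def prod.distrib)
  also have "\<dots> = (\<Prod>j\<in>UNIV. \<Sum>b\<le>d. shift_coeff (x $ j) (e l j) b * (t $ j) ^ b)"
    by (rule sum_exponents_prod[OF e_in[OF assms]]) (simp add: shift_coeff_eq_0)
  also have "\<dots> = \<phi> l (x - t)"
    using e_le[OF assms] by (simp add: \<phi>_def flip: shift_coeff_expand)
  finally show ?thesis ..
qed

text \<open>Substituting \<open>x - t\<close> for \<open>t\<close> twice is the identity; this
  factorises into the one-variable identities of \<open>sum_shift_coeff_mult\<close>.\<close>

lemma shift_matrix_mult:
  assumes "l < N" "i < N"
  shows "(\<Sum>k<N. shift_matrix x (e l) (e k) * shift_matrix x (e k) (e i)) = (if l = i then 1 else 0)"
proof -
  have "(\<Sum>k<N. shift_matrix x (e l) (e k) * shift_matrix x (e k) (e i)) =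
     (\<Sum>\<beta>\<in>exponents d. \<Prod>j\<in>UNIV. shift_coeff (x $ j) (e l j) (\<beta> j) * shift_coeff (x $ j) (\<beta> j) (e i j))"
    using sum_e_eq[of "\<lambda>\<beta>. \<Prod>j\<in>UNIV. shift_coeff (x $ j) (e l j) (\<beta> j) * shift_coeff (x $ j) (\<beta> j) (e i j)"]
    by (simp add: shift_matrix_def prod.distrib)
  also have "\<dots> = (\<Prod>j\<in>UNIV. \<Sum>b\<le>d. shift_coeff (x $ j) (e l j) b * shift_coeff (x $ j) b (e i j))"
    by (rule sum_exponents_prod[OF e_in[OF assms(1)]]) (simp add: shift_coeff_eq_0)
  also have "\<dots> = (\<Prod>j\<in>UNIV. if e l j = e i j then 1 else 0)"
    using e_le assms by (intro prod.cong) (auto simp: sum_shift_coeff_mult)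
  also have "\<dots> = (if e l = e i then 1 else 0)"
    by (auto simp: fun_eq_iff prod_zero_iff)
  also have "e l = e i \<longleftrightarrow> l = i" using assms by (metis index_e)
  finally show ?thesis .
qed

lemma shift_matrix_zero: "l < N \<Longrightarrow> shift_matrix x (e 0) (e l) = (if l = 0 then 1 else 0)"
proof (cases "l = 0")
  case True
  then show ?thesis by (simp add: shift_matrix_def shift_coeff_def e_0)
next
  case False
  assume "l < N"
  then have "e l \<noteq> e 0" using False index_e N_pos by metis
  then obtain j where "0 < e l j" unfolding e_0 by auto
  then have "shift_matrix x (e 0) (e l) = 0"
    unfolding shift_matrix_def by (intro prod_zero) (auto simp: shift_coeff_eq_0 e_0 intro!: exI[of _ j])
  then show ?thesis using False by simp
qed

lemma reflect_reflect:
  assumes X: "X \<in> space coeffs"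
  shows "reflect z (reflect z X) = X"
proof
  fix i
  show "reflect z (reflect z X) i = X i"
  proof (cases "i < N")
    case False
    then show ?thesis using X by (auto simp: reflect_def space_PiM PiE_iff extensional_def)
  next
    case True
    let ?S = "\<lambda>l i. shift_matrix (fst z) (e l) (e i)"
    have "(\<Sum>l<N. ?S l i *\<^sub>R reflect z X l) =
      (\<Sum>l<N. ?S l i *\<^sub>R (if l = 0 then snd z else 0)) - (\<Sum>l<N. \<Sum>k<N. (?S k l * ?S l i) *\<^sub>R X k)"
      by (simp add: reflect_def scaleR_diff_right sum_subtractf scaleR_sum_right mult.commute)
    also have "(\<Sum>l<N. ?S l i *\<^sub>R (if l = 0 then snd z else 0)) = (\<Sum>l<N. if l = 0 then ?S 0 i *\<^sub>R snd z else 0)"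
      by (intro sum.cong) auto
    also have "\<dots> = (if i = 0 then snd z else 0)"
      using N_pos True by (simp add: shift_matrix_zero)
    also have "(\<Sum>l<N. \<Sum>k<N. (?S k l * ?S l i) *\<^sub>R X k) = (\<Sum>k<N. (\<Sum>l<N. ?S k l * ?S l i) *\<^sub>R X k)"
      by (subst sum.swap) (simp add: scaleR_sum_left)
    also have "\<dots> = (\<Sum>k<N. if k = i then X i else 0)"
      using True by (intro sum.cong) (auto simp: shift_matrix_mult)
    also have "\<dots> = X i" using True by simp
    finally show ?thesis using True by (simp add: reflect_def)
  qed
qed

lemma poly_of_reflect: "poly_of (reflect (x, y) X) t = y - poly_of X (x - t)"
proof -
  have "poly_of (reflect (x, y) X) t =
    (\<Sum>i<N. \<phi> i t *\<^sub>R (if i = 0 then y else 0)) - (\<Sum>i<N. \<Sum>l<N. (shift_matrix x (e l) (e i) * \<phi> i t) *\<^sub>R X l)"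
    by (simp add: poly_of_def reflect_def scaleR_diff_right sum_subtractf scaleR_sum_right mult.commute
        cong: if_cong)
  also have "(\<Sum>i<N. \<phi> i t *\<^sub>R (if i = 0 then y else 0)) = (\<Sum>i<N. if i = 0 then y else 0)"
    by (intro sum.cong) auto
  also have "\<dots> = y" using N_pos by simp
  also have "(\<Sum>i<N. \<Sum>l<N. (shift_matrix x (e l) (e i) * \<phi> i t) *\<^sub>R X l) =
     (\<Sum>l<N. (\<Sum>i<N. shift_matrix x (e l) (e i) * \<phi> i t) *\<^sub>R X l)"
    by (subst sum.swap) (simp add: scaleR_sum_left)
  also have "\<dots> = poly_of X (x - t)" by (simp add: poly_of_def \<phi>_diff)
  finally show ?thesis .
qed

lemma continuous_shift_matrix [continuous_intros]:
  "continuous_on A (\<lambda>x. shift_matrix x \<alpha> \<beta>)"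
  unfolding shift_matrix_def shift_coeff_def by (intro continuous_intros)

lemma measurable_shift_matrix [measurable]: "(\<lambda>x. shift_matrix x \<alpha> \<beta>) \<in> borel_measurable borel"
  by (intro borel_measurable_continuous_onI continuous_intros)

lemma measurable_reflect_pair [measurable]:
  "(\<lambda>w. reflect (fst w) (snd w)) \<in> (borel :: ((real ^ 'n) \<times> (real ^ 'm::finite)) measure) \<Otimes>\<^sub>M coeffs \<rightarrow>\<^sub>M coeffs"
  unfolding reflect_def
proof (rule measurable_restrict)
  fix i assume "i \<in> {..<N}"
  let ?M = "(borel :: ((real ^ 'n) \<times> (real ^ 'm)) measure) \<Otimes>\<^sub>M (coeffs :: (nat \<Rightarrow> real ^ 'm) measure)"
  have [measurable]: "(\<lambda>w. fst (fst w)) \<in> borel_measurable ?M" "(\<lambda>w. snd (fst w)) \<in> borel_measurable ?M"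
    by (auto simp flip: borel_prod)
  show "(\<lambda>w. (if i = 0 then snd (fst w) else 0) - (\<Sum>l<N. shift_matrix (fst (fst w)) (e l) (e i) *\<^sub>R snd w l))
     \<in> ?M \<rightarrow>\<^sub>M lborel"
    by simp
qed

lemma measurable_reflect [measurable]: "reflect z \<in> coeffs \<rightarrow>\<^sub>M coeffs"
  using measurable_compose[OF measurable_Pair1' measurable_reflect_pair, of z] by simp

text \<open>In the increasing enumeration the linear part is triangular with diagonal entries of
  modulus 1, so its Jacobian is 1; the added constant is a translation.\<close>

lemma distr_reflect: "distr coeffs coeffs (reflect z) = (coeffs :: (nat \<Rightarrow> real ^ 'm::finite) measure)"
proof (rule PL.PiM_eqI)
  fix A :: "nat \<Rightarrow> (real ^ 'm) set" assume A: "\<And>i. i \<in> {..<N} \<Longrightarrow> A i \<in> sets lborel"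
  \<comment> \<open>The matrix is continued by the identity beyond \<open>N\<close>, which keeps it
    triangular for all indices.\<close>
  let ?S = "\<lambda>l i. if l < N \<and> i < N then - shift_matrix (fst z) (e l) (e i) else if l = i then 1 else 0"
  define y where "y i = (if i = (0::nat) then snd z else 0)" for i
  define F where "F i v = (indicator (if i < N then A i else {}) (y i + v) :: ennreal)" for i v
  have Fm: "F i \<in> borel_measurable borel" for i
    using A[of i] unfolding F_def by auto
  \<comment> \<open>The preceding exponent \<open>e k\<close> has an entry below that of
    \<open>e i\<close>, and \<open>(x - t) ^ a\<close> contains no power of \<open>t\<close> above
    \<open>a\<close>.\<close>
  have tri: "?S k i = 0" if "k < i" for k i
  proof (cases "i < N")
    case True
    from lexless_ex_less[OF e_less[OF that True]] obtain j where "e k j < e i j" by blast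
    then have "shift_matrix (fst z) (e k) (e i) = 0"
      unfolding shift_matrix_def by (intro prod_zero) (auto simp: shift_coeff_eq_0 intro!: exI[of _ j])
    then show ?thesis using that by simp
  qed (use that in simp)
  have piv: "\<bar>pivot ?S k\<bar> = 1" if "k < N" for k
  proof -
    have "pivot ?S k = ?S k k" unfolding pivot_def using tri by (rule elim_triangular) simp_all
    then show ?thesis
      using that by (simp add: shift_matrix_def shift_coeff_def abs_prod power_abs)
  qed
  have S: "Pi\<^sub>E {..<N} A \<in> sets coeffs" using A by (intro sets_PiM_I_finite) auto
  then have "emeasure (distr coeffs coeffs (reflect z)) (Pi\<^sub>E {..<N} A) =
     (\<integral>\<^sup>+X. indicator (Pi\<^sub>E {..<N} A) X \<partial>distr coeffs coeffs (reflect z))"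
    by simp
  also have "\<dots> = (\<integral>\<^sup>+X. indicator (Pi\<^sub>E {..<N} A) (reflect z X) \<partial>coeffs)"
    using S by (intro nn_integral_distr measurable_reflect) simp
  also have "\<dots> = (\<integral>\<^sup>+X. (\<Prod>i<N. F i (\<Sum>l<N. ?S l i *\<^sub>R X l)) \<partial>coeffs)"
  proof (intro nn_integral_cong)
    fix X :: "nat \<Rightarrow> real ^ 'm"
    have r: "reflect z X i = y i + (\<Sum>l<N. ?S l i *\<^sub>R X l)" if "i < N" for i
      using that by (simp add: reflect_def y_def sum_negf)
    have "reflect z X \<in> Pi\<^sub>E {..<N} A \<longleftrightarrow> (\<forall>i<N. reflect z X i \<in> A i)"
      by (auto simp: PiE_iff reflect_def)
    moreover have "(\<Prod>i<N. F i (\<Sum>l<N. ?S l i *\<^sub>R X l)) = (\<Prod>i<N. indicator (A i) (reflect z X i))"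
      by (intro prod.cong refl) (simp only: r F_def if_True lessThan_iff)
    moreover have "(\<Prod>i<N. indicator (A i) (reflect z X i)) = (if \<forall>i<N. reflect z X i \<in> A i then 1 else 0 :: ennreal)"
    proof (cases "\<forall>i<N. reflect z X i \<in> A i")
      case False
      then obtain i where "i < N" "reflect z X i \<notin> A i" by blast
      then have "(\<Prod>i<N. indicator (A i) (reflect z X i) :: ennreal) = 0"
        by (intro prod_zero bexI[of _ i]) auto
      then show ?thesis using False by simp
    qed simp
    ultimately show "indicator (Pi\<^sub>E {..<N} A) (reflect z X) = (\<Prod>i<N. F i (\<Sum>l<N. ?S l i *\<^sub>R X l))"
      by (simp only: indicator_def of_bool_def)
  qed
  also have "\<dots> = (\<Prod>i<N. ennreal (\<bar>pivot ?S i\<bar> ^ DIM(real ^ 'm))) *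
     (\<integral>\<^sup>+X. (\<Prod>i<N. F i (\<Sum>l<N. ?S l i *\<^sub>R X l)) \<partial>coeffs)"
    by (simp add: piv)
  also have "\<dots> = (\<Prod>i<N. \<integral>\<^sup>+v. F i v \<partial>lborel)"
    by (rule nn_integral_matrix[OF Fm]) (use piv in force)
  also have "\<dots> = (\<Prod>i\<in>{..<N}. emeasure lborel (A i))"
  proof (intro prod.cong refl)
    fix i assume "i \<in> {..<N}"
    then show "(\<integral>\<^sup>+v. F i v \<partial>lborel) = emeasure lborel (A i)"
      using A[of i] nn_integral_lborel_shift[of "indicator (A i)" "y i"] by (simp add: F_def)
  qed
  finally show "emeasure (distr coeffs coeffs (reflect z)) (Pi\<^sub>E {..<N} A) = (\<Prod>i\<in>{..<N}. emeasure lborel (A i))" .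
qed simp_all

lemma nn_integral_reflect:
  assumes [measurable]: "G \<in> borel_measurable coeffs"
  shows "(\<integral>\<^sup>+X. G (reflect z X) \<partial>coeffs) = (\<integral>\<^sup>+X. G X \<partial>coeffs)"
  by (subst (2) distr_reflect[of z, symmetric]) (simp add: nn_integral_distr)

text \<open>
  Generic translates of a polynomial of degree \<open>d \<ge> 2\<close> are told apart by their coefficients of
  degree \<open>d - 1\<close>. Those of \<open>t\<^sub>j ^ (d - 1)\<close> depend affinely on the translation, and \<open>slope\<close> is
  the matrix of that dependence.
\<close>

definition sub_exponent :: "'n \<Rightarrow> 'n \<Rightarrow> nat" where
  "sub_exponent j = (\<lambda>i. if i = j then d - 1 else 0)"

definition top_exponent :: "'n \<Rightarrow> 'n \<Rightarrow> 'n \<Rightarrow> nat" where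
  "top_exponent j k = (\<lambda>i. sub_exponent j i + (if i = k then 1 else 0))"

definition slope :: "'m \<Rightarrow> (nat \<Rightarrow> real ^ 'm::finite) \<Rightarrow> nat \<Rightarrow> nat \<Rightarrow> real" where
  "slope c X l i = (if l < CARD('n) \<and> i < CARD('n)
     then (if l = i then real d else 1) * X (index (top_exponent (js ! i) (js ! l))) $ c else 0)"

lemma bij_js: "bij_betw ((!) js) {..<CARD('n)} UNIV"
  using bij_betw_nth[OF js(1), of "{..<CARD('n)}" UNIV] js(2) length_js by auto

lemma sum_sub_exponent: "(\<Sum>i\<in>UNIV. sub_exponent j i) = d - 1"
  by (simp add: sub_exponent_def)

lemma sum_top_exponent: "(\<Sum>i\<in>UNIV. top_exponent j k i) = d"
  using d_pos by (simp add: top_exponent_def sum.distrib sum_sub_exponent)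

lemma sub_exponent_in: "sub_exponent j \<in> exponents d"
  by (simp add: exponents_def sum_sub_exponent)

lemma top_exponent_in: "top_exponent j k \<in> exponents d"
  by (simp add: exponents_def sum_top_exponent)

lemma shift_matrix_nonzeroD: "shift_matrix x \<alpha> \<beta> \<noteq> 0 \<Longrightarrow> \<beta> i \<le> \<alpha> i"
proof (rule ccontr)
  assume nz: "shift_matrix x \<alpha> \<beta> \<noteq> 0" and "\<not> \<beta> i \<le> \<alpha> i"
  then have "shift_coeff (x $ i) (\<alpha> i) (\<beta> i) = 0" by (simp add: shift_coeff_eq_0)
  then have "shift_matrix x \<alpha> \<beta> = 0"
    unfolding shift_matrix_def by (intro prod_zero bexI[of _ i]) auto
  with nz show False by simp
qed

lemma shift_matrix_same: "shift_matrix x \<beta> \<beta> = (- 1) ^ (\<Sum>i\<in>UNIV. \<beta> i)"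
  by (simp add: shift_matrix_def shift_coeff_def power_sum)

lemma shift_matrix_Suc:
  "shift_matrix x (\<lambda>i. \<beta> i + (if i = k then 1 else 0)) \<beta> =
     (- 1) ^ (\<Sum>i\<in>UNIV. \<beta> i) * (real (\<beta> k + 1) * x $ k)"
proof -
  have "shift_matrix x (\<lambda>i. \<beta> i + (if i = k then 1 else 0)) \<beta> =
     (\<Prod>i\<in>UNIV. (- 1) ^ \<beta> i * (if i = k then real (\<beta> k + 1) * x $ k else 1))"
    unfolding shift_matrix_def by (intro prod.cong) (auto simp: shift_coeff_def)
  also have "\<dots> = (- 1) ^ (\<Sum>i\<in>UNIV. \<beta> i) * (real (\<beta> k + 1) * x $ k)"
    by (simp add: prod.distrib power_sum)
  finally show ?thesis .
qed

lemma reflect_index: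
  assumes "\<beta> \<in> exponents d" "\<beta> \<noteq> (\<lambda>_. 0)"
  shows "reflect z X (index \<beta>) = - (\<Sum>\<alpha>\<in>exponents d. shift_matrix (fst z) \<alpha> \<beta> *\<^sub>R X (index \<alpha>))"
proof -
  have "index \<beta> \<noteq> 0" using assms e_index[OF assms(1)] e_0 by metis
  then have "reflect z X (index \<beta>) = - (\<Sum>l<N. shift_matrix (fst z) (e l) \<beta> *\<^sub>R X (index (e l)))"
    using assms by (simp add: reflect_def index_less e_index index_e)
  then show ?thesis using sum_e_eq[of "\<lambda>\<alpha>. shift_matrix (fst z) \<alpha> \<beta> *\<^sub>R X (index \<alpha>)"] by simp
qed

text \<open>A coefficient receives contributions only from exponents that dominate its own
  entrywise; for one of degree \<open>d\<close> this leaves only itself.\<close>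

lemma reflect_top:
  "reflect z X (index (top_exponent j k)) = - ((- 1) ^ d) *\<^sub>R X (index (top_exponent j k))"
proof -
  let ?\<beta> = "top_exponent j k"
  have ne: "?\<beta> \<noteq> (\<lambda>_. 0)"
    by (auto simp: fun_eq_iff top_exponent_def)
  have z: "shift_matrix (fst z) \<alpha> ?\<beta> = 0" if \<alpha>: "\<alpha> \<in> exponents d - {?\<beta>}" for \<alpha>
  proof (rule ccontr)
    assume "shift_matrix (fst z) \<alpha> ?\<beta> \<noteq> 0"
    then have le: "?\<beta> i \<le> \<alpha> i" for i by (rule shift_matrix_nonzeroD)
    have "?\<beta> \<noteq> \<alpha>" using \<alpha> by auto
    then obtain i where "?\<beta> i \<noteq> \<alpha> i" by (metis ext)
    then have "?\<beta> i < \<alpha> i" using le[of i] by simp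
    then have "(\<Sum>i\<in>UNIV. ?\<beta> i) < (\<Sum>i\<in>UNIV. \<alpha> i)"
      using le by (intro sum_strict_mono_ex1) auto
    then show False using \<alpha> by (simp add: sum_top_exponent exponents_def)
  qed
  have "(\<Sum>\<alpha>\<in>exponents d. shift_matrix (fst z) \<alpha> ?\<beta> *\<^sub>R X (index \<alpha>)) =
      (\<Sum>\<alpha>\<in>{?\<beta>}. shift_matrix (fst z) \<alpha> ?\<beta> *\<^sub>R X (index \<alpha>))"
    using z top_exponent_in by (intro sum.mono_neutral_right) auto
  then show ?thesis
    by (simp add: reflect_index[OF top_exponent_in ne] shift_matrix_same sum_top_exponent)
qed

text \<open>An exponent of degree \<open>d - 1\<close> is dominated only by itself and its
  successors of degree \<open>d\<close>; the latter enter linearly in \<open>fst z\<close>. For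
  \<open>d \<ge> 2\<close> it is not the constant exponent, so \<open>snd z\<close> does not
  enter.\<close>

lemma reflect_sub:
  assumes "d \<ge> 2"
  shows "reflect z X (index (sub_exponent j)) = - ((- 1) ^ (d - 1)) *\<^sub>R (X (index (sub_exponent j)) +
     (\<Sum>k\<in>UNIV. ((if k = j then real d else 1) * fst z $ k) *\<^sub>R X (index (top_exponent j k))))"
proof -
  let ?\<beta> = "sub_exponent j"
  let ?f = "\<lambda>\<alpha>. shift_matrix (fst z) \<alpha> ?\<beta> *\<^sub>R X (index \<alpha>)"
  have ne: "?\<beta> \<noteq> (\<lambda>_. 0)"
    using assms by (auto simp: fun_eq_iff sub_exponent_def)
  have topne: "top_exponent j k \<noteq> ?\<beta>" for k
    by (auto simp: top_exponent_def fun_eq_iff)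
  have z: "?f \<alpha> = 0" if \<alpha>: "\<alpha> \<in> exponents d - insert ?\<beta> (range (top_exponent j))" for \<alpha>
  proof (rule ccontr)
    assume "?f \<alpha> \<noteq> 0"
    then have le: "?\<beta> i \<le> \<alpha> i" for i using shift_matrix_nonzeroD by auto
    have "?\<beta> \<noteq> \<alpha>" using \<alpha> by auto
    then obtain k where k: "?\<beta> k \<noteq> \<alpha> k" by (metis ext)
    have top: "top_exponent j k i \<le> \<alpha> i" for i
      using le[of i] k le[of k] by (auto simp: top_exponent_def)
    have "top_exponent j k \<noteq> \<alpha>" using \<alpha> by auto
    then obtain i where "top_exponent j k i \<noteq> \<alpha> i" by (metis ext)
    then have "top_exponent j k i < \<alpha> i" using top[of i] by simp
    then have "(\<Sum>i\<in>UNIV. top_exponent j k i) < (\<Sum>i\<in>UNIV. \<alpha> i)"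
      using top by (intro sum_strict_mono_ex1) auto
    then show False using \<alpha> by (simp add: sum_top_exponent exponents_def)
  qed
  have inj: "inj (top_exponent j)"
  proof (rule injI)
    fix k k' assume "top_exponent j k = top_exponent j k'"
    then have "top_exponent j k k = top_exponent j k' k" by simp
    then show "k = k'" by (auto simp: top_exponent_def split: if_splits)
  qed
  have "(\<Sum>\<alpha>\<in>exponents d. ?f \<alpha>) = (\<Sum>\<alpha>\<in>insert ?\<beta> (range (top_exponent j)). ?f \<alpha>)"
    using z top_exponent_in sub_exponent_in by (intro sum.mono_neutral_right) auto
  also have "\<dots> = ?f ?\<beta> + (\<Sum>k\<in>UNIV. ?f (top_exponent j k))"
    using topne topne[symmetric] by (subst sum.insert) (auto simp: sum.reindex[OF inj])
  also have "?f ?\<beta> = (- 1) ^ (d - 1) *\<^sub>R X (index ?\<beta>)"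
    by (simp add: shift_matrix_same sum_sub_exponent)
  also have "(\<Sum>k\<in>UNIV. ?f (top_exponent j k)) = (- 1) ^ (d - 1) *\<^sub>R
     (\<Sum>k\<in>UNIV. ((if k = j then real d else 1) * fst z $ k) *\<^sub>R X (index (top_exponent j k)))"
    unfolding scaleR_sum_right
  proof (intro sum.cong refl)
    fix k
    have "real (?\<beta> k + 1) = (if k = j then real d else 1)" using d_pos by (simp add: sub_exponent_def)
    then show "?f (top_exponent j k) = (- 1) ^ (d - 1) *\<^sub>R
        (((if k = j then real d else 1) * fst z $ k) *\<^sub>R X (index (top_exponent j k)))"
      using shift_matrix_Suc[of "fst z" ?\<beta> k]
      by (simp add: top_exponent_def[of j k] sum_sub_exponent)
  qed
  finally show ?thesis
    by (simp add: reflect_index[OF sub_exponent_in ne] scaleR_add_right)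
qed

text \<open>The coefficients of degree \<open>d\<close> change at most by a common sign, so the
  Jacobian factor of the weight below is constant along each orbit.\<close>

lemma abs_pivot_slope_reflect: "\<bar>pivot (slope c (reflect z X)) k\<bar> = \<bar>pivot (slope c X) k\<bar>"
proof (cases "even d")
  case True
  then have "slope c (reflect z X) = (\<lambda>l i. - slope c X l i)"
    by (auto simp: slope_def fun_eq_iff reflect_top)
  then show ?thesis by (simp add: pivot_uminus)
next
  case False
  then have "slope c (reflect z X) = slope c X"
    by (auto simp: slope_def fun_eq_iff reflect_top)
  then show ?thesis by simp
qed

section \<open>A weight with bounded integrals over orbits\<close>

text \<open>\<open>hm\<close> localises the constant coefficient and \<open>hr\<close> the
  coefficients of \<open>t\<^sub>j ^ (d - 1)\<close> in component \<open>c\<close>. The pivots are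
  the Jacobian of the dependence of the latter on the translation.\<close>

definition slice_weight ::
  "'m \<Rightarrow> (real ^ 'm \<Rightarrow> ennreal) \<Rightarrow> (real \<Rightarrow> ennreal) \<Rightarrow> (nat \<Rightarrow> real ^ 'm::finite) \<Rightarrow> ennreal" where
  "slice_weight c hm hr X = hm (X 0) *
     ((\<Prod>i<CARD('n). hr (X (index (sub_exponent (js ! i))) $ c)) *
      (\<Prod>i<CARD('n). ennreal \<bar>pivot (slope c X) i\<bar>))"

lemma measurable_component: "k < N \<Longrightarrow> (\<lambda>X. X k) \<in> borel_measurable (coeffs :: (nat \<Rightarrow> real ^ 'm::finite) measure)"
  using measurable_component_singleton[of k "{..<N}" "\<lambda>_. lborel :: (real ^ 'm) measure"] by simp

lemma measurable_slope [measurable]: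
  "(\<lambda>X. slope c X l i) \<in> borel_measurable (coeffs :: (nat \<Rightarrow> real ^ 'm::finite) measure)"
proof -
  have "(\<lambda>X. X (index (top_exponent (js ! i) (js ! l))) $ c)
      \<in> borel_measurable (coeffs :: (nat \<Rightarrow> real ^ 'm) measure)"
    by (rule measurable_compose[OF measurable_component[OF index_less[OF top_exponent_in]]]) simp
  then show ?thesis
    by (cases "l < CARD('n) \<and> i < CARD('n)") (simp_all add: slope_def)
qed

lemma measurable_pivot_slope [measurable]:
  "(\<lambda>X. pivot (slope c X) k) \<in> borel_measurable (coeffs :: (nat \<Rightarrow> real ^ 'm::finite) measure)"
  by (rule measurable_pivot) (rule measurable_slope)

lemma measurable_slice_weight [measurable]:
  assumes [measurable]: "hm \<in> borel_measurable borel" "hr \<in> borel_measurable borel"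
  shows "slice_weight c hm hr \<in> borel_measurable (coeffs :: (nat \<Rightarrow> real ^ 'm::finite) measure)"
proof -
  let ?M = "coeffs :: (nat \<Rightarrow> real ^ 'm) measure"
  have 1: "(\<lambda>X. hm (X 0)) \<in> borel_measurable ?M"
    by (rule measurable_compose[OF measurable_component[OF N_pos]]) simp
  have 2: "(\<lambda>X. hr (X (index (sub_exponent j)) $ c)) \<in> borel_measurable ?M" for j
    by (rule measurable_compose[OF measurable_component[OF index_less[OF sub_exponent_in]]]) simp
  have 3: "(\<lambda>X. ennreal \<bar>pivot (slope c X) i\<bar>) \<in> borel_measurable ?M" for i
    by measurable
  show ?thesis
    unfolding slice_weight_def
    by (intro borel_measurable_times_ennreal borel_measurable_prod_ennreal 1 2 3)
qed

text \<open>Integration over \<open>y\<close> sees a translate of \<open>hm\<close>. The other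
  factors are functions of affine forms in \<open>x\<close> with matrix \<open>slope c X\<close>,
  whose Jacobian the weight contains. A vanishing pivot makes the weight 0 on the whole
  orbit.\<close>

lemma nn_integral_slice_weight_reflect_le:
  fixes X :: "nat \<Rightarrow> real ^ 'm::finite"
  assumes d: "d \<ge> 2" and X: "X \<in> space coeffs"
    and [measurable]: "hm \<in> borel_measurable borel" "hr \<in> borel_measurable borel"
  shows "(\<integral>\<^sup>+z. slice_weight c hm hr (reflect z X) \<partial>lborel) \<le>
    (\<integral>\<^sup>+y. hm y \<partial>lborel) * (\<integral>\<^sup>+u. hr u \<partial>lborel) ^ CARD('n)"
proof -
  define \<epsilon> :: real where "\<epsilon> = - ((- 1) ^ (d - 1))"
  have \<epsilon>: "\<bar>\<epsilon>\<bar> = 1" by (simp add: \<epsilon>_def power_abs)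
  let ?P = "\<Prod>i<CARD('n). ennreal \<bar>pivot (slope c X) i\<bar>"
  define q where "q i = X (index (sub_exponent (js ! i))) $ c" for i
  define L where "L i x = (\<Sum>l<CARD('n). slope c X l i *\<^sub>R (x $ (js ! l)))" for i and x :: "real ^ 'n"
  define v where "v x = (\<Sum>l<N. shift_matrix x (e l) (e 0) *\<^sub>R X l)" for x
  have [measurable]: "L i \<in> borel_measurable borel" for i
    unfolding L_def by (intro borel_measurable_continuous_onI continuous_intros)
  have [measurable]: "v \<in> borel_measurable borel"
    unfolding v_def by measurable
  have sub: "reflect (x, y) X (index (sub_exponent (js ! i))) $ c = \<epsilon> * (q i + L i x)"
    if i: "i < CARD('n)" for x y i
  proof -
    have eq: "js ! l = js ! i \<longleftrightarrow> l = i" if "l < CARD('n)" for l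
      using js(1) i that length_js by (simp add: nth_eq_iff_index_eq)
    have "(\<Sum>k\<in>UNIV. (if k = js ! i then real d else 1) * x $ k * X (index (top_exponent (js ! i) k)) $ c) =
      (\<Sum>l<CARD('n). (if js ! l = js ! i then real d else 1) * x $ (js ! l) *
        X (index (top_exponent (js ! i) (js ! l))) $ c)"
      by (rule sum.reindex_bij_betw[OF bij_js, symmetric])
    also have "\<dots> = L i x"
      unfolding L_def by (intro sum.cong) (use i eq in \<open>auto simp: slope_def\<close>)
    finally show ?thesis
      by (simp add: reflect_sub[OF d] \<epsilon>_def q_def sum_component)
  qed
  have w: "slice_weight c hm hr (reflect (x, y) X) =
      hm (y - v x) * ((\<Prod>i<CARD('n). hr (\<epsilon> * (q i + L i x))) * ?P)" for x y
    unfolding slice_weight_def abs_pivot_slope_reflect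
    using N_pos by (simp add: sub v_def) (simp add: reflect_def)
  have hm: "(\<integral>\<^sup>+y. hm (y - v x) \<partial>lborel) = (\<integral>\<^sup>+y. hm y \<partial>lborel)" for x
    using nn_integral_lborel_shift[of hm "- v x"] by simp
  have "(\<integral>\<^sup>+z. slice_weight c hm hr (reflect z X) \<partial>lborel) =
     (\<integral>\<^sup>+z. slice_weight c hm hr (reflect z X) \<partial>(lborel \<Otimes>\<^sub>M lborel))"
    by (simp add: lborel_prod)
  also have "\<dots> = (\<integral>\<^sup>+x. \<integral>\<^sup>+y. slice_weight c hm hr (reflect (x, y) X) \<partial>lborel \<partial>lborel)"
  proof (rule lborel.nn_integral_fst[symmetric])
    have "(\<lambda>z. reflect z X) \<in> borel \<rightarrow>\<^sub>M coeffs"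
      using measurable_compose[OF measurable_Pair2'[OF X] measurable_reflect_pair] by simp
    then show "(\<lambda>z. slice_weight c hm hr (reflect z X)) \<in> borel_measurable (lborel \<Otimes>\<^sub>M lborel)"
      by (simp add: lborel_prod)
  qed
  also have "\<dots> = (\<integral>\<^sup>+x. (\<integral>\<^sup>+y. hm y \<partial>lborel) * ((\<Prod>i<CARD('n). hr (\<epsilon> * (q i + L i x))) * ?P) \<partial>lborel)"
    unfolding w by (intro nn_integral_cong) (simp add: nn_integral_multc hm)
  also have "\<dots> = (\<integral>\<^sup>+y. hm y \<partial>lborel) * (?P * (\<integral>\<^sup>+x. (\<Prod>i<CARD('n). hr (\<epsilon> * (q i + L i x))) \<partial>lborel))"
    by (simp add: nn_integral_cmult nn_integral_multc mult.commute)
  also have "?P * (\<integral>\<^sup>+x. (\<Prod>i<CARD('n). hr (\<epsilon> * (q i + L i x))) \<partial>lborel) \<le> (\<integral>\<^sup>+u. hr u \<partial>lborel) ^ CARD('n)"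
  proof (cases "\<forall>i<CARD('n). pivot (slope c X) i \<noteq> 0")
    case True
    \<comment> \<open>The coordinates of \<open>x\<close> are numbered as in \<open>js\<close>, to
      match the indices of \<open>slope\<close>.\<close>
    define \<nu> where "\<nu> = inv_into {..<CARD('n)} ((!) js)"
    have \<nu>: "bij_betw \<nu> UNIV {..<CARD('n)}" unfolding \<nu>_def by (rule bij_betw_inv_into[OF bij_js])
    have \<nu>js: "\<nu> (js ! l) = l" if "l < CARD('n)" for l
      unfolding \<nu>_def using bij_betw_inv_into_left[OF bij_js] that by simp
    note [measurable] = lborel_vec_reindex(2)[OF \<nu>]
    have "(\<integral>\<^sup>+x. (\<Prod>i<CARD('n). hr (\<epsilon> * (q i + L i x))) \<partial>lborel) =
      (\<integral>\<^sup>+f. (\<Prod>i<CARD('n). hr (\<epsilon> * (q i + L i (\<chi> j. f (\<nu> j))))) \<partial>PiM {..<CARD('n)} (\<lambda>_. lborel))"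
      by (subst lborel_vec_reindex(1)[OF \<nu>], subst nn_integral_distr) simp_all
    also have "\<dots> = (\<integral>\<^sup>+f. (\<Prod>i<CARD('n). hr (\<epsilon> * (q i + (\<Sum>l<CARD('n). slope c X l i *\<^sub>R f l)))) \<partial>PiM {..<CARD('n)} (\<lambda>_. lborel))"
      by (simp add: L_def \<nu>js)
    finally have "?P * (\<integral>\<^sup>+x. (\<Prod>i<CARD('n). hr (\<epsilon> * (q i + L i x))) \<partial>lborel) =
       (\<Prod>i<CARD('n). \<integral>\<^sup>+u. hr (\<epsilon> * (q i + u)) \<partial>lborel)"
      using nn_integral_matrix[of "\<lambda>i u. hr (\<epsilon> * (q i + u))" "CARD('n)" "slope c X"] True by simp
    moreover have "(\<integral>\<^sup>+u. hr (\<epsilon> * (q i + u)) \<partial>lborel) = (\<integral>\<^sup>+u. hr u \<partial>lborel)" for i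
    proof -
      have "(\<integral>\<^sup>+u. hr (\<epsilon> * (q i + u)) \<partial>lborel) = (\<integral>\<^sup>+u. hr (\<epsilon> * u) \<partial>lborel)"
        by (rule nn_integral_lborel_shift[of "\<lambda>u. hr (\<epsilon> * u)" "q i"]) simp
      also have "\<dots> = (\<integral>\<^sup>+u. hr u \<partial>lborel)"
        using nn_integral_lborel_scale[of hr \<epsilon>] \<epsilon> by (cases "\<epsilon> = 0") simp_all
      finally show ?thesis .
    qed
    ultimately show ?thesis by simp
  next
    case False
    then have P0: "?P = 0" by (intro prod_zero) auto
    show ?thesis unfolding P0 by simp
  qed
  finally show ?thesis by (simp add: mult_left_mono)
qed

lemma null_set_hyperplane:
  assumes "a \<noteq> 0"
  shows "emeasure lborel {v :: real ^ 'm::finite. a * v $ c + b = 0} = 0"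
proof -
  have "{v :: real ^ 'm. a * v $ c + b = 0} = {v. v $ c = - b / a}"
    using assms by (auto simp: field_simps eq_neg_iff_add_eq_0)
  moreover have "negligible {v :: real ^ 'm. v $ c = - b / a}"
    using negligible_standard_hyperplane[of "axis c 1 :: real ^ 'm" "- b / a"] by (simp add: inner_axis)
  moreover have "closed {v :: real ^ 'm. v $ c = - b / a}"
    by (intro closed_Collect_eq continuous_intros)
  ultimately show ?thesis
    by (auto simp: negligible_iff_null_sets null_sets_def)
qed

text \<open>
  Each pivot is nontrivially affine in the coefficient of \<open>t\<^sub>k ^ d\<close>, which does not occur in
  the rest of the leading submatrix.
\<close>

lemma AE_pivot_slope_nonzero:
  fixes c :: "'m::finite"
  assumes d: "d \<ge> 2" and k: "k < CARD('n)"
  shows "AE X in coeffs. pivot (slope c X) k \<noteq> 0"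
proof -
  define i0 where "i0 = index (top_exponent (js ! k) (js ! k))"
  let ?I = "{..<N} - {i0}"
  have i0: "i0 < N" unfolding i0_def by (rule index_less[OF top_exponent_in])
  have ins: "insert i0 ?I = {..<N}" using i0 by auto
  \<comment> \<open>For \<open>d \<ge> 2\<close> a pure \<open>d\<close>-th power arises from only
    one pair of indices, so this coefficient occupies only the entry \<open>(k, k)\<close>.\<close>
  have unaff: "slope c (X(i0 := v)) l i = slope c X l i" if "\<not> (l = k \<and> i = k)"
    for X :: "nat \<Rightarrow> real ^ 'm" and v l i
  proof (cases "l < CARD('n) \<and> i < CARD('n)")
    case True
    have "index (top_exponent (js ! i) (js ! l)) \<noteq> i0"
    proof
      assume "index (top_exponent (js ! i) (js ! l)) = i0"
      then have eq: "top_exponent (js ! i) (js ! l) = top_exponent (js ! k) (js ! k)"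
        unfolding i0_def using e_index[OF top_exponent_in] by metis
      have "js ! i = js ! k"
        using fun_cong[OF eq, of "js ! k"] fun_cong[OF eq, of "js ! i"] d
        by (auto simp: top_exponent_def sub_exponent_def split: if_splits)
      moreover from this have "js ! l = js ! k"
        using fun_cong[OF eq, of "js ! l"] by (auto simp: top_exponent_def sub_exponent_def split: if_splits)
      ultimately show False
        using that True k js(1) length_js by (simp add: nth_eq_iff_index_eq)
    qed
    then show ?thesis by (simp add: slope_def)
  qed (auto simp: slope_def)
  have null: "emeasure lborel {v. pivot (slope c (X(i0 := v))) k = 0} = 0" for X :: "nat \<Rightarrow> real ^ 'm"
  proof -
    obtain a where a: "\<And>A'. (\<forall>r. \<forall>j<k. A' r j = slope c X r j) \<Longrightarrow>
       (\<forall>i. elim A' k k i = A' k i + (\<Sum>r<k. a r * A' r i))"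
      using elim_combination[of k "slope c X" k] by blast
    have "pivot (slope c (X(i0 := v))) k = real d * v $ c + (\<Sum>r<k. a r * slope c X r k)" for v
    proof -
      have "\<forall>r. \<forall>j<k. slope c (X(i0 := v)) r j = slope c X r j" using unaff by auto
      from a[OF this] have "pivot (slope c (X(i0 := v))) k =
          slope c (X(i0 := v)) k k + (\<Sum>r<k. a r * slope c (X(i0 := v)) r k)"
        by (simp add: pivot_def)
      also have "(\<Sum>r<k. a r * slope c (X(i0 := v)) r k) = (\<Sum>r<k. a r * slope c X r k)"
        using unaff by (intro sum.cong) auto
      also have "slope c (X(i0 := v)) k k = real d * v $ c"
        using k by (simp add: slope_def i0_def)
      finally show ?thesis .
    qed
    then show ?thesis using null_set_hyperplane[of "real d" c] d by simp
  qed
  have S: "{X \<in> space (coeffs :: (nat \<Rightarrow> real ^ 'm) measure). pivot (slope c X) k = 0} \<in> sets coeffs"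
    by measurable
  have "emeasure coeffs {X \<in> space (coeffs :: (nat \<Rightarrow> real ^ 'm) measure). pivot (slope c X) k = 0} =
     (\<integral>\<^sup>+X. emeasure lborel {v. pivot (slope c (X(i0 := v))) k = 0} \<partial>PiM ?I (\<lambda>_. lborel))"
    using emeasure_PiM_insert(1)[of ?I i0 "\<lambda>X. pivot (slope c X) k = 0", unfolded ins, OF _ _ S] by simp
  then have "emeasure coeffs {X \<in> space (coeffs :: (nat \<Rightarrow> real ^ 'm) measure). pivot (slope c X) k = 0} = 0"
    by (simp add: null)
  then show ?thesis
    using S by (subst AE_iff_measurable[OF _ refl]) auto
qed

end

section \<open>From the multilinear estimate to convolutions\<close>

context exponent_enumeration
begin

text \<open>
  By invariance under reflections, integrating over a weighted set of polynomials and then over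
  all their translates costs no more than integrating over the whole coefficient space.
\<close>

lemma AE_nn_integral_multilinear_reflect:
  fixes F :: "(real ^ 'n) \<times> (real ^ 'm::finite) \<Rightarrow> ennreal"
  assumes d: "d \<ge> 2" and F [measurable]: "F \<in> borel_measurable borel" and fin: "(\<integral>\<^sup>+z. F z \<partial>lborel) < \<infinity>"
  shows "AE X in coeffs. (\<integral>\<^sup>+z. multilinear F (reflect z X) \<partial>lborel) < \<infinity>"
proof -
  let ?C = "coeffs :: (nat \<Rightarrow> real ^ 'm) measure"
  \<comment> \<open>A single component already controls the translation in \<open>x\<close>, so any
    \<open>c\<close> will do.\<close>
  define c :: 'm where "c = undefined"
  \<comment> \<open>Sigma-finiteness gives everywhere positive functions of finite integral;
    positivity later allows the weight to be divided out.\<close>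
  obtain hm :: "real ^ 'm \<Rightarrow> ennreal" where hm [measurable]: "hm \<in> borel_measurable borel"
    and hm_fin: "integral\<^sup>N lborel hm \<noteq> \<infinity>" and hm_pos: "\<And>y. 0 < hm y"
    using sigma_finite_measure.Ex_finite_integrable_function[OF sigma_finite_lborel] by auto
  obtain hr :: "real \<Rightarrow> ennreal" where hr [measurable]: "hr \<in> borel_measurable borel"
    and hr_fin: "integral\<^sup>N lborel hr \<noteq> \<infinity>" and hr_pos: "\<And>y. 0 < hr y"
    using sigma_finite_measure.Ex_finite_integrable_function[OF sigma_finite_lborel] by auto
  define w where "w = slice_weight c hm hr"
  define K where "K = integral\<^sup>N lborel hm * integral\<^sup>N lborel hr ^ CARD('n)"
  have K: "K < \<infinity>"
    using hm_fin hr_fin by (simp add: K_def ennreal_mult_less_top power_less_top_ennreal less_top)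
  have w [measurable]: "w \<in> borel_measurable ?C" unfolding w_def by measurable
  have ml [measurable]: "multilinear F \<in> borel_measurable ?C" by measurable
  let ?P = "(lborel :: ((real ^ 'n) \<times> (real ^ 'm)) measure)"
  have refl [measurable]: "(\<lambda>v. reflect (fst v) (snd v)) \<in> ?P \<Otimes>\<^sub>M ?C \<rightarrow>\<^sub>M ?C"
    using measurable_reflect_pair by simp
  have refl' [measurable]: "(\<lambda>v. reflect (snd v) (fst v)) \<in> ?C \<Otimes>\<^sub>M ?P \<rightarrow>\<^sub>M ?C"
    using measurable_compose[OF measurable_pair_swap' refl] by (simp add: case_prod_beta)
  have mr [measurable]: "(\<lambda>v. multilinear F (reflect (snd v) (fst v))) \<in> borel_measurable (?C \<Otimes>\<^sub>M ?P)"
    by (rule measurable_compose[OF refl' ml])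
  have wr [measurable]: "(\<lambda>v. w (reflect (snd v) (fst v))) \<in> borel_measurable (?C \<Otimes>\<^sub>M ?P)"
    by (rule measurable_compose[OF refl' w])
  have ps: "pair_sigma_finite ?C ?P" by (simp add: pair_sigma_finite_def sigma_finite_lborel)
  have "(\<integral>\<^sup>+X. w X * (\<integral>\<^sup>+z. multilinear F (reflect z X) \<partial>lborel) \<partial>?C) =
    (\<integral>\<^sup>+X. \<integral>\<^sup>+z. w X * multilinear F (reflect z X) \<partial>lborel \<partial>?C)"
  proof (intro nn_integral_cong nn_integral_cmult[symmetric])
    fix X assume "X \<in> space ?C"
    then show "(\<lambda>z. multilinear F (reflect z X)) \<in> borel_measurable ?P"
      using measurable_compose[OF measurable_Pair1' mr] by simp
  qed
  also have "\<dots> = (\<integral>\<^sup>+z. \<integral>\<^sup>+X. w X * multilinear F (reflect z X) \<partial>?C \<partial>lborel)"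
    by (rule pair_sigma_finite.Fubini'[OF ps, symmetric]) (simp add: case_prod_beta)
  also have "\<dots> = (\<integral>\<^sup>+z. \<integral>\<^sup>+X. w (reflect z X) * multilinear F X \<partial>?C \<partial>lborel)"
  proof (rule nn_integral_cong)
    \<comment> \<open>As an involution preserving the measure, \<open>reflect z\<close> can be moved
      from \<open>multilinear F\<close> onto the weight.\<close>
    fix z :: "(real ^ 'n) \<times> (real ^ 'm)"
    have "(\<integral>\<^sup>+X. w X * multilinear F (reflect z X) \<partial>?C) =
       (\<integral>\<^sup>+X. w (reflect z (reflect z X)) * multilinear F (reflect z X) \<partial>?C)"
      by (intro nn_integral_cong) (simp add: reflect_reflect)
    also have "\<dots> = (\<integral>\<^sup>+X. w (reflect z X) * multilinear F X \<partial>?C)"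
      by (rule nn_integral_reflect[of "\<lambda>X. w (reflect z X) * multilinear F X"]) measurable
    finally show "(\<integral>\<^sup>+X. w X * multilinear F (reflect z X) \<partial>?C) =
       (\<integral>\<^sup>+X. w (reflect z X) * multilinear F X \<partial>?C)" .
  qed
  also have "\<dots> = (\<integral>\<^sup>+X. \<integral>\<^sup>+z. w (reflect z X) * multilinear F X \<partial>lborel \<partial>?C)"
    by (rule pair_sigma_finite.Fubini'[OF ps]) (simp add: case_prod_beta)
  also have "\<dots> = (\<integral>\<^sup>+X. (\<integral>\<^sup>+z. w (reflect z X) \<partial>lborel) * multilinear F X \<partial>?C)"
  proof (intro nn_integral_cong nn_integral_multc)
    fix X assume "X \<in> space ?C"
    then show "(\<lambda>z. w (reflect z X)) \<in> borel_measurable ?P"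
      using measurable_compose[OF measurable_Pair1' wr] by simp
  qed
  also have "\<dots> \<le> (\<integral>\<^sup>+X. K * multilinear F X \<partial>?C)"
    unfolding w_def K_def
    by (intro nn_integral_mono mult_right_mono nn_integral_slice_weight_reflect_le d) auto
  also have "\<dots> = K * (\<integral>\<^sup>+X. multilinear F X \<partial>?C)" by (rule nn_integral_cmult) simp
  also have "\<dots> \<le> K * (\<integral>\<^sup>+z. F z \<partial>lborel) ^ N"
    by (intro mult_left_mono nn_integral_multilinear_le F) simp
  also have "\<dots> < \<infinity>" using K fin by (simp add: ennreal_mult_less_top power_less_top_ennreal)
  finally have "(\<integral>\<^sup>+X. w X * (\<integral>\<^sup>+z. multilinear F (reflect z X) \<partial>lborel) \<partial>?C) \<noteq> \<infinity>" by simp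
  moreover have "(\<lambda>X. w X * (\<integral>\<^sup>+z. multilinear F (reflect z X) \<partial>lborel)) \<in> borel_measurable ?C"
    by (intro borel_measurable_times_ennreal w lborel.borel_measurable_nn_integral)
       (simp add: case_prod_beta)
  ultimately have "AE X in ?C. w X * (\<integral>\<^sup>+z. multilinear F (reflect z X) \<partial>lborel) \<noteq> \<infinity>"
    by (intro nn_integral_PInf_AE)
  moreover have "AE X in ?C. \<forall>k\<in>{..<CARD('n)}. pivot (slope c X) k \<noteq> 0"
    by (rule AE_finite_allI) (auto intro!: AE_pivot_slope_nonzero d)
  ultimately show ?thesis
  proof eventually_elim
    case (elim X)
    \<comment> \<open>The weight vanishes only where a pivot does. Off that null set the finite
      product forces a finite orbit integral.\<close>
    have "0 < w X"
      unfolding w_def slice_weight_def using elim hm_pos hr_pos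
      by (auto simp: zero_less_iff_neq_zero intro!: ennreal_prod_nonzero)
    then show ?case using elim by (auto simp: ennreal_mult_eq_top_iff less_top)
  qed
qed

lemma nn_integral_reflect_slice:
  fixes F :: "(real ^ 'n) \<times> (real ^ 'm::finite) \<Rightarrow> ennreal"
  assumes [measurable]: "F \<in> borel_measurable borel"
  shows "(\<integral>\<^sup>+t. F (z - (t, poly_of X t)) \<partial>lborel) = (\<integral>\<^sup>+t. F (t, poly_of (reflect z X) t) \<partial>lborel)"
proof -
  obtain x y where z: "z = (x, y)" by fastforce
  have cont: "continuous_on UNIV (poly_of X)"
    unfolding poly_of_def \<phi>_def by (intro continuous_intros)
  have [measurable]: "poly_of X \<in> borel_measurable borel"
    using cont by (rule borel_measurable_continuous_onI)
  let ?g = "\<lambda>t. F (t, y - poly_of X (x - t))"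
  have "(\<integral>\<^sup>+t. F (z - (t, poly_of X t)) \<partial>lborel) = (\<integral>\<^sup>+t. ?g (x - t) \<partial>lborel)"
    by (simp add: z)
  also have "\<dots> = (\<integral>\<^sup>+t. ?g (x + t) \<partial>lborel)"
    using nn_integral_lborel_scale[of "\<lambda>t. ?g (x + t)" "-1"] by simp
  also have "\<dots> = (\<integral>\<^sup>+t. ?g t \<partial>lborel)"
    by (rule nn_integral_lborel_shift) measurable
  finally show ?thesis by (simp add: z poly_of_reflect)
qed

text \<open>For the reflected polynomial, the \<open>q\<close>-th power of the multilinear bound is
  linear in the multilinear form, which is integrable over almost every orbit. Since
  \<open>enn2real\<close> sends infinity to 0, finiteness almost everywhere is a separate
  conjunct.\<close>

lemma AE_slice_integrals:
  fixes f :: "(real ^ 'n) \<times> (real ^ 'm::finite) \<Rightarrow> complex"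
  assumes d: "d \<ge> 2" and p: "p = 1 + real CARD('m) / s" and q: "q = real N * p"
    and f [measurable]: "f \<in> borel_measurable borel"
    and fin: "(\<integral>\<^sup>+z. ennreal (norm (f z) powr p) \<partial>lborel) < \<infinity>"
  shows "AE X in coeffs.
     (AE z in lborel. (\<integral>\<^sup>+t. ennreal (norm (f (z - (t, poly_of X t)))) \<partial>lborel) < \<infinity>) \<and>
     (\<integral>\<^sup>+z. ennreal (enn2real (\<integral>\<^sup>+t. ennreal (norm (f (z - (t, poly_of X t)))) \<partial>lborel) powr q) \<partial>lborel) < \<infinity>"
proof -
  let ?C = "coeffs :: (nat \<Rightarrow> real ^ 'm) measure"
  let ?F = "\<lambda>z. ennreal (norm (f z) powr p)"
  have p1: "p > 1" using p s_pos by simp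
  have q0: "q > 0" using q p1 N_pos by simp
  obtain C where C: "C > 0" "\<And>u J. u \<in> borel_measurable borel \<Longrightarrow> (\<And>t. 0 \<le> u t) \<Longrightarrow> 0 \<le> J \<Longrightarrow>
     (\<integral>\<^sup>+t. (\<Prod>k<N. pivots CARD('m) t k * ennreal (u (t k) powr p)) \<partial>PiM {..<N} (\<lambda>_. lborel)) \<le> ennreal J \<Longrightarrow>
     (\<integral>\<^sup>+t. ennreal (u t) \<partial>lborel) \<le> ennreal (C * J powr (1 / (real N * p)))"
  proof (rule ex_bound_nn_integral_multilinear[OF p])
    show "1 \<le> CARD('m)" by (simp add: Suc_leI)
  qed blast
  define H where "H X z = (\<integral>\<^sup>+t. ennreal (norm (f (z - (t, poly_of X t)))) \<partial>lborel)"
    for X :: "nat \<Rightarrow> real ^ 'm" and z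
  have H: "H X z \<le> ennreal (C * J powr (1 / q))"
    if J: "multilinear ?F (reflect z X) \<le> ennreal J" "0 \<le> J" for X z J
  proof -
    let ?u = "\<lambda>t. norm (f (t, poly_of (reflect z X) t))"
    have [measurable]: "poly_of (reflect z X) \<in> borel_measurable borel"
      unfolding poly_of_def \<phi>_def by (intro borel_measurable_continuous_onI continuous_intros)
    have "H X z = (\<integral>\<^sup>+t. ennreal (?u t) \<partial>lborel)"
      unfolding H_def by (rule nn_integral_reflect_slice[of "\<lambda>z. ennreal (norm (f z))"]) measurable
    also have "\<dots> \<le> ennreal (C * J powr (1 / (real N * p)))"
      using J by (intro C(2)) (auto simp: multilinear_def)
    finally show ?thesis by (simp add: q)
  qed
  have "AE X in ?C. (\<integral>\<^sup>+z. multilinear ?F (reflect z X) \<partial>lborel) < \<infinity>"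
    by (rule AE_nn_integral_multilinear_reflect[OF d _ fin]) measurable
  moreover have "AE X in ?C. X \<in> space ?C" by simp
  ultimately have "AE X in ?C. (AE z in lborel. H X z < \<infinity>) \<and>
     (\<integral>\<^sup>+z. ennreal (enn2real (H X z) powr q) \<partial>lborel) < \<infinity>"
  proof eventually_elim
    case (elim X)
    let ?J = "\<lambda>z. multilinear ?F (reflect z X)"
    have Jm [measurable]: "?J \<in> borel_measurable borel"
      using measurable_compose[OF measurable_compose[OF measurable_Pair2'[OF elim(2)] measurable_reflect_pair]
          measurable_multilinear, of ?F] by simp
    have "AE z in lborel. ?J z \<noteq> \<infinity>"
      using elim(1) by (intro nn_integral_PInf_AE) auto
    then have "AE z in lborel. H X z < \<infinity>"
    proof eventually_elim
      case (elim z)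
      then obtain J where J: "?J z = ennreal J" "0 \<le> J" by (cases "?J z") auto
      from H[of z X J] J have "H X z \<le> ennreal (C * J powr (1 / q))" by simp
      then show ?case using ennreal_less_top order_le_less_trans by (metis infinity_ennreal_def)
    qed
    moreover have "ennreal (enn2real (H X z) powr q) \<le> ennreal (C powr q) * ?J z" for z
    proof (cases "?J z")
      case (real J)
      then have "H X z \<le> ennreal (C * J powr (1 / q))" by (intro H) auto
      then have "enn2real (H X z) \<le> C * J powr (1 / q)"
        using C(1) by (intro enn2real_leI) auto
      then have "enn2real (H X z) powr q \<le> (C * J powr (1 / q)) powr q"
        using q0 by (intro powr_mono2) auto
      also have "\<dots> = C powr q * J"
        using C(1) q0 real by (simp add: powr_mult powr_powr)
      finally show ?thesis using real by (simp add: ennreal_leI flip: ennreal_mult)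
    next
      case top
      then show ?thesis using C(1) by (simp add: ennreal_mult_top)
    qed
    then have "(\<integral>\<^sup>+z. ennreal (enn2real (H X z) powr q) \<partial>lborel) \<le> (\<integral>\<^sup>+z. ennreal (C powr q) * ?J z \<partial>lborel)"
      by (intro nn_integral_mono)
    then have "(\<integral>\<^sup>+z. ennreal (enn2real (H X z) powr q) \<partial>lborel) \<le> ennreal (C powr q) * (\<integral>\<^sup>+z. ?J z \<partial>lborel)"
      by (simp add: nn_integral_cmult)
    then have "(\<integral>\<^sup>+z. ennreal (enn2real (H X z) powr q) \<partial>lborel) < \<infinity>"
      using elim(1) by (auto simp: ennreal_mult_less_top intro: order_le_less_trans)
    ultimately show ?case by blast
  qed
  then show ?thesis unfolding H_def .
qed

section \<open>The two descriptions of the coefficient space\<close>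

definition to_coeffs :: "('m::finite \<times> ('n \<Rightarrow> nat) \<Rightarrow> real) \<Rightarrow> nat \<Rightarrow> real ^ 'm" where
  "to_coeffs c = (\<lambda>l\<in>{..<N}. \<chi> j. c (j, e l))"

lemma poly_tuple_eq: "poly_tuple d c = poly_of (to_coeffs c)"
proof
  fix t :: "real ^ 'n"
  have "(\<Sum>\<alpha>\<in>exponents d. c (j, \<alpha>) * (\<Prod>i\<in>UNIV. (t $ i) ^ \<alpha> i)) = (\<Sum>l<N. c (j, e l) * \<phi> l t)" for j
    unfolding \<phi>_def by (rule sum_e_eq[symmetric])
  then show "poly_tuple d c t = poly_of (to_coeffs c) t"
    by (simp add: poly_tuple_def poly_of_def to_coeffs_def vec_eq_iff mult.commute)
qed

lemma measurable_to_coeffs [measurable]: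
  "to_coeffs \<in> (coeff_measure d :: ('m::finite \<times> ('n \<Rightarrow> nat) \<Rightarrow> real) measure) \<rightarrow>\<^sub>M coeffs"
  unfolding to_coeffs_def
proof (rule measurable_restrict)
  fix l assume "l \<in> {..<N}"
  then have in_E: "(j, e l) \<in> UNIV \<times> exponents d" for j :: 'm using e_in[of l] by simp
  have "(\<lambda>c. c (j, e l)) \<in> borel_measurable (coeff_measure d)" for j :: 'm
    unfolding coeff_measure_def
    using measurable_component_singleton[OF in_E[of j], where M="\<lambda>_. lborel :: real measure"] by simp
  then show "(\<lambda>c. \<chi> j. c (j, e l)) \<in> (coeff_measure d :: ('m \<times> ('n \<Rightarrow> nat) \<Rightarrow> real) measure) \<rightarrow>\<^sub>M lborel"
    by (simp, subst borel_measurable_euclidean_space) (auto simp: Basis_vec_def inner_axis)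
qed

text \<open>Product measures are compared on products of measurable sets. Products of sets of
  scalars pull back under the inverse \<open>\<Phi>\<close> to products again, so
  \<open>\<Phi>\<close> is treated first and then composed with \<open>to_coeffs\<close>.\<close>

lemma distr_to_coeffs:
  "distr (coeff_measure d :: ('m::finite \<times> ('n \<Rightarrow> nat) \<Rightarrow> real) measure) coeffs to_coeffs = coeffs"
proof -
  let ?C = "coeffs :: (nat \<Rightarrow> real ^ 'm) measure"
  let ?I = "(UNIV :: 'm set) \<times> (exponents d :: ('n \<Rightarrow> nat) set)"
  let ?D = "coeff_measure d :: ('m \<times> ('n \<Rightarrow> nat) \<Rightarrow> real) measure"
  define \<Phi> where "\<Phi> X = (\<lambda>w\<in>?I. X (index (snd w)) $ fst w)" for X :: "nat \<Rightarrow> real ^ 'm"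
  have \<Phi>m [measurable]: "\<Phi> \<in> ?C \<rightarrow>\<^sub>M ?D"
    unfolding \<Phi>_def coeff_measure_def
  proof (rule measurable_restrict)
    fix w assume "w \<in> ?I"
    then have "index (snd w) < N" by (auto intro: index_less)
    then have "(\<lambda>X. X (index (snd w)) $ fst w) \<in> borel_measurable ?C"
      by (intro measurable_compose[OF measurable_component]) auto
    then show "(\<lambda>X. X (index (snd w)) $ fst w) \<in> ?C \<rightarrow>\<^sub>M lborel" by simp
  qed
  have "distr ?C ?D \<Phi> = ?D"
    unfolding coeff_measure_def[of d]
  proof (rule PL.PiM_eqI)
    fix A :: "'m \<times> ('n \<Rightarrow> nat) \<Rightarrow> real set" assume A: "\<And>w. w \<in> ?I \<Longrightarrow> A w \<in> sets lborel"
    define B where "B l = {y :: real ^ 'm. \<forall>j. y $ j \<in> A (j, e l)}" for l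
    have Am: "A (j, e l) \<in> sets borel" if "l < N" for j l using A[of "(j, e l)"] e_in[OF that] by simp
    have Bm: "B l \<in> sets borel" if "l < N" for l
      unfolding B_def using emeasure_lborel_vec_box(2)[of "\<lambda>j. A (j, e l)"] Am[OF that] by simp
    have "\<Phi> -` (PiE ?I A) \<inter> space ?C = PiE {..<N} B"
    proof (intro set_eqI iffI)
      fix X assume X: "X \<in> \<Phi> -` (PiE ?I A) \<inter> space ?C"
      then have "X l $ j \<in> A (j, e l)" if "l < N" for j l
        using e_in[OF that] PiE_mem[of "\<Phi> X" ?I A "(j, e l)"] that by (simp add: \<Phi>_def index_e)
      then show "X \<in> PiE {..<N} B" using X by (auto simp: B_def space_PiM PiE_iff)
    next
      fix X assume X: "X \<in> PiE {..<N} B"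
      have "X (index \<alpha>) $ j \<in> A (j, \<alpha>)" if "\<alpha> \<in> exponents d" for j \<alpha>
        using PiE_mem[OF X, of "index \<alpha>"] index_less[OF that] e_index[OF that] by (simp add: B_def)
      then show "X \<in> \<Phi> -` (PiE ?I A) \<inter> space ?C"
        using X by (auto simp: \<Phi>_def space_PiM PiE_iff)
    qed
    then have "emeasure (distr ?C (PiM ?I (\<lambda>_. lborel)) \<Phi>) (PiE ?I A) = emeasure ?C (PiE {..<N} B)"
      using \<Phi>m A unfolding coeff_measure_def
      by (subst emeasure_distr) (auto intro!: sets_PiM_I_finite)
    also have "\<dots> = (\<Prod>l<N. emeasure lborel (B l))"
      using Bm by (intro PL.emeasure_PiM) auto
    also have "\<dots> = (\<Prod>l<N. \<Prod>j\<in>UNIV. emeasure lborel (A (j, e l)))"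
    proof (intro prod.cong refl)
      fix l assume "l \<in> {..<N}"
      then show "emeasure lborel (B l) = (\<Prod>j\<in>UNIV. emeasure lborel (A (j, e l)))"
        unfolding B_def using emeasure_lborel_vec_box(1)[of "\<lambda>j. A (j, e l)"] Am[of l] by simp
    qed
    also have "\<dots> = (\<Prod>\<alpha>\<in>exponents d. \<Prod>j\<in>UNIV. emeasure lborel (A (j, \<alpha>)))"
      by (rule prod.reindex_bij_betw[OF e_bij])
    also have "\<dots> = (\<Prod>j\<in>UNIV. \<Prod>\<alpha>\<in>exponents d. emeasure lborel (A (j, \<alpha>)))"
      by (rule prod.swap)
    also have "\<dots> = (\<Prod>w\<in>?I. emeasure lborel (A w))"
      by (simp add: prod.cartesian_product)
    finally show "emeasure (distr ?C (PiM ?I (\<lambda>_. lborel)) \<Phi>) (PiE ?I A) = (\<Prod>w\<in>?I. emeasure lborel (A w))" .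
  qed simp_all
  then have "distr ?D ?C to_coeffs = distr (distr ?C ?D \<Phi>) ?C to_coeffs" by simp
  also have "\<dots> = distr ?C ?C (to_coeffs \<circ> \<Phi>)" by (rule distr_distr) measurable
  also have "\<dots> = distr ?C ?C (\<lambda>X. X)"
  proof (rule distr_cong)
    fix X assume X: "X \<in> space ?C"
    show "(to_coeffs \<circ> \<Phi>) X = X"
    proof
      fix l
      show "(to_coeffs \<circ> \<Phi>) X l = X l"
        using X e_in[of l] by (cases "l < N")
          (auto simp: to_coeffs_def \<Phi>_def index_e vec_eq_iff space_PiM PiE_iff extensional_def)
    qed
  qed simp_all
  also have "\<dots> = ?C" by (rule distr_id)
  finally show ?thesis .
qed

lemma AE_coeff_measure:
  assumes "AE X in (coeffs :: (nat \<Rightarrow> real ^ 'm::finite) measure). P X"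
  shows "AE c in (coeff_measure d :: ('m \<times> ('n \<Rightarrow> nat) \<Rightarrow> real) measure). P (to_coeffs c)"
proof -
  have "AE X in distr (coeff_measure d :: ('m \<times> ('n \<Rightarrow> nat) \<Rightarrow> real) measure) coeffs to_coeffs. P X"
    unfolding distr_to_coeffs by (rule assms)
  then show ?thesis by (rule AE_distrD[OF measurable_to_coeffs])
qed

end

section \<open>Lebesgue measurable functions\<close>

lemma borel_measurable_lebesgue_AE_cong:
  fixes f g :: "'a::euclidean_space \<Rightarrow> 'b::topological_space"
  assumes g: "g \<in> borel_measurable lebesgue" and ae: "AE x in lebesgue. f x = g x"
  shows "f \<in> borel_measurable lebesgue"
proof (rule measurableI)
  fix B :: "'b set" assume B: "B \<in> sets borel"
  have "g -` B \<in> sets lebesgue" using measurable_sets[OF g B] by simp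
  moreover have "AE x in lebesgue. x \<in> g -` B \<longleftrightarrow> x \<in> f -` B" using ae by eventually_elim auto
  ultimately show "f -` B \<inter> space lebesgue \<in> sets lebesgue"
    using completion.in_sets_AE[of "g -` B" "f -` B" "lborel :: 'a measure"] by simp
qed simp

lemma ex_borel_measurable_complex:
  fixes f :: "'a::euclidean_space \<Rightarrow> complex"
  assumes "f \<in> borel_measurable lebesgue"
  obtains g where "g \<in> borel_measurable borel" "AE x in lborel. f x = g x"
proof -
  have "(\<lambda>x. Re (f x)) \<in> borel_measurable lebesgue" "(\<lambda>x. Im (f x)) \<in> borel_measurable lebesgue"
    using assms by (auto intro: measurable_compose[OF assms])
  then obtain u v where uv: "u \<in> borel_measurable lborel" "AE x in lborel. Re (f x) = u x"
    "v \<in> borel_measurable lborel" "AE x in lborel. Im (f x) = v x"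
    using completion_ex_borel_measurable_real by metis
  have "(\<lambda>x. Complex (u x) (v x)) \<in> borel_measurable borel"
    using uv by (subst borel_measurable_complex_iff) simp
  moreover have "AE x in lborel. f x = Complex (u x) (v x)"
    using uv(2,4) by eventually_elim (simp add: complex_eq_iff)
  ultimately show ?thesis using that by blast
qed

text \<open>Every translate of the exceptional set is null, and Tonelli exchanges \<open>z\<close>
  and \<open>t\<close>. As a graph is itself a null set, changing a function on a null set is
  harmless only for almost every \<open>z\<close>.\<close>

lemma AE_AE_translate:
  fixes r :: "'a::euclidean_space \<Rightarrow> 'b::euclidean_space"
  assumes r [measurable]: "r \<in> borel_measurable borel" and P: "AE w in lborel. P w"
  shows "AE z in lborel. AE t in lborel. P (z - (t, r t))"
proof -
  obtain S where S: "{w \<in> space lborel. \<not> P w} \<subseteq> S" "S \<in> null_sets (lborel :: ('a \<times> 'b) measure)"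
    using P by (auto elim!: AE_E simp: null_sets_def)
  have Sm [measurable]: "S \<in> sets borel" using S(2) by auto
  have m: "(\<lambda>(z, t). indicator S (z - (t, r t)) :: ennreal) \<in> borel_measurable (lborel \<Otimes>\<^sub>M lborel)"
  proof -
    have "(\<lambda>v. fst v - (snd v, r (snd v))) \<in> borel_measurable ((borel :: ('a \<times> 'b) measure) \<Otimes>\<^sub>M (borel :: 'a measure))"
      by measurable
    from measurable_compose[OF this, of "indicator S"] show ?thesis
      by (simp add: case_prod_beta)
  qed
  have "(\<integral>\<^sup>+z. \<integral>\<^sup>+t. indicator S (z - (t, r t)) \<partial>lborel \<partial>lborel) =
     (\<integral>\<^sup>+t. \<integral>\<^sup>+z. indicator S (z - (t, r t)) \<partial>lborel \<partial>lborel)"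
    by (rule pair_sigma_finite.Fubini'[symmetric, OF _ m]) (simp add: pair_sigma_finite_def sigma_finite_lborel)
  also have "\<dots> = (\<integral>\<^sup>+t. 0 \<partial>(lborel :: 'a measure))"
  proof (intro nn_integral_cong)
    fix t :: 'a
    have "(\<integral>\<^sup>+z. indicator S (- (t, r t) + z) \<partial>lborel) = (\<integral>\<^sup>+z. indicator S z \<partial>(lborel :: ('a \<times> 'b) measure))"
      by (rule nn_integral_lborel_shift) simp
    then have "(\<integral>\<^sup>+z. indicator S (z - (t, r t)) \<partial>lborel) = emeasure lborel S"
      unfolding uminus_add_conv_diff by simp
    then show "(\<integral>\<^sup>+z. indicator S (z - (t, r t)) \<partial>lborel) = (0 :: ennreal)"
      using S(2) by (simp add: null_sets_def)
  qed
  finally have "(\<integral>\<^sup>+z. \<integral>\<^sup>+t. indicator S (z - (t, r t)) \<partial>lborel \<partial>lborel) = 0" by simp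
  moreover have "(\<lambda>z. \<integral>\<^sup>+t. indicator S (z - (t, r t)) \<partial>lborel) \<in> borel_measurable lborel"
    by (rule lborel.borel_measurable_nn_integral[OF m])
  ultimately have "AE z in lborel. (\<integral>\<^sup>+t. indicator S (z - (t, r t)) \<partial>lborel) = (0 :: ennreal)"
    by (simp add: nn_integral_0_iff_AE)
  then show ?thesis
  proof eventually_elim
    case (elim z)
    have "(\<lambda>t. indicator S (z - (t, r t)) :: ennreal) \<in> borel_measurable lborel"
      using measurable_compose[OF measurable_Pair1' m, of z] by simp
    with elim have "AE t in lborel. indicator S (z - (t, r t)) = (0 :: ennreal)"
      by (simp add: nn_integral_0_iff_AE)
    then show ?case
      by eventually_elim (use S(1) in \<open>auto simp: indicator_def split: if_splits\<close>)
  qed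
qed

text \<open>Passes from the Borel representative \<open>g\<close>, where Tonelli applies, to
  \<open>f\<close> and the completed measures.\<close>

lemma conv_graph_measure_properties:
  fixes f g :: "'a::euclidean_space \<times> 'b::euclidean_space \<Rightarrow> complex" and r :: "'a \<Rightarrow> 'b"
  assumes r: "continuous_on UNIV r" and g [measurable]: "g \<in> borel_measurable borel"
    and fg: "AE w in lborel. f w = g w" and q: "q > 0"
    and fin: "AE z in lborel. (\<integral>\<^sup>+t. ennreal (norm (g (z - (t, r t)))) \<partial>lborel) < \<infinity>"
    and int: "(\<integral>\<^sup>+z. ennreal (enn2real (\<integral>\<^sup>+t. ennreal (norm (g (z - (t, r t)))) \<partial>lborel) powr q) \<partial>lborel) < \<infinity>"
  shows "(AE z in lebesgue. integrable (graph_measure r) (\<lambda>w. f (z - w))) \<and>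
    conv f (graph_measure r) \<in> borel_measurable lebesgue \<and>
    Lp_norm lebesgue q (conv f (graph_measure r)) < \<infinity>"
proof -
  have rm [measurable]: "r \<in> borel_measurable borel"
    using r by (rule borel_measurable_continuous_onI)
  define c where "c z = (LINT t|lborel. g (z - (t, r t)))" for z
  have m: "(\<lambda>(z, t). g (z - (t, r t))) \<in> borel_measurable (lborel \<Otimes>\<^sub>M lborel)"
  proof -
    have "(\<lambda>v. fst v - (snd v, r (snd v))) \<in> borel_measurable ((borel :: ('a \<times> 'b) measure) \<Otimes>\<^sub>M (borel :: 'a measure))"
      by measurable
    from measurable_compose[OF this g] show ?thesis
      by (simp add: case_prod_beta)
  qed
  have gz [measurable]: "(\<lambda>t. g (z - (t, r t))) \<in> borel_measurable borel" for z
    using measurable_compose[OF measurable_Pair1' m, of z] by simp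
  have cm: "c \<in> borel_measurable lborel"
    unfolding c_def using m by (rule lborel.borel_measurable_lebesgue_integral)
  have key: "AE z in lborel. integrable (graph_measure r) (\<lambda>w. f (z - w)) \<and>
     conv f (graph_measure r) z = c z \<and>
     ennreal (norm (c z)) \<le> (\<integral>\<^sup>+t. ennreal (norm (g (z - (t, r t)))) \<partial>lborel) \<and>
     (\<integral>\<^sup>+t. ennreal (norm (g (z - (t, r t)))) \<partial>lborel) < \<infinity>"
    using fin AE_AE_translate[OF rm fg]
  proof eventually_elim
    case (elim z)
    have gi: "integrable lborel (\<lambda>t. g (z - (t, r t)))"
      using elim(1) by (intro integrableI_bounded) auto
    then have gi': "integrable lebesgue (\<lambda>t. g (z - (t, r t)))"
      by (subst integrable_completion) auto
    have ae: "AE t in lebesgue. f (z - (t, r t)) = g (z - (t, r t))"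
      using elim(2) by (rule AE_completion)
    have fm: "(\<lambda>t. f (z - (t, r t))) \<in> borel_measurable lebesgue"
      using borel_measurable_integrable[OF gi'] ae by (rule borel_measurable_lebesgue_AE_cong)
    have "integrable lebesgue (\<lambda>t. f (z - (t, r t)))"
      using gi' fm ae by (subst integrable_cong_AE[of _ _ "\<lambda>t. g (z - (t, r t))"]) auto
    moreover have "conv f (graph_measure r) z = c z"
    proof -
      have "conv f (graph_measure r) z = (LINT t|lebesgue. f (z - (t, r t)))"
        by (simp add: conv_def integral_graph_measure[OF r])
      also have "\<dots> = (LINT t|lebesgue. g (z - (t, r t)))"
        using gi' fm ae by (intro integral_cong_AE) auto
      also have "\<dots> = c z" unfolding c_def by (rule integral_completion) simp
      finally show ?thesis .
    qed
    moreover have "ennreal (norm (c z)) \<le> (\<integral>\<^sup>+t. ennreal (norm (g (z - (t, r t)))) \<partial>lborel)"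
      unfolding c_def using gi by (rule integral_norm_bound_ennreal)
    ultimately show ?case using elim(1) by (simp add: integrable_graph_measure_iff[OF r])
  qed
  have "AE z in lebesgue. integrable (graph_measure r) (\<lambda>w. f (z - w))"
    by (rule AE_completion) (use key in eventually_elim, simp)
  moreover have "conv f (graph_measure r) \<in> borel_measurable lebesgue"
  proof (rule borel_measurable_lebesgue_AE_cong)
    show "c \<in> borel_measurable lebesgue" using cm by (rule measurable_completion)
    show "AE z in lebesgue. conv f (graph_measure r) z = c z"
      by (rule AE_completion) (use key in eventually_elim, simp)
  qed
  moreover have "Lp_norm lebesgue q (conv f (graph_measure r)) < \<infinity>"
  proof -
    have "(\<integral>\<^sup>+z. ennreal (norm (conv f (graph_measure r) z) powr q) \<partial>lebesgue) =
        (\<integral>\<^sup>+z. ennreal (norm (conv f (graph_measure r) z) powr q) \<partial>lborel)"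
      by (rule nn_integral_completion)
    also have "\<dots> \<le> (\<integral>\<^sup>+z. ennreal (enn2real (\<integral>\<^sup>+t. ennreal (norm (g (z - (t, r t)))) \<partial>lborel) powr q) \<partial>lborel)"
    proof (rule nn_integral_mono_AE)
      show "AE z in lborel. ennreal (norm (conv f (graph_measure r) z) powr q) \<le>
         ennreal (enn2real (\<integral>\<^sup>+t. ennreal (norm (g (z - (t, r t)))) \<partial>lborel) powr q)"
        using key
      proof eventually_elim
        case (elim z)
        have "enn2real (ennreal (norm (c z))) \<le> enn2real (\<integral>\<^sup>+t. ennreal (norm (g (z - (t, r t)))) \<partial>lborel)"
          using elim by (intro enn2real_mono) auto
        then show ?case using elim q by (intro ennreal_leI powr_mono2) auto
      qed
    qed
    also have "\<dots> < \<infinity>" by (rule int)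
    finally show ?thesis by (simp add: Lp_norm_def Let_def)
  qed
  ultimately show ?thesis by blast
qed

text \<open>The Bochner integral defaults to 0 and \<open>Lp_norm\<close> does not test
  measurability, so integrability for almost every \<open>z\<close> and measurability are part of
  the conclusion.\<close>

theorem corollary1:
  fixes f :: "(real ^ 'n::finite) \<times> (real ^ 'm::finite) \<Rightarrow> complex"
    and d :: nat and p q :: real
  assumes "d \<ge> 2"
    and "p = 1 + real CARD('m) * real d / (real CARD('n) + 1)"
    and "q = real ((CARD('n) + d) choose d) * p"
    and "f \<in> Lp_space lebesgue p"
  shows "AE c in coeff_measure d :: ('m \<times> ('n \<Rightarrow> nat) \<Rightarrow> real) measure.
    (AE z in lebesgue. integrable (graph_measure (poly_tuple d c)) (\<lambda>w. f (z - w))) \<and>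
    conv f (graph_measure (poly_tuple d c)) \<in> borel_measurable lebesgue \<and>
    Lp_norm lebesgue q (conv f (graph_measure (poly_tuple d c))) < \<infinity>"
proof -
  obtain js :: "'n list" where js: "distinct js" "set js = UNIV"
    using finite_distinct_list[of "UNIV :: 'n set"] by auto
  obtain e where e: "bij_betw e {..<card (exponents d :: ('n \<Rightarrow> nat) set)} (exponents d :: ('n \<Rightarrow> nat) set)"
    "\<And>r k. r < k \<Longrightarrow> k < card (exponents d :: ('n \<Rightarrow> nat) set) \<Longrightarrow> lexless js (e r) (e k)"
    using ex_increasing_enumeration[of "exponents d :: ('n \<Rightarrow> nat) set" "lexless js"]
      lexless_irrefl[of js] lexless_trans[of js] lexless_total[of js] js(2) by auto
  interpret exponent_enumeration d js e "card (exponents d :: ('n \<Rightarrow> nat) set)"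
    using assms(1) js e by unfold_locales auto
  let ?N = "card (exponents d :: ('n \<Rightarrow> nat) set)"
  have p: "p = 1 + real CARD('m) / s" by (simp add: assms(2) s_def)
  have q: "q = real ?N * p" using assms(3) N_eq by simp
  have q0: "q > 0"
    unfolding q using N_pos s_pos by (simp add: p add_pos_nonneg)
  obtain g where g: "g \<in> borel_measurable borel" "AE w in lborel. f w = g w"
    using ex_borel_measurable_complex assms(4) unfolding Lp_space_def by blast
  have "(\<integral>\<^sup>+z. ennreal (norm (f z) powr p) \<partial>lebesgue) < \<infinity>"
    using assms(4) by (auto simp: Lp_space_def Lp_norm_def Let_def less_top split: if_splits)
  also have "(\<integral>\<^sup>+z. ennreal (norm (f z) powr p) \<partial>lebesgue) = (\<integral>\<^sup>+z. ennreal (norm (f z) powr p) \<partial>lborel)"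
    by (rule nn_integral_completion)
  also have "\<dots> = (\<integral>\<^sup>+z. ennreal (norm (g z) powr p) \<partial>lborel)"
    by (intro nn_integral_cong_AE) (use g(2) in eventually_elim, simp)
  finally have fin: "(\<integral>\<^sup>+z. ennreal (norm (g z) powr p) \<partial>lborel) < \<infinity>" .
  from AE_coeff_measure[OF AE_slice_integrals[OF assms(1) p q g(1) fin]]
  show ?thesis
  proof eventually_elim
    case (elim c)
    show ?case
      using elim unfolding poly_tuple_eq[symmetric]
      by (intro conv_graph_measure_properties[OF continuous_on_poly_tuple g q0]) auto
  qed
qed

end
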